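(* Let $G\subset GL(p,\mathbb{R})$ be a connected linear Lie group with Lie algebra $\mathfrak{g}\subset M_p(\mathbb{R})$. Then the following conditions are equivalent: (1) $\mathfrak{g}\cong\theta[G]_0(p)$ as $\mathbb{R}$-vector spaces; (2) for any $\eta=\sum_{i=1}^p\eta_i(y)\frac{\partial}{\partial y_i}\in\theta[G]_0(p)$, the component functions $\eta_i(y)$ $(i=1,\dots,p)$ are linear functions; (3) $\mathrm{Diff}_0[G](p)=G$.
   Context: All maps and germs are of class $C^\infty$. $M_p(\mathbb{R})$ is the space of real $p\times p$ matrices, and $\mathfrak{g}=T_IG\subset M_p(\mathbb{R})$ is the Lie algebra of the linear Lie group $G$. $\theta[G]_0(p)$ is the real vector space of germs at $0\in\mathbb{R}^p$ of smooth vector fields $\eta=\sum_{i=1}^p\eta_i(y)\frac{\partial}{\partial y_i}$ such that the matrix $\left(\frac{\partial\eta_i}{\partial y_j}(y)\right)\in\mathfrak{g}$ for all $y$ near $0$, and $\eta_i(0)=0$ for all $i$. $\mathrm{Diff}[G](p)$ is the group of germs of diffeomorphisms $\psi:(\mathbb{R}^p,0)\to(\mathbb{R}^p,0)$ whose Jacobi matrix satisfies $J_\psi(y)\in G$ for all $y$ near $0$. An element $\psi\in\mathrm{Diff}[G](p)$ is isotopic to the identity if there is a smooth family (map germ along $0\times[0,1]$) $\Psi:(\mathbb{R}^p\times\mathbb{R},0\times[0,1])\to(\mathbb{R}^p,0)$ such that, with $\psi_t(y)=\Psi(y,t)$, one has $\psi_t\in\mathrm{Diff}[G](p)$ for all $t$,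 $\psi_0=1_{\mathbb{R}^p}$ and $\psi_1=\psi$. $\mathrm{Diff}_0[G](p)$ is the set of $\psi\in\mathrm{Diff}[G](p)$ isotopic to the identity. $G$ is regarded as a subset of $\mathrm{Diff}[G](p)$ by identifying $A\in G$ with the germ at $0$ of the linear isomorphism $\psi_A(y)=Ay$; condition (3) is understood with this identification. *)

theory Defs
  imports "HOL-Analysis.Analysis"
begin

section \<open>Smooth maps\<close>

text \<open>
  \<open>Ck_on k S f\<close> is meant for open \<open>S\<close>.  In finite dimensions, being \<open>C\<^sup>k\<^sup>+\<^sup>1\<close> means being
  differentiable with all directional derivatives of class \<open>C\<^sup>k\<close>; using directional
  derivatives keeps the type of \<open>f\<close> fixed in the recursion.
\<close>

primrec Ck_on :: "nat \<Rightarrow> 'a::euclidean_space set \<Rightarrow> ('a \<Rightarrow> 'b::euclidean_space) \<Rightarrow> bool" where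
  "Ck_on 0 S f \<longleftrightarrow> continuous_on S f"
| "Ck_on (Suc k) S f \<longleftrightarrow>
     (\<forall>x\<in>S. f differentiable (at x)) \<and>
     (\<forall>v. Ck_on k S (\<lambda>x. frechet_derivative f (at x) v))"

definition smooth_on :: "'a::euclidean_space set \<Rightarrow> ('a \<Rightarrow> 'b::euclidean_space) \<Rightarrow> bool" where
  "smooth_on S f \<longleftrightarrow> (\<forall>k. Ck_on k S f)"


section \<open>Germs at the origin\<close>

text \<open>
  Germs of maps are classes of total functions; the values away from the origin are irrelevant,
  so this is the usual notion for maps defined only near the origin.
\<close>

quotient_type (overloaded) ('a, 'b) germ =
  "'a::{topological_space, zero} \<Rightarrow> 'b" / "\<lambda>f g. \<forall>\<^sub>F x in nhds 0. f x = g x"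
  morphisms rep_germ germ_of
proof (rule equivpI)
  show "reflp (\<lambda>f g :: 'a \<Rightarrow> 'b. \<forall>\<^sub>F x in nhds 0. f x = g x)"
    by (simp add: reflp_def)
  show "symp (\<lambda>f g :: 'a \<Rightarrow> 'b. \<forall>\<^sub>F x in nhds 0. f x = g x)"
    by (simp add: symp_def eq_commute)
  show "transp (\<lambda>f g :: 'a \<Rightarrow> 'b. \<forall>\<^sub>F x in nhds 0. f x = g x)"
  proof (rule transpI)
    fix f g h :: "'a \<Rightarrow> 'b"
    assume "\<forall>\<^sub>F x in nhds 0. f x = g x" "\<forall>\<^sub>F x in nhds 0. g x = h x"
    then show "\<forall>\<^sub>F x in nhds 0. f x = h x" by eventually_elim simp
  qed
qed

instantiation germ :: ("{topological_space, zero}", real_vector) real_vector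
begin

lift_definition zero_germ :: "('a, 'b) germ" is "\<lambda>x. 0" .

lift_definition plus_germ :: "('a, 'b) germ \<Rightarrow> ('a, 'b) germ \<Rightarrow> ('a, 'b) germ"
  is "\<lambda>f g x. f x + g x"
  by (auto elim: eventually_elim2)

lift_definition minus_germ :: "('a, 'b) germ \<Rightarrow> ('a, 'b) germ \<Rightarrow> ('a, 'b) germ"
  is "\<lambda>f g x. f x - g x"
  by (auto elim: eventually_elim2)

lift_definition uminus_germ :: "('a, 'b) germ \<Rightarrow> ('a, 'b) germ" is "\<lambda>f x. - f x"
  by (auto elim: eventually_mono)

lift_definition scaleR_germ :: "real \<Rightarrow> ('a, 'b) germ \<Rightarrow> ('a, 'b) germ" is "\<lambda>c f x. c *\<^sub>R f x"
  by (auto elim: eventually_mono)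

instance
  by standard (transfer; simp add: algebra_simps)+

end

lift_definition component_germ :: "('a::{topological_space, zero}, real ^ 'n) germ \<Rightarrow> 'n \<Rightarrow> ('a, real) germ"
  is "\<lambda>f i x. f x $ i"
  by (auto elim: eventually_mono)

definition linear_germ :: "('a::real_normed_vector, 'b::real_normed_vector) germ \<Rightarrow> bool" where
  "linear_germ \<phi> \<longleftrightarrow> (\<exists>L. linear L \<and> \<phi> = germ_of L)"


section \<open>Linear Lie groups and their Lie algebras\<close>

definition GL :: "(real ^ 'p ^ 'p) set" where
  "GL = {A. invertible A}"

text \<open>A linear Lie group is a subgroup of the general linear group that is closed in it.\<close>

definition linear_Lie_group :: "(real ^ 'p ^ 'p) set \<Rightarrow> bool" where
  "linear_Lie_group G \<longleftrightarrow>
     G \<subseteq> GL \<and> mat 1 \<in> G \<and> (\<forall>A\<in>G. \<forall>B\<in>G. A ** B \<in> G) \<and> (\<forall>A\<in>G. matrix_inv A \<in> G) \<and>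
     closedin (top_of_set GL) G"

text \<open>The tangent space of \<open>G\<close> at the identity, as the set of velocities of smooth curves in \<open>G\<close>.\<close>

definition lie_algebra :: "(real ^ 'p ^ 'p) set \<Rightarrow> (real ^ 'p ^ 'p) set" where
  "lie_algebra G =
     {X. \<exists>\<gamma> e. e > 0 \<and> smooth_on {-e<..<e} \<gamma> \<and> \<gamma> ` {-e<..<e} \<subseteq> G \<and> \<gamma> 0 = mat 1 \<and>
           (\<gamma> has_vector_derivative X) (at (0::real))}"

text \<open>Linear isomorphism of real vector spaces that are given as subspaces of ambient types.\<close>

definition lin_isomorphic :: "'a::real_vector set \<Rightarrow> 'b::real_vector set \<Rightarrow> bool" where
  "lin_isomorphic V W \<longleftrightarrow>
     (\<exists>f. bij_betw f V W \<and> (\<forall>x\<in>V. \<forall>y\<in>V. f (x + y) = f x + f y) \<and>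
          (\<forall>c. \<forall>x\<in>V. f (c *\<^sub>R x) = c *\<^sub>R f x))"


section \<open>Vector fields and diffeomorphisms with Jacobi matrices in a Lie algebra or group\<close>

text \<open>A vector field is identified with the map whose components are its coefficients.\<close>

definition theta0 :: "(real ^ 'p ^ 'p) set \<Rightarrow> (real ^ 'p, real ^ 'p) germ set" where
  "theta0 G =
     {germ_of f | f. \<exists>U. open U \<and> 0 \<in> U \<and> smooth_on U f \<and> f 0 = 0 \<and>
                       (\<forall>y\<in>U. jacobian f (at y) \<in> lie_algebra G)}"

definition Diff :: "(real ^ 'p ^ 'p) set \<Rightarrow> (real ^ 'p, real ^ 'p) germ set" where
  "Diff G =
     {germ_of f | f. \<exists>U V g. open U \<and> open V \<and> 0 \<in> U \<and> f 0 = 0 \<and>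
                       homeomorphism U V f g \<and> smooth_on U f \<and> smooth_on V g \<and>
                       (\<forall>y\<in>U. jacobian f (at y) \<in> G)}"

definition isotopic_to_id ::
  "(real ^ 'p ^ 'p) set \<Rightarrow> (real ^ 'p, real ^ 'p) germ \<Rightarrow> bool" where
  "isotopic_to_id G \<psi> \<longleftrightarrow>
     (\<exists>\<Psi> :: (real ^ 'p) \<times> real \<Rightarrow> real ^ 'p. \<exists>U.
        open U \<and> {0} \<times> {0..1} \<subseteq> U \<and> smooth_on U \<Psi> \<and> (\<forall>t\<in>{0..1}. \<Psi> (0, t) = 0) \<and>
        (\<forall>t\<in>{0..1}. germ_of (\<lambda>y. \<Psi> (y, t)) \<in> Diff G) \<and>
        germ_of (\<lambda>y. \<Psi> (y, 0)) = germ_of (\<lambda>y. y) \<and>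
        germ_of (\<lambda>y. \<Psi> (y, 1)) = \<psi>)"

definition Diff0 :: "(real ^ 'p ^ 'p) set \<Rightarrow> (real ^ 'p, real ^ 'p) germ set" where
  "Diff0 G = {\<psi> \<in> Diff G. isotopic_to_id G \<psi>}"

definition matrix_germ :: "real ^ 'p ^ 'p \<Rightarrow> (real ^ 'p, real ^ 'p) germ" where
  "matrix_germ A = germ_of (\<lambda>y. A *v y)"

end

theory Submission
  imports Defs
begin

text \<open>
  All three conditions are equivalent to the vanishing of the first prolongation of \<open>\<gg>\<close>: every
  symmetric bilinear \<open>B\<close> with \<open>B(v, \<cdot>) \<in> \<gg>\<close> for all \<open>v\<close> is zero.  Such a \<open>B\<close> gives the quadratic
  field \<open>B(y, y)/2\<close> in \<open>\<theta>[G]\<^sub>0\<close>, and conversely the second derivative of a field in \<open>\<theta>[G]\<^sub>0\<close>, or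
  \<open>J\<^sup>-\<^sup>1 D\<^sub>v J\<close> for the Jacobi matrix \<open>J\<close> of an element of \<open>Diff[G]\<close>, is such a \<open>B\<close> at every point; so if
  the prolongation vanishes, everything is linear (isotopy is not needed).  If it does not vanish,
  the flow of a small multiple of \<open>B(y, y)/2\<close>, given by a power series, is a nonlinear isotopy in
  \<open>Diff[G]\<close>: its Jacobi matrices solve \<open>M' = X(t) M\<close> with \<open>X(t) \<in> \<gg>\<close>, and such solutions stay in
  \<open>G\<close> because their distance to \<open>G\<close> satisfies a Gronwall inequality.  The same invariance argument shows
  that sequential tangent vectors of \<open>G\<close> at \<open>1\<close> lie in \<open>\<gg>\<close>, which makes a neighbourhood of
  \<open>1\<close> in \<open>G\<close> accessible by products of smooth curves; hence \<open>G \<subseteq> Diff\<^sub>0[G]\<close> for connected \<open>G\<close>.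
\<close>

section \<open>Differential calculus of smooth maps\<close>

text \<open>Condition (1) speaks of an arbitrary isomorphism, not of the inclusion of the linear
  fields. It forces linearity only because \<open>lie_algebra G\<close> has finite dimension:
  comparison with \<open>matrix_germ\<close> gives an injective endomorphism, which must be onto.
  The obstacle in (3) is that an isotopy must be jointly smooth in space and time near the whole of
  {0} x [0, 1]. A power series in the pair \<open>(y, t)\<close> gives this at once, provided that
  it converges up to time 1; shrinking the field by a positive factor ensures that. The same series
  supplies the solutions of M' = Y M that take the place of the matrix exponential. \<open>G\<close>
  is closed only in \<open>GL\<close>. The Gronwall argument therefore ends in
  \<open>closure G\<close>, and invertibility is proved separately, each time by running the
  solution backwards. Tangent vectors are sequential because compactness of the unit sphere, the
  only source of tangent directions from bare elements of \<open>G\<close>, yields no more than a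
  convergent subsequence.\<close>

lemma Ck_on_cong:
  assumes "open S" "\<And>x. x \<in> S \<Longrightarrow> f x = g x" "Ck_on k S f"
  shows "Ck_on k S g"
  using assms(2,3)
proof (induction k arbitrary: f g)
  case 0
  then show ?case by (metis Ck_on.simps(1) continuous_on_cong)
next
  case (Suc k)
  have "g differentiable at x" if "x \<in> S" for x
    using Suc.prems that assms(1) unfolding differentiable_def
    by (metis (no_types, lifting) Ck_on.simps(2) differentiable_def has_derivative_transform_within_open)
  moreover have "Ck_on k S (\<lambda>x. frechet_derivative g (at x) v)" for v
  proof (rule Suc.IH)
    show "Ck_on k S (\<lambda>x. frechet_derivative f (at x) v)"
      using Suc.prems by auto
    show "frechet_derivative f (at x) v = frechet_derivative g (at x) v" if "x \<in> S" for x
      using frechet_derivative_transform_within_open[of f x S g] Suc.prems assms(1) that by auto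
  qed
  ultimately show ?case by simp
qed

lemma Ck_on_SucI:
  assumes "open S" "\<And>x. x \<in> S \<Longrightarrow> (f has_derivative f' x) (at x)"
    and "\<And>v. Ck_on k S (\<lambda>x. f' x v)"
  shows "Ck_on (Suc k) S f"
proof -
  have "Ck_on k S (\<lambda>x. frechet_derivative f (at x) v)" for v
  proof (rule Ck_on_cong[OF assms(1) _ assms(3)])
    show "f' x v = frechet_derivative f (at x) v" if "x \<in> S" for x
      using frechet_derivative_at[OF assms(2)[OF that]] by simp
  qed
  then show ?thesis using assms(2) by (auto intro: differentiableI)
qed

lemma Ck_on_SucE:
  assumes "Ck_on (Suc k) S f"
  obtains f' where "\<And>x. x \<in> S \<Longrightarrow> (f has_derivative f' x) (at x)" "\<And>v. Ck_on k S (\<lambda>x. f' x v)"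
  using assms frechet_derivative_works by (metis Ck_on.simps(2))

lemma Ck_on_Suc_imp: "Ck_on (Suc k) S f \<Longrightarrow> Ck_on k S f"
proof (induction k arbitrary: f)
  case 0
  then have "f differentiable_on S"
    by (simp add: differentiable_on_def differentiable_at_withinI)
  then show ?case
    by (simp add: differentiable_imp_continuous_on)
qed auto

lemma Ck_on_subset: "Ck_on k S f \<Longrightarrow> T \<subseteq> S \<Longrightarrow> Ck_on k T f"
  by (induction k arbitrary: f) (auto intro: continuous_on_subset)

lemma Ck_on_const: "Ck_on k S (\<lambda>x. c)"
  by (induction k arbitrary: c) auto

lemma Ck_on_add:
  assumes "open S" "Ck_on k S f" "Ck_on k S g"
  shows "Ck_on k S (\<lambda>x. f x + g x)"
  using assms(2,3)
proof (induction k arbitrary: f g)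
  case (Suc k)
  obtain f' g' where f': "\<And>x. x \<in> S \<Longrightarrow> (f has_derivative f' x) (at x)" "\<And>v. Ck_on k S (\<lambda>x. f' x v)"
    and g': "\<And>x. x \<in> S \<Longrightarrow> (g has_derivative g' x) (at x)" "\<And>v. Ck_on k S (\<lambda>x. g' x v)"
    using Suc.prems by (metis Ck_on_SucE)
  show ?case
    by (rule Ck_on_SucI[OF assms(1), where f' = "\<lambda>x v. f' x v + g' x v"])
      (auto intro!: derivative_intros f' g' Suc.IH)
qed (auto intro: continuous_intros)

lemma Ck_on_bilinear:
  assumes "open S" "Ck_on k S f" "Ck_on k S g" and h: "bounded_bilinear h"
  shows "Ck_on k S (\<lambda>x. h (f x) (g x))"
  using assms(2,3)
proof (induction k arbitrary: f g)
  case 0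
  then show ?case using bounded_bilinear.continuous_on[OF h] by auto
next
  case (Suc k)
  obtain f' g' where f': "\<And>x. x \<in> S \<Longrightarrow> (f has_derivative f' x) (at x)" "\<And>v. Ck_on k S (\<lambda>x. f' x v)"
    and g': "\<And>x. x \<in> S \<Longrightarrow> (g has_derivative g' x) (at x)" "\<And>v. Ck_on k S (\<lambda>x. g' x v)"
    using Suc.prems by (metis Ck_on_SucE)
  show ?case
    by (rule Ck_on_SucI[OF assms(1), where f' = "\<lambda>x v. h (f x) (g' x v) + h (f' x v) (g x)"])
      (auto intro!: bounded_bilinear.FDERIV[OF h] Ck_on_add[OF assms(1)]
        f' g' Suc.IH Ck_on_Suc_imp[OF Suc.prems(1)] Ck_on_Suc_imp[OF Suc.prems(2)])
qed

lemma Ck_on_bounded_linear: "bounded_linear L \<Longrightarrow> Ck_on k S L"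
proof (cases k)
  case (Suc m)
  assume L: "bounded_linear L"
  have "Ck_on (Suc m) UNIV L"
    by (rule Ck_on_SucI[where f' = "\<lambda>x. L"])
      (auto intro: bounded_linear_imp_has_derivative L Ck_on_const)
  then show ?thesis using Suc Ck_on_subset by blast
qed (auto intro: linear_continuous_on)

lemma Ck_on_compose_bounded_linear:
  assumes "open S" "Ck_on k S f" and L: "bounded_linear L"
  shows "Ck_on k S (\<lambda>x. L (f x))"
  using assms(2)
proof (induction k arbitrary: f)
  case 0
  then show ?case using bounded_linear.continuous_on[OF L] by auto
next
  case (Suc k)
  obtain f' where f': "\<And>x. x \<in> S \<Longrightarrow> (f has_derivative f' x) (at x)" "\<And>v. Ck_on k S (\<lambda>x. f' x v)"
    using Suc.prems by (metis Ck_on_SucE)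
  show ?case
    by (rule Ck_on_SucI[OF assms(1), where f' = "\<lambda>x v. L (f' x v)"])
      (auto intro!: bounded_linear.has_derivative[OF L] f' Suc.IH)
qed

text \<open>An affine inner map turns the derivative in direction \<open>v\<close> into that of
  \<open>f\<close> in the fixed direction \<open>L v\<close>, so the induction hypothesis applies to
  a single directional derivative. Rescaled curves, time slices and projections are all of this
  form.\<close>

lemma Ck_on_compose_affine:
  assumes "open S" "open T" "Ck_on k S f" and L: "bounded_linear L" and "\<And>x. x \<in> T \<Longrightarrow> a + L x \<in> S"
  shows "Ck_on k T (\<lambda>x. f (a + L x))"
  using assms(3)
proof (induction k arbitrary: f)
  case 0
  have "continuous_on T (\<lambda>x. a + L x)"
    by (intro continuous_intros linear_continuous_on L)
  with 0 show ?case using continuous_on_compose2[of S f T "\<lambda>x. a + L x"] assms(5) by auto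
next
  case (Suc k)
  obtain f' where f': "\<And>x. x \<in> S \<Longrightarrow> (f has_derivative f' x) (at x)" "\<And>v. Ck_on k S (\<lambda>x. f' x v)"
    using Suc.prems by (metis Ck_on_SucE)
  have aff: "((\<lambda>x. a + L x) has_derivative L) (at x)" for x
    by (auto intro!: derivative_eq_intros bounded_linear_imp_has_derivative L)
  show ?case
  proof (rule Ck_on_SucI[OF assms(2)])
    show "((\<lambda>x. f (a + L x)) has_derivative (\<lambda>v. f' (a + L x) (L v))) (at x)" if "x \<in> T" for x
      using has_derivative_compose[OF aff f'(1)[OF assms(5)[OF that]]] .
  qed (rule Suc.IH[OF f'(2)])
qed

lemma smooth_on_Ck: "smooth_on S f \<Longrightarrow> Ck_on k S f"
  by (simp add: smooth_on_def)

lemma smooth_on_subset: "smooth_on S f \<Longrightarrow> T \<subseteq> S \<Longrightarrow> smooth_on T f"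
  by (auto simp: smooth_on_def intro: Ck_on_subset)

lemma smooth_on_compose_affine:
  assumes "smooth_on S f" "open S" "open T" "bounded_linear L" "\<And>x. x \<in> T \<Longrightarrow> a + L x \<in> S"
  shows "smooth_on T (\<lambda>x. f (a + L x))"
  using assms by (auto simp: smooth_on_def intro: Ck_on_compose_affine)

lemma smooth_on_bilinear:
  assumes "bounded_bilinear h" "open S" "smooth_on S f" "smooth_on S g"
  shows "smooth_on S (\<lambda>x. h (f x) (g x))"
  using assms by (auto simp: smooth_on_def intro: Ck_on_bilinear)

lemma smooth_on_bounded_linear: "bounded_linear L \<Longrightarrow> smooth_on S L"
  by (simp add: smooth_on_def Ck_on_bounded_linear)

lemma smooth_on_compose_bounded_linear:
  "bounded_linear L \<Longrightarrow> open S \<Longrightarrow> smooth_on S f \<Longrightarrow> smooth_on S (\<lambda>x. L (f x))"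
  by (simp add: smooth_on_def Ck_on_compose_bounded_linear)

lemma smooth_on_const: "smooth_on S (\<lambda>x. c)"
  by (simp add: smooth_on_def Ck_on_const)

lemma smooth_on_imp_continuous_on: "smooth_on S f \<Longrightarrow> continuous_on S f"
  using smooth_on_Ck[of S f 0] by simp

lemma smooth_on_frechet_derivative:
  "smooth_on S f \<Longrightarrow> smooth_on S (\<lambda>x. frechet_derivative f (at x) v)"
  unfolding smooth_on_def by (metis Ck_on.simps(2))

lemma smooth_on_has_derivative:
  assumes "smooth_on S f" "x \<in> S"
  shows "(f has_derivative frechet_derivative f (at x)) (at x)"
  using smooth_on_Ck[OF assms(1), of 1] assms(2) frechet_derivative_works by auto

text \<open>The mean value inequality in \<open>s\<close> is applied to \<open>F s\<close>, a first
  difference in direction \<open>w\<close> with its expected linear part removed. Differentiability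
  of the directional derivative is used at the single point \<open>x\<close>.\<close>

lemma second_difference_estimate:
  fixes f :: "'a::real_normed_vector \<Rightarrow> 'b::real_normed_vector"
  assumes S: "open S" "x \<in> S" and f: "\<And>y. y \<in> S \<Longrightarrow> (f has_derivative f' y) (at y)"
    and A: "((\<lambda>y. f' y v) has_derivative A) (at x)" and "e > 0"
  shows "\<exists>d>0. \<forall>h. 0 < h \<and> h < d \<longrightarrow>
    norm (f (x + h *\<^sub>R v + h *\<^sub>R w) - f (x + h *\<^sub>R v) - f (x + h *\<^sub>R w) + f x - (h * h) *\<^sub>R A w) \<le> e * (h * h)"
proof -
  interpret A: bounded_linear A using A by (rule has_derivative_bounded_linear)
  define N where "N = norm v + norm w + 1"
  have N: "N > 0" by (simp add: N_def add_nonneg_pos)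
  obtain r where r: "r > 0" "ball x r \<subseteq> S" using S openE by blast
  obtain d where d: "d > 0" "\<And>y. norm (y - x) < d \<Longrightarrow> norm (f' y v - f' x v - A (y - x)) \<le> e / (2 * N) * norm (y - x)"
    using A[unfolded has_derivative_at_alt] N \<open>e > 0\<close>
    by (metis divide_pos_pos mult_pos_pos zero_less_numeral)
  show ?thesis
  proof (intro exI[of _ "min r d / N"] conjI allI impI)
    show "0 < min r d / N" using r d N by simp
    fix h assume h: "0 < h \<and> h < min r d / N"
    then have hN: "h * N < r" "h * N < d" using N by (auto simp: field_simps)
    have small: "norm (s *\<^sub>R v + u *\<^sub>R w) \<le> h * N" if "0 \<le> s" "s \<le> h" "0 \<le> u" "u \<le> h" for s u
    proof -
      have "norm (s *\<^sub>R v + u *\<^sub>R w) \<le> s * norm v + u * norm w"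
        using that by (metis abs_of_nonneg norm_scaleR norm_triangle_ineq)
      also have "\<dots> \<le> h * norm v + h * norm w"
        using that by (intro add_mono mult_right_mono) auto
      also have "\<dots> \<le> h * N" using h by (simp add: N_def algebra_simps)
      finally show ?thesis .
    qed
    define F where "F s = f (x + s *\<^sub>R v + h *\<^sub>R w) - f (x + s *\<^sub>R v) - s *\<^sub>R h *\<^sub>R A w" for s
    define F' where "F' s = f' (x + s *\<^sub>R v + h *\<^sub>R w) v - f' (x + s *\<^sub>R v) v - h *\<^sub>R A w" for s
    have inS: "x + s *\<^sub>R v + u *\<^sub>R w \<in> S" if "0 \<le> s" "s \<le> h" "0 \<le> u" "u \<le> h" for s u
    proof -
      have "x - (x + s *\<^sub>R v + u *\<^sub>R w) = - (s *\<^sub>R v + u *\<^sub>R w)" by simp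
      then have "dist x (x + s *\<^sub>R v + u *\<^sub>R w) < r"
        unfolding dist_norm using small[OF that] hN by (simp only: norm_minus_cancel)
      then show ?thesis using r by auto
    qed
    have shift: "((\<lambda>s. f (x + s *\<^sub>R v + u *\<^sub>R w)) has_vector_derivative f' (x + s *\<^sub>R v + u *\<^sub>R w) v) (at s)"
      if "0 \<le> s" "s \<le> h" "0 \<le> u" "u \<le> h" for s u
    proof -
      have "((\<lambda>s. x + s *\<^sub>R v + u *\<^sub>R w) has_derivative (\<lambda>s. s *\<^sub>R v)) (at s)"
        by (auto intro!: derivative_eq_intros)
      from has_derivative_compose[OF this f[OF inS[OF that]]]
      show ?thesis unfolding has_vector_derivative_def
        using linear_cmul[OF has_derivative_linear[OF f[OF inS[OF that]]]] by simp
    qed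
    have F': "(F has_vector_derivative F' s) (at s)" if "0 \<le> s" "s \<le> h" for s
      unfolding F_def F'_def using shift[of s h] shift[of s 0] that h
      by (auto intro!: derivative_eq_intros)
    have "norm (F h - F 0) \<le> (e * h) * h - (e * h) * 0"
    proof (rule differentiable_bound_general[where f' = F' and \<phi>' = "\<lambda>s. e * h"])
      show "continuous_on {0..h} F"
        by (meson F' atLeastAtMost_iff continuous_at_imp_continuous_on has_vector_derivative_continuous)
      fix s assume s: "0 < s" "s < h"
      show "(F has_vector_derivative F' s) (at s)" using F' s by simp
      show "((*) (e * h) has_vector_derivative e * h) (at s)"
        by (auto intro!: derivative_eq_intros)
      \<comment> \<open>The linearization at \<open>x\<close> serves as common reference, which
        leaves two remainders controlled by \<open>d\<close>, each at most half of
        \<open>e * h\<close>.\<close>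
      have eq: "F' s = (f' (x + s *\<^sub>R v + h *\<^sub>R w) v - f' x v - A (s *\<^sub>R v + h *\<^sub>R w))
                 - (f' (x + s *\<^sub>R v) v - f' x v - A (s *\<^sub>R v))"
        by (simp add: F'_def A.add A.scaleR)
      have 1: "norm (f' (x + s *\<^sub>R v + u *\<^sub>R w) v - f' x v - A (s *\<^sub>R v + u *\<^sub>R w)) \<le> e / (2 * N) * (h * N)"
        if "0 \<le> u" "u \<le> h" for u
      proof -
        have "norm (f' (x + s *\<^sub>R v + u *\<^sub>R w) v - f' x v - A (s *\<^sub>R v + u *\<^sub>R w))
              \<le> e / (2 * N) * norm (s *\<^sub>R v + u *\<^sub>R w)"
          using d(2)[of "x + s *\<^sub>R v + u *\<^sub>R w"] small[of s u] s hN that by (simp add: add.assoc)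
        also have "\<dots> \<le> e / (2 * N) * (h * N)"
          using small[of s u] s that N \<open>e > 0\<close> by (intro mult_left_mono) auto
        finally show ?thesis .
      qed
      have "norm (F' s) \<le> e / (2 * N) * (h * N) + e / (2 * N) * (h * N)"
        unfolding eq by (rule order_trans[OF norm_triangle_ineq4 add_mono]) (use 1[of h] 1[of 0] h in simp_all)
      also have "\<dots> = e * h" using N by (simp add: field_simps)
      finally show "norm (F' s) \<le> e * h" .
    qed (use h in \<open>auto intro: continuous_intros\<close>)
    then show "norm (f (x + h *\<^sub>R v + h *\<^sub>R w) - f (x + h *\<^sub>R v) - f (x + h *\<^sub>R w) + f x - (h * h) *\<^sub>R A w)
      \<le> e * (h * h)"
      by (simp add: F_def algebra_simps)
  qed
qed

text \<open>The second difference is symmetric in \<open>v\<close> and \<open>w\<close>, so it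
  approximates h^2 \<open>A w\<close> and h^2 \<open>B v\<close> at once; division by h^2 leaves an
  arbitrarily small gap.\<close>

lemma symmetric_second_derivative:
  fixes f :: "'a::real_normed_vector \<Rightarrow> 'b::real_normed_vector"
  assumes "open S" "x \<in> S" "\<And>y. y \<in> S \<Longrightarrow> (f has_derivative f' y) (at y)"
    and A: "((\<lambda>y. f' y v) has_derivative A) (at x)" and B: "((\<lambda>y. f' y w) has_derivative B) (at x)"
  shows "A w = B v"
proof -
  have "norm (A w - B v) \<le> 0 + e" if "e > 0" for e :: real
  proof -
    from second_difference_estimate[OF assms(1-3) A, of "e/2" w]
      second_difference_estimate[OF assms(1-3) B, of "e/2" v] that
    obtain d1 d2 where d: "d1 > 0" "d2 > 0"
      and 1: "\<And>h. 0 < h \<Longrightarrow> h < d1 \<Longrightarrow> norm (f (x + h *\<^sub>R v + h *\<^sub>R w) - f (x + h *\<^sub>R v) - f (x + h *\<^sub>R w) + f x - (h * h) *\<^sub>R A w) \<le> e / 2 * (h * h)"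
      and 2: "\<And>h. 0 < h \<Longrightarrow> h < d2 \<Longrightarrow> norm (f (x + h *\<^sub>R w + h *\<^sub>R v) - f (x + h *\<^sub>R w) - f (x + h *\<^sub>R v) + f x - (h * h) *\<^sub>R B v) \<le> e / 2 * (h * h)"
      by (metis half_gt_zero)
    obtain h where h: "0 < h" "h < d1" "h < d2" using d by (metis field_lbound_gt_zero)
    let ?D = "f (x + h *\<^sub>R v + h *\<^sub>R w) - f (x + h *\<^sub>R v) - f (x + h *\<^sub>R w) + f x"
    have "(h * h) * norm (A w - B v) = norm ((h * h) *\<^sub>R A w - (h * h) *\<^sub>R B v)"
      by (metis abs_mult_self_eq abs_mult norm_scaleR scaleR_right_diff_distrib)
    also have "\<dots> = norm ((?D - (h * h) *\<^sub>R B v) - (?D - (h * h) *\<^sub>R A w))"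
      by simp
    also have "\<dots> \<le> e / 2 * (h * h) + e / 2 * (h * h)"
      by (rule order_trans[OF norm_triangle_ineq4 add_mono])
        (use 1[OF h(1,2)] 2[OF h(1,3)] in \<open>simp_all add: algebra_simps\<close>)
    finally show ?thesis using h by (simp add: field_simps)
  qed
  then have "norm (A w - B v) \<le> 0" by (rule field_le_epsilon)
  then show ?thesis by simp
qed

section \<open>Series of homogeneous polynomials\<close>

text \<open>
  \<open>hom_poly d K f\<close>: \<open>f\<close> is a homogeneous polynomial of degree \<open>d\<close> whose symmetric multilinear form is
  bounded by \<open>K\<close>.  Phrased through derivatives, the bound controls all derivatives of \<open>f\<close> at once and
  is still submultiplicative under bilinear products.
\<close>

primrec hom_poly :: "nat \<Rightarrow> real \<Rightarrow> ('a::real_normed_vector \<Rightarrow> 'b::real_normed_vector) \<Rightarrow> bool" where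
  "hom_poly 0 K f \<longleftrightarrow> (\<exists>c. f = (\<lambda>x. c) \<and> norm c \<le> K)"
| "hom_poly (Suc d) K f \<longleftrightarrow> f 0 = 0 \<and>
     (\<exists>f'. (\<forall>x. (f has_derivative f' x) (at x)) \<and>
           (\<forall>v. hom_poly d (real (Suc d) * K * norm v) (\<lambda>x. f' x v)))"

lemma hom_poly_zero: "0 \<le> K \<Longrightarrow> hom_poly d K (\<lambda>x. 0)"
proof (induction d arbitrary: K)
  case (Suc d)
  then show ?case by (auto intro!: exI[of _ "\<lambda>x v. 0"])
qed auto

lemma hom_poly_derivative:
  assumes "hom_poly d K f"
  obtains f' where "\<And>x. (f has_derivative f' x) (at x)"
    "\<And>v. hom_poly (d - 1) (real d * K * norm v) (\<lambda>x. f' x v)"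
    "d = 0 \<Longrightarrow> f' = (\<lambda>x v. 0)"
  using assms by (cases d) (auto intro: that[of "\<lambda>x v. 0"])

lemma hom_poly_add:
  "hom_poly d K f \<Longrightarrow> hom_poly d L g \<Longrightarrow> hom_poly d (K + L) (\<lambda>x. f x + g x)"
proof (induction d arbitrary: K L f g)
  case 0
  then show ?case by (auto intro: norm_triangle_mono)
next
  case (Suc d)
  then obtain f' g' where f': "f 0 = 0" "\<And>x. (f has_derivative f' x) (at x)"
    "\<And>v. hom_poly d (real (Suc d) * K * norm v) (\<lambda>x. f' x v)"
   and g': "g 0 = 0" "\<And>x. (g has_derivative g' x) (at x)"
    "\<And>v. hom_poly d (real (Suc d) * L * norm v) (\<lambda>x. g' x v)" by auto
  have "hom_poly d (real (Suc d) * (K + L) * norm v) (\<lambda>x. f' x v + g' x v)" for v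
    using Suc.IH[OF f'(3) g'(3), of v v] by (simp add: algebra_simps)
  then show ?case using f' g'
    by (auto intro!: exI[of _ "\<lambda>x v. f' x v + g' x v"] derivative_intros)
qed

lemma hom_poly_sum:
  assumes "finite I" "\<And>i. i \<in> I \<Longrightarrow> hom_poly d (K i) (f i)"
  shows "hom_poly d (\<Sum>i\<in>I. K i) (\<lambda>x. \<Sum>i\<in>I. f i x)"
  using assms by (induction I rule: finite_induct) (auto intro: hom_poly_zero hom_poly_add)

lemma hom_poly_scaleR: "hom_poly d K f \<Longrightarrow> hom_poly d (\<bar>c\<bar> * K) (\<lambda>x. c *\<^sub>R f x)"
proof (induction d arbitrary: K f)
  case 0
  then obtain a where "f = (\<lambda>x. a)" "norm a \<le> K" by auto
  then show ?case by (auto intro!: exI[of _ "c *\<^sub>R a"] mult_left_mono)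
next
  case (Suc d)
  then obtain f' where f': "f 0 = 0" "\<And>x. (f has_derivative f' x) (at x)"
    "\<And>v. hom_poly d (real (Suc d) * K * norm v) (\<lambda>x. f' x v)" by auto
  have "hom_poly d (real (Suc d) * (\<bar>c\<bar> * K) * norm v) (\<lambda>x. c *\<^sub>R f' x v)" for v
    using Suc.IH[OF f'(3), of v] by (simp add: algebra_simps)
  then show ?case using f'
    by (auto intro!: exI[of _ "\<lambda>x v. c *\<^sub>R f' x v"] derivative_intros)
qed

lemma hom_poly_bounded_linear:
  assumes "bounded_linear L" "\<And>v. norm (L v) \<le> norm v"
  shows "hom_poly 1 1 L"
  using assms bounded_linear_imp_has_derivative[OF assms(1)] linear_0[OF bounded_linear.linear[OF assms(1)]]
  by (auto intro!: exI[of _ "\<lambda>x. L"])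

text \<open>By the product rule the bounds for the derivative carry the factors d and e, which add
  up to the required d + e. The constants thus multiply without binomial factors, which keeps
  iterated products geometric.\<close>

lemma hom_poly_bilinear:
  assumes h: "bounded_bilinear h" and C: "0 \<le> C" "\<And>x y. norm (h x y) \<le> C * norm x * norm y"
    and "hom_poly d K f" "hom_poly e L g" "0 \<le> K" "0 \<le> L"
  shows "hom_poly (d + e) (C * K * L) (\<lambda>x. h (f x) (g x))"
  using assms(4-)
proof (induction "d + e" arbitrary: d e K L f g)
  case 0
  then obtain a b where "f = (\<lambda>x. a)" "norm a \<le> K" "g = (\<lambda>x. b)" "norm b \<le> L" by auto
  moreover from this have "norm (h a b) \<le> C * K * L"
    using order_trans[OF C(2)] C(1) 0 by (smt (verit) mult_mono mult_nonneg_nonneg norm_ge_zero)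
  ultimately show ?case using 0 by auto
next
  case (Suc n)
  obtain f' where f': "\<And>x. (f has_derivative f' x) (at x)"
    "\<And>v. hom_poly (d - 1) (real d * K * norm v) (\<lambda>x. f' x v)" "d = 0 \<Longrightarrow> f' = (\<lambda>x v. 0)"
    using Suc.prems(1) hom_poly_derivative by blast
  obtain g' where g': "\<And>x. (g has_derivative g' x) (at x)"
    "\<And>v. hom_poly (e - 1) (real e * L * norm v) (\<lambda>x. g' x v)" "e = 0 \<Longrightarrow> g' = (\<lambda>x v. 0)"
    using Suc.prems(2) hom_poly_derivative by blast
  \<comment> \<open>In degree 0 the truncated \<open>e - 1\<close> would break the degree count of
    the induction hypothesis; the derivative is zero there.\<close>
  have 1: "hom_poly n (C * K * (real e * L * norm v)) (\<lambda>x. h (f x) (g' x v))" for v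
  proof (cases e)
    case 0
    then show ?thesis using g'(3)[OF 0] bounded_bilinear.zero_right[OF h]
      by (simp add: hom_poly_zero)
  next
    case (Suc e')
    then have n: "n = d + (e - 1)" using \<open>Suc n = d + e\<close> by simp
    show ?thesis unfolding n
      by (rule Suc.hyps(1)[OF n]) (use Suc.prems g'(2) in auto)
  qed
  have 2: "hom_poly n (C * (real d * K * norm v) * L) (\<lambda>x. h (f' x v) (g x))" for v
  proof (cases d)
    case 0
    then show ?thesis using f'(3)[OF 0] bounded_bilinear.zero_left[OF h]
      by (simp add: hom_poly_zero)
  next
    case (Suc d')
    then have n: "n = (d - 1) + e" using \<open>Suc n = d + e\<close> by simp
    show ?thesis unfolding n
      by (rule Suc.hyps(1)[OF n]) (use Suc.prems f'(2) in auto)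
  qed
  \<comment> \<open>The total degree is positive, so some factor has positive degree and vanishes at
    the origin.\<close>
  have "f 0 = 0 \<or> g 0 = 0"
    using Suc.prems(1,2) Suc.hyps(2) by (cases d; cases e) auto
  then have 0: "h (f 0) (g 0) = 0"
    using bounded_bilinear.zero_left[OF h] bounded_bilinear.zero_right[OF h] by auto
  have "hom_poly n (real (Suc n) * (C * K * L) * norm v) (\<lambda>x. h (f x) (g' x v) + h (f' x v) (g x))" for v
    using hom_poly_add[OF 1[of v] 2[of v]] \<open>Suc n = d + e\<close> by (simp add: algebra_simps)
  moreover have "((\<lambda>x. h (f x) (g x)) has_derivative (\<lambda>v. h (f x) (g' x v) + h (f' x v) (g x))) (at x)" for x
    by (rule bounded_bilinear.FDERIV[OF h f'(1) g'(1)])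
  ultimately show ?case unfolding Suc.hyps(2)[symmetric] using 0
    by (auto intro!: exI[of _ "\<lambda>x v. h (f x) (g' x v) + h (f' x v) (g x)"])
qed

text \<open>Along the ray through \<open>x\<close> the derivative of \<open>f\<close> is bounded by
  that of K |x|^(d+1) s^(d+1); the mean value inequality on [0, 1] compares the two.\<close>

lemma hom_poly_norm_le: "hom_poly d K f \<Longrightarrow> norm (f x) \<le> K * norm x ^ d"
proof (induction d arbitrary: K f x)
  case (Suc d)
  then obtain f' where f': "f 0 = 0" "\<And>x. (f has_derivative f' x) (at x)"
    "\<And>v. hom_poly d (real (Suc d) * K * norm v) (\<lambda>x. f' x v)" by auto
  have F: "((\<lambda>s. f (s *\<^sub>R x)) has_vector_derivative f' (s *\<^sub>R x) x) (at s)" for s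
  proof -
    have "((\<lambda>s. s *\<^sub>R x) has_derivative (\<lambda>s. s *\<^sub>R x)) (at s)"
      by (auto intro!: derivative_eq_intros)
    from has_derivative_compose[OF this f'(2)] show ?thesis
      unfolding has_vector_derivative_def
      using linear_cmul[OF has_derivative_linear[OF f'(2)]] by simp
  qed
  have "norm (f (1 *\<^sub>R x) - f (0 *\<^sub>R x)) \<le> K * norm x ^ Suc d * 1 ^ Suc d - K * norm x ^ Suc d * 0 ^ Suc d"
  proof (rule differentiable_bound_general[where f' = "\<lambda>s. f' (s *\<^sub>R x) x"
        and \<phi>' = "\<lambda>s. K * norm x ^ Suc d * (real (Suc d) * s ^ d)" and \<phi> = "\<lambda>s. K * norm x ^ Suc d * s ^ Suc d"])
    show "continuous_on {0..1} (\<lambda>s. f (s *\<^sub>R x))"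
      by (intro continuous_at_imp_continuous_on ballI has_vector_derivative_continuous[OF F])
    fix s :: real assume s: "0 < s" "s < 1"
    show "((\<lambda>s. K * norm x ^ Suc d * s ^ Suc d) has_vector_derivative
         K * norm x ^ Suc d * (real (Suc d) * s ^ d)) (at s)"
      unfolding has_real_derivative_iff_has_vector_derivative[symmetric]
      using DERIV_cmult[OF DERIV_pow[of "Suc d" s UNIV], of "K * norm x ^ Suc d"] by simp
    have "norm (f' (s *\<^sub>R x) x) \<le> real (Suc d) * K * norm x * norm (s *\<^sub>R x) ^ d"
      by (rule Suc.IH[OF f'(3)])
    also have "\<dots> = K * norm x ^ Suc d * (real (Suc d) * s ^ d)"
      using s by (simp add: power_mult_distrib)
    finally show "norm (f' (s *\<^sub>R x) x) \<le> K * norm x ^ Suc d * (real (Suc d) * s ^ d)" .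
  qed (auto intro!: F continuous_intros simp del: power_Suc)
  then show ?case using f' by simp
qed auto

section \<open>Convergence and termwise differentiation of the series\<close>

lemma summable_power_index:
  fixes K :: "nat \<Rightarrow> real"
  assumes K: "\<And>n. 0 \<le> K n" and "0 < r" "r < s" "summable (\<lambda>n. K n * s ^ d n)"
  shows "summable (\<lambda>n. real (d n) * K n * r ^ (d n - 1))"
proof -
  \<comment> \<open>The factor \<open>d n\<close> produced by differentiation is absorbed by passing
    from \<open>s\<close> to the smaller radius \<open>r\<close>, as m (r/s)^m is bounded in
    m.\<close>
  have "(\<lambda>m. real m * (r / s) ^ m) \<longlonglongrightarrow> 0"
    using powser_times_n_limit_0[of "r / s"] assms by simp
  then have "Bseq (\<lambda>m. real m * (r / s) ^ m)"
    by (intro convergent_imp_Bseq convergentI)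
  then obtain M where M: "\<And>m. norm (real m * (r / s) ^ m) \<le> M" unfolding Bseq_def by blast
  have "real (d n) * K n * r ^ (d n - 1) \<le> M / r * (K n * s ^ d n)" for n
  proof (cases "d n")
    case 0
    have "0 \<le> M" using M[of 0] by simp
    then show ?thesis using 0 K[of n] assms by simp
  next
    case (Suc m)
    have e: "(r / s) ^ d n * s ^ d n = r * r ^ (d n - 1)"
      using Suc assms by (simp add: power_divide)
    have "real (d n) * K n * r ^ (d n - 1) = real (d n) * K n * ((r / s) ^ d n * s ^ d n) / r"
      unfolding e using assms by simp
    also have "\<dots> = (real (d n) * (r / s) ^ d n) * (K n * s ^ d n) / r"
      by (simp only: mult_ac)
    also have "\<dots> \<le> M * (K n * s ^ d n) / r"
      using M[of "d n"] K[of n] assms by (intro divide_right_mono mult_right_mono) auto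
    finally show ?thesis by simp
  qed
  then show ?thesis
    using assms by (intro summable_comparison_test'[OF summable_mult[OF assms(4), of "M / r"]]) auto
qed

text \<open>The degree is a function of the index rather than the index itself: differentiation
  lowers it by one, and in the flow series the term of index n has degree 2n + 1. Where
  \<open>d n - 1\<close> is truncated, the factor \<open>real (d n)\<close> in the differentiated
  bound is zero.\<close>

locale hom_poly_series =
  fixes d :: "nat \<Rightarrow> nat" and K :: "nat \<Rightarrow> real" and \<rho> :: real
    and f :: "nat \<Rightarrow> 'a::euclidean_space \<Rightarrow> 'b::euclidean_space"
  assumes hom: "\<And>n. hom_poly (d n) (K n) (f n)" and nonneg: "\<And>n. 0 \<le> K n"
    and summable_radius: "\<And>r. 0 < r \<Longrightarrow> r < \<rho> \<Longrightarrow> summable (\<lambda>n. K n * r ^ d n)"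
begin

definition Df :: "nat \<Rightarrow> 'a \<Rightarrow> 'a \<Rightarrow> 'b" where
  "Df n x = frechet_derivative (f n) (at x)"

lemma Df: "(f n has_derivative Df n x) (at x)"
  "hom_poly (d n - 1) (real (d n) * K n * norm v) (\<lambda>x. Df n x v)"
proof -
  obtain f' where "\<And>x. (f n has_derivative f' x) (at x)"
    "\<And>v. hom_poly (d n - 1) (real (d n) * K n * norm v) (\<lambda>x. f' x v)"
    by (rule hom_poly_derivative[OF hom[of n]]) (rule that; assumption)
  moreover have "f' = Df n" unfolding Df_def
    by (rule ext) (rule frechet_derivative_at[OF calculation(1)])
  ultimately show "(f n has_derivative Df n x) (at x)"
    "hom_poly (d n - 1) (real (d n) * K n * norm v) (\<lambda>x. Df n x v)" by auto
qed

lemma Df_series: "hom_poly_series (\<lambda>n. d n - 1) (\<lambda>n. real (d n) * K n * norm v) \<rho> (\<lambda>n x. Df n x v)"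
proof
  fix r :: real assume r: "0 < r" "r < \<rho>"
  then obtain s where "r < s" "s < \<rho>" using dense by blast
  with r have "summable (\<lambda>n. real (d n) * K n * r ^ (d n - 1))"
    by (intro summable_power_index[OF nonneg]) (auto intro: summable_radius)
  from summable_mult[OF this, of "norm v"]
  show "summable (\<lambda>n. real (d n) * K n * norm v * r ^ (d n - 1))" by (simp add: algebra_simps)
qed (use Df(2) nonneg in auto)

lemma summable_norm_f:
  assumes "x \<in> ball 0 \<rho>"
  shows "summable (\<lambda>n. norm (f n x))"
proof -
  obtain r where r: "norm x < r" "r < \<rho>" using assms dense by auto
  have "norm (f n x) \<le> K n * r ^ d n" for n
    using hom_poly_norm_le[OF hom] r nonneg[of n]
    by (metis less_imp_le mult_left_mono norm_ge_zero order_trans power_mono)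
  moreover have s: "summable (\<lambda>n. K n * r ^ d n)"
    using summable_radius[of r] r norm_ge_zero[of x] by linarith
  ultimately show ?thesis
    by (auto intro: summable_comparison_test'[OF s, of 0])
qed

text \<open>On a smaller ball \<open>M\<close> majorizes the derivatives of the terms, so their
  partial sums converge uniformly and the series may be differentiated term by term.\<close>

lemma has_derivative_suminf:
  assumes x: "x \<in> ball 0 \<rho>"
  shows "((\<lambda>x. \<Sum>n. f n x) has_derivative (\<lambda>v. \<Sum>n. Df n x v)) (at x)"
proof -
  obtain r where r: "norm x < r" "r < \<rho>" using x dense by auto
  then have "0 < r" using norm_ge_zero[of x] by linarith
  define M where "M n = real (d n) * K n * r ^ (d n - 1)" for n
  have M: "summable M" unfolding M_def
  proof -
    obtain s where "r < s" "s < \<rho>" using dense r by blast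
    with \<open>0 < r\<close> show "summable (\<lambda>n. real (d n) * K n * r ^ (d n - 1))"
      by (intro summable_power_index[OF nonneg]) (auto intro: summable_radius)
  qed
  have bound: "norm (Df n y h) \<le> M n * norm h" if "y \<in> ball 0 r" for n y h
  proof -
    have "norm (Df n y h) \<le> real (d n) * K n * norm h * norm y ^ (d n - 1)"
      by (rule hom_poly_norm_le[OF Df(2)])
    also have "\<dots> \<le> real (d n) * K n * norm h * r ^ (d n - 1)"
      using that nonneg[of n] by (intro mult_left_mono power_mono) auto
    finally show ?thesis by (simp add: M_def algebra_simps)
  qed
  have "\<forall>\<^sub>F n in sequentially. \<forall>y\<in>ball 0 r. \<forall>h.
      norm (sum (\<lambda>i. Df i y h) {..<n} - (\<Sum>i. Df i y h)) \<le> e * norm h" if "e > 0" for e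
  proof -
    have "(\<lambda>n. \<Sum>i. M (i + n)) \<longlonglongrightarrow> 0" by (rule suminf_exist_split2[OF M])
    then have "\<forall>\<^sub>F n in sequentially. (\<Sum>i. M (i + n)) < e"
      using that by (metis order_tendstoD(2))
    then show ?thesis
    proof eventually_elim
      case (elim n)
      show ?case
      proof (intro ballI allI)
        fix y h assume y: "y \<in> ball (0::'a) r"
        have s: "summable (\<lambda>i. Df i y h)"
          by (rule summable_comparison_test'[of "\<lambda>i. M i * norm h"])
            (use bound[OF y] M in \<open>auto intro: summable_mult2\<close>)
        have "norm (sum (\<lambda>i. Df i y h) {..<n} - (\<Sum>i. Df i y h)) = norm (\<Sum>i. Df (i + n) y h)"
          using suminf_minus_initial_segment[OF s, of n] by (simp add: norm_minus_commute)
        also have "\<dots> \<le> (\<Sum>i. M (i + n) * norm h)"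
          using bound[OF y] summable_ignore_initial_segment[OF M, of n]
          by (intro norm_suminf_le summable_mult2) auto
        also have "\<dots> = (\<Sum>i. M (i + n)) * norm h"
          using summable_ignore_initial_segment[OF M, of n] by (rule suminf_mult2[symmetric])
        also have "\<dots> \<le> e * norm h" using elim by (intro mult_right_mono) auto
        finally show "norm (sum (\<lambda>i. Df i y h) {..<n} - (\<Sum>i. Df i y h)) \<le> e * norm h" .
      qed
    qed
  qed
  then have "\<exists>g. \<forall>y\<in>ball 0 r. (\<lambda>n. f n y) sums g y \<and>
      (g has_derivative (\<lambda>h. \<Sum>n. Df n y h)) (at y within ball 0 r)"
  proof (rule has_derivative_series[rotated 2])
    show "(\<lambda>n. f n x) sums (\<Sum>n. f n x)"
      by (rule summable_sums[OF summable_norm_cancel[OF summable_norm_f[OF x]]])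
  qed (use r in \<open>auto intro: has_derivative_at_withinI[OF Df(1)]\<close>)
  then obtain g where g: "\<forall>y\<in>ball 0 r. (\<lambda>n. f n y) sums g y \<and>
      (g has_derivative (\<lambda>h. \<Sum>n. Df n y h)) (at y within ball 0 r)" ..
  have xr: "x \<in> ball 0 r" using r by simp
  have "(g has_derivative (\<lambda>h. \<Sum>n. Df n x h)) (at x)"
    using g xr at_within_open[OF xr open_ball] by metis
  then show ?thesis
    by (rule has_derivative_transform_within_open[OF _ open_ball xr]) (metis g sums_unique)
qed

end

text \<open>Each directional derivative is again such a series with the same \<open>\<rho>\<close>,
  so the induction runs over all series at once.\<close>

lemma Ck_on_suminf:
  "hom_poly_series d K \<rho> f \<Longrightarrow> Ck_on k (ball 0 \<rho>) (\<lambda>x. \<Sum>n. f n x)"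
proof (induction k arbitrary: d K f)
  case 0
  show ?case unfolding Ck_on.simps
    by (rule has_derivative_continuous_on, rule has_derivative_at_withinI)
      (rule hom_poly_series.has_derivative_suminf[OF 0])
next
  case (Suc k)
  show ?case
    by (rule Ck_on_SucI[OF open_ball hom_poly_series.has_derivative_suminf[OF Suc.prems]])
      (auto intro: Suc.IH[OF hom_poly_series.Df_series[OF Suc.prems]])
qed

lemma (in hom_poly_series) smooth_on_suminf: "smooth_on (ball 0 \<rho>) (\<lambda>x. \<Sum>n. f n x)"
  by (simp add: smooth_on_def Ck_on_suminf[OF hom_poly_series_axioms])

section \<open>Flows of quadratic vector fields\<close>

declare hom_poly.simps(2) [simp del]

text \<open>Expanding both arguments in the orthonormal bases turns \<open>h\<close> into finitely
  many products of real coordinates, to which the Cauchy product theorem for real series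
  applies.\<close>

lemma Cauchy_product_bilinear_sums:
  fixes a :: "nat \<Rightarrow> 'a::euclidean_space" and b :: "nat \<Rightarrow> 'b::euclidean_space"
    and h :: "'a \<Rightarrow> 'b \<Rightarrow> 'c::real_normed_vector"
  assumes h: "bounded_bilinear h"
    and a: "summable (\<lambda>k. norm (a k))" and b: "summable (\<lambda>k. norm (b k))"
  shows "(\<lambda>k. \<Sum>i\<le>k. h (a i) (b (k - i))) sums h (\<Sum>k. a k) (\<Sum>k. b k)"
proof -
  interpret h: bounded_bilinear h by fact
  have expand: "h x y = (\<Sum>u\<in>Basis. \<Sum>v\<in>Basis. ((x \<bullet> u) * (y \<bullet> v)) *\<^sub>R h u v)" for x y
  proof -
    have "h x y = h (\<Sum>u\<in>Basis. (x \<bullet> u) *\<^sub>R u) (\<Sum>v\<in>Basis. (y \<bullet> v) *\<^sub>R v)"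
      by (simp add: euclidean_representation)
    also have "\<dots> = (\<Sum>u\<in>Basis. h ((x \<bullet> u) *\<^sub>R u) (\<Sum>v\<in>Basis. (y \<bullet> v) *\<^sub>R v))"
      by (rule h.sum_left)
    also have "\<dots> = (\<Sum>u\<in>Basis. \<Sum>v\<in>Basis. ((x \<bullet> u) * (y \<bullet> v)) *\<^sub>R h u v)"
      by (simp only: h.sum_right h.scaleR_left h.scaleR_right scaleR_scaleR mult.commute)
    finally show ?thesis .
  qed
  have comp: "(\<lambda>k. \<Sum>i\<le>k. (a i \<bullet> u) * (b (k - i) \<bullet> v)) sums (((\<Sum>k. a k) \<bullet> u) * ((\<Sum>k. b k) \<bullet> v))"
    if "u \<in> Basis" "v \<in> Basis" for u v
  proof -
    have eq: "(\<Sum>k. a k) \<bullet> u = (\<Sum>k. a k \<bullet> u)" "(\<Sum>k. b k) \<bullet> v = (\<Sum>k. b k \<bullet> v)"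
      by (rule bounded_linear.suminf[OF bounded_linear_inner_left summable_norm_cancel[OF a]],
        rule bounded_linear.suminf[OF bounded_linear_inner_left summable_norm_cancel[OF b]])
    have "summable (\<lambda>k. norm (a k \<bullet> u))" "summable (\<lambda>k. norm (b k \<bullet> v))"
      by (rule summable_comparison_test'[OF a, of 0], simp add: Basis_le_norm that(1))
        (rule summable_comparison_test'[OF b, of 0], simp add: Basis_le_norm that(2))
    from Cauchy_product_sums[OF this] show ?thesis unfolding eq .
  qed
  have "(\<lambda>k. \<Sum>u\<in>Basis. \<Sum>v\<in>Basis. (\<Sum>i\<le>k. (a i \<bullet> u) * (b (k - i) \<bullet> v)) *\<^sub>R h u v)
      sums (\<Sum>u\<in>Basis. \<Sum>v\<in>Basis. (((\<Sum>k. a k) \<bullet> u) * ((\<Sum>k. b k) \<bullet> v)) *\<^sub>R h u v)"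
    by (intro sums_sum sums_scaleR_left comp)
  moreover have "(\<Sum>u\<in>Basis. \<Sum>v\<in>Basis. (\<Sum>i\<le>k. (a i \<bullet> u) * (b (k - i) \<bullet> v)) *\<^sub>R h u v)
      = (\<Sum>i\<le>k. h (a i) (b (k - i)))" for k
    unfolding expand[of "a _"] scaleR_sum_left
    by (subst (2) sum.swap, subst sum.swap) (simp add: sum.swap[of _ Basis "{..k}"])
  ultimately show ?thesis by (simp add: expand[symmetric])
qed

section \<open>The power series of a quadratic flow\<close>

lemma hom_poly_fst: "hom_poly 1 1 fst"
  by (rule hom_poly_bounded_linear[OF bounded_linear_fst]) (metis norm_fst_le prod.collapse)

lemma hom_poly_snd: "hom_poly 1 1 snd"
  by (rule hom_poly_bounded_linear[OF bounded_linear_snd]) (metis norm_snd_le prod.collapse)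

text \<open>These are the Taylor coefficients of the formal solution of x' = Q(x, x), x(0) = y:
  comparing coefficients of t^n gives (n + 1) a_(n+1) = sum of Q(a_i, a_(n-i)) for i from 0 to
  n.\<close>

fun flow_coeff :: "('a::real_vector \<Rightarrow> 'a \<Rightarrow> 'a) \<Rightarrow> nat \<Rightarrow> 'a \<Rightarrow> 'a" where
  "flow_coeff Q 0 y = y"
| "flow_coeff Q (Suc n) y = (1 / real (Suc n)) *\<^sub>R (\<Sum>i\<le>n. Q (flow_coeff Q i y) (flow_coeff Q (n - i) y))"

declare flow_coeff.simps(2) [simp del]

text \<open>Space and time form one argument, so that the series calculus yields joint
  smoothness.\<close>

definition flow :: "('a::real_normed_vector \<Rightarrow> 'a \<Rightarrow> 'a) \<Rightarrow> 'a \<times> real \<Rightarrow> 'a" where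
  "flow Q z = (\<Sum>n. snd z ^ n *\<^sub>R flow_coeff Q n (fst z))"

text \<open>At radius r the term of index n is bounded by C^n r^(2n+1), and \<open>C * 4 < 1\<close>
  makes this summable for all r < 2. The radius 2 is chosen so that the ball contains every
  \<open>(y, t)\<close> with |y| < 1 and |t| \<le> 1.\<close>

locale quadratic_field = bounded_bilinear Q
  for Q :: "'a::euclidean_space \<Rightarrow> 'a \<Rightarrow> 'a" +
  fixes C :: real
  assumes C: "0 \<le> C" "C * 4 < 1" and bound: "\<And>x y. norm (Q x y) \<le> C * norm x * norm y"
begin

text \<open>For positive n the recursion has n summands, each bounded by C^n, and its factor 1/n
  restores C^n exactly. The coefficients are read as functions of the pair so that they can be
  multiplied by powers of time.\<close>

lemma hom_poly_flow_coeff: "hom_poly (Suc n) (C ^ n) (\<lambda>z::'a \<times> real. flow_coeff Q n (fst z))"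
proof (induction n rule: less_induct)
  case (less n)
  show ?case
  proof (cases n)
    case 0
    then show ?thesis
      using hom_poly_fst by simp
  next
    case (Suc m)
    have "hom_poly (Suc n) (C ^ n) (\<lambda>z::'a \<times> real. Q (flow_coeff Q i (fst z)) (flow_coeff Q (m - i) (fst z)))"
      if "i \<in> {..m}" for i
    proof -
      have "hom_poly (Suc i + Suc (m - i)) (C * C ^ i * C ^ (m - i))
          (\<lambda>z::'a \<times> real. Q (flow_coeff Q i (fst z)) (flow_coeff Q (m - i) (fst z)))"
        using that C Suc by (intro hom_poly_bilinear[OF bounded_bilinear_axioms] bound less.IH) auto
      moreover have "C * C ^ i * C ^ (m - i) = C ^ n" "Suc i + Suc (m - i) = Suc n"
        using that Suc by (auto simp: mult.assoc simp flip: power_add)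
      ultimately show ?thesis by simp
    qed
    from hom_poly_sum[OF finite_atMost this]
    have "hom_poly (Suc n) (real n * C ^ n)
        (\<lambda>z::'a \<times> real. \<Sum>i\<le>m. Q (flow_coeff Q i (fst z)) (flow_coeff Q (m - i) (fst z)))"
      using Suc by simp
    from hom_poly_scaleR[OF this, of "1 / real n"]
    show ?thesis using Suc by (simp add: flow_coeff.simps(2))
  qed
qed

sublocale series: hom_poly_series "\<lambda>n. n + Suc n" "\<lambda>n. C ^ n" 2 "\<lambda>n z. snd z ^ n *\<^sub>R flow_coeff Q n (fst z)"
proof
  fix n
  have "hom_poly n 1 (\<lambda>z::'a \<times> real. snd z ^ n)"
  proof (induction n)
    case (Suc n)
    have "hom_poly (1 + n) (1 * 1 * 1) (\<lambda>z::'a \<times> real. snd z * snd z ^ n)"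
      using Suc hom_poly_snd
      by (intro hom_poly_bilinear[OF bounded_bilinear_mult]) (auto simp: abs_mult)
    then show ?case by simp
  qed auto
  then have "hom_poly (n + Suc n) (1 * 1 * C ^ n) (\<lambda>z::'a \<times> real. snd z ^ n *\<^sub>R flow_coeff Q n (fst z))"
    using C hom_poly_flow_coeff[of n]
    by (intro hom_poly_bilinear[OF bounded_bilinear_scaleR]) auto
  then show "hom_poly (n + Suc n) (C ^ n) (\<lambda>z::'a \<times> real. snd z ^ n *\<^sub>R flow_coeff Q n (fst z))"
    by simp
next
  fix r :: real assume r: "0 < r" "r < 2"
  then have "r * r \<le> 2 * 2" by (intro mult_mono) auto
  then have "C * (r * r) \<le> C * 4" using C by (intro mult_left_mono) auto
  with C r have "norm (C * (r * r)) < 1" by simp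
  then have "summable (\<lambda>n. r * (C * (r * r)) ^ n)" by (intro summable_mult summable_geometric)
  then show "summable (\<lambda>n. C ^ n * r ^ (n + Suc n))"
    by (simp add: power_mult_distrib power_add algebra_simps)
qed (use C in auto)

lemma smooth_on_flow: "smooth_on (ball 0 2) (flow Q)"
  using series.smooth_on_suminf unfolding flow_def by simp

lemma flow_0_time [simp]: "flow Q (y, 0) = y"
proof -
  have "flow Q (y, 0) = (\<Sum>n\<in>{0}. 0 ^ n *\<^sub>R flow_coeff Q n y)"
    unfolding flow_def by (simp only: fst_conv snd_conv, rule suminf_finite) auto
  then show ?thesis by simp
qed

lemma flow_origin [simp]: "flow Q (0, t) = 0"
proof -
  have "flow_coeff Q n 0 = 0" for n
    using hom_poly_flow_coeff[of n] by (simp add: hom_poly.simps(2))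
  then show ?thesis by (simp add: flow_def)
qed

lemma flow_coeff_scaleR: "flow_coeff Q n (c *\<^sub>R y) = c ^ Suc n *\<^sub>R flow_coeff Q n y"
proof (induction n rule: less_induct)
  case (less n)
  show ?case
  proof (cases n)
    case (Suc m)
    have "Q (flow_coeff Q i (c *\<^sub>R y)) (flow_coeff Q (m - i) (c *\<^sub>R y))
        = c ^ Suc n *\<^sub>R Q (flow_coeff Q i y) (flow_coeff Q (m - i) y)" if "i \<le> m" for i
    proof -
      have "c ^ Suc i * c ^ Suc (m - i) = c ^ Suc n"
        using that Suc by (simp flip: power_add power_Suc)
      then show ?thesis
        using that Suc less.IH[of i] less.IH[of "m - i"] by (simp add: scaleR_left scaleR_right mult.commute)
    qed
    then show ?thesis using Suc
      by (simp add: flow_coeff.simps(2) scaleR_sum_right[symmetric] mult.commute del: power_Suc)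
  qed simp
qed

text \<open>A quadratic field is homogeneous, so scaling the initial point amounts to scaling time
  and value. This later relates the time-one map to all smaller times.\<close>

lemma flow_scaleR:
  assumes "(y, c * t) \<in> ball 0 2"
  shows "flow Q (c *\<^sub>R y, t) = c *\<^sub>R flow Q (y, c * t)"
proof -
  have "summable (\<lambda>n. (c * t) ^ n *\<^sub>R flow_coeff Q n y)"
    using summable_norm_cancel[OF series.summable_norm_f[OF assms]] by simp
  from suminf_scaleR_right[OF this, of c] show ?thesis
    by (simp add: flow_def flow_coeff_scaleR power_mult_distrib mult_ac)
qed

lemma flow_time_derivative:
  assumes "(y, t) \<in> ball 0 2"
  shows "frechet_derivative (flow Q) (at (y, t)) (0, 1) = Q (flow Q (y, t)) (flow Q (y, t))"
proof -
  let ?P = "\<lambda>n. flow_coeff Q n y"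
  \<comment> \<open>On the time line the term is an ordinary monomial, and uniqueness of derivatives
    identifies the value of \<open>series.Df\<close>.\<close>
  have D: "series.Df n (y, t) (0, 1) = (real n * t ^ (n - 1)) *\<^sub>R ?P n" for n
  proof -
    have "((\<lambda>s. (y, s)) has_derivative (\<lambda>s. (0, s))) (at t)"
      by (auto intro!: derivative_eq_intros)
    from has_derivative_compose[OF this series.Df(1)]
    have "((\<lambda>s. s ^ n *\<^sub>R ?P n) has_derivative (\<lambda>s. series.Df n (y, t) (0, s))) (at t)"
      by simp
    moreover have "((\<lambda>s. s ^ n *\<^sub>R ?P n) has_derivative (\<lambda>s. (s * (real n * t ^ (n - 1))) *\<^sub>R ?P n)) (at t)"
      by (auto intro!: derivative_eq_intros)
    ultimately have "(\<lambda>s. series.Df n (y, t) (0, s)) = (\<lambda>s. (s * (real n * t ^ (n - 1))) *\<^sub>R ?P n)"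
      by (rule has_derivative_unique)
    from fun_cong[OF this, of 1] show ?thesis by simp
  qed
  have norm: "summable (\<lambda>n. norm (t ^ n *\<^sub>R ?P n))"
    using series.summable_norm_f[OF assms] by simp
  have "series.Df (Suc n) (y, t) (0, 1) = (\<Sum>i\<le>n. Q (t ^ i *\<^sub>R ?P i) (t ^ (n - i) *\<^sub>R ?P (n - i)))" for n
  proof -
    have "series.Df (Suc n) (y, t) (0, 1) = (\<Sum>i\<le>n. t ^ n *\<^sub>R Q (?P i) (?P (n - i)))"
      unfolding D by (simp add: flow_coeff.simps(2) scaleR_sum_right del: of_nat_Suc)
    also have "\<dots> = (\<Sum>i\<le>n. Q (t ^ i *\<^sub>R ?P i) (t ^ (n - i) *\<^sub>R ?P (n - i)))"
      by (intro sum.cong refl) (simp add: scaleR_left scaleR_right flip: power_add)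
    finally show ?thesis .
  qed
  with Cauchy_product_bilinear_sums[OF bounded_bilinear_axioms norm norm]
  have "(\<lambda>n. series.Df (Suc n) (y, t) (0, 1)) sums Q (flow Q (y, t)) (flow Q (y, t))"
    by (simp add: flow_def)
  \<comment> \<open>The index shifts by one: the term of index 0 is constant in time and contributes
    nothing.\<close>
  then have "(\<lambda>n. series.Df n (y, t) (0, 1)) sums (Q (flow Q (y, t)) (flow Q (y, t)) + series.Df 0 (y, t) (0, 1))"
    by (rule sums_Suc)
  then have "(\<Sum>n. series.Df n (y, t) (0, 1)) = Q (flow Q (y, t)) (flow Q (y, t))"
    by (simp add: D sums_iff)
  moreover have "flow Q = (\<lambda>z. \<Sum>n. snd z ^ n *\<^sub>R flow_coeff Q n (fst z))"
    by (simp add: flow_def fun_eq_iff)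
  then have "frechet_derivative (flow Q) (at (y, t)) = (\<lambda>v. \<Sum>n. series.Df n (y, t) v)"
    using frechet_derivative_at[OF series.has_derivative_suminf[OF assms]] by simp
  ultimately show ?thesis by simp
qed

lemma flow_has_vector_derivative:
  assumes "(y, t) \<in> ball 0 2"
  shows "((\<lambda>s. flow Q (y, s)) has_vector_derivative Q (flow Q (y, t)) (flow Q (y, t))) (at t)"
proof -
  note F = smooth_on_has_derivative[OF smooth_on_flow assms]
  have "((\<lambda>s. (y, s)) has_derivative (\<lambda>s. (0, s))) (at t)"
    by (auto intro!: derivative_eq_intros)
  from has_derivative_compose[OF this F]
  have "((\<lambda>s. flow Q (y, s)) has_derivative (\<lambda>s. frechet_derivative (flow Q) (at (y, t)) (0, s))) (at t)" .
  moreover have "frechet_derivative (flow Q) (at (y, t)) (0, s)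
      = s *\<^sub>R Q (flow Q (y, t)) (flow Q (y, t))" for s
    using linear_cmul[OF has_derivative_linear[OF F], of s "(0, 1)"]
      flow_time_derivative[OF assms] by simp
  ultimately show ?thesis by (simp add: has_vector_derivative_def)
qed

end

section \<open>Matrix algebra\<close>

lemma bounded_bilinear_matrix_mult:
  "bounded_bilinear ((**) :: real^'n^'m \<Rightarrow> real^'p^'n \<Rightarrow> real^'p^'m)"
proof -
  have "bilinear ((**) :: real^'n^'m \<Rightarrow> real^'p^'n \<Rightarrow> real^'p^'m)"
    unfolding bilinear_def
    by (auto intro!: linearI simp: matrix_matrix_mult_def vec_eq_iff sum.distrib distrib_left distrib_right
        sum_distrib_left mult_ac)
  then show ?thesis by (simp add: bilinear_conv_bounded_bilinear)
qed

lemma bounded_bilinear_matrix_vector_mult: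
  "bounded_bilinear ((*v) :: real^'n^'m \<Rightarrow> real^'n \<Rightarrow> real^'m)"
proof -
  have "bilinear ((*v) :: real^'n^'m \<Rightarrow> real^'n \<Rightarrow> real^'m)"
    unfolding bilinear_def
    by (auto intro!: linearI simp: matrix_vector_mult_def vec_eq_iff sum.distrib distrib_left distrib_right
        sum_distrib_left mult_ac)
  then show ?thesis by (simp add: bilinear_conv_bounded_bilinear)
qed

lemma matrix_inv_right: "invertible A \<Longrightarrow> A ** matrix_inv A = mat 1"
  and matrix_inv_left: "invertible A \<Longrightarrow> matrix_inv A ** A = mat 1"
  for A :: "real^'n^'n"
  unfolding invertible_def matrix_inv_def by (metis (mono_tags, lifting) someI_ex)+

lemma matrix_inv_unique: "A ** B = mat 1 \<Longrightarrow> matrix_inv A = B" for A :: "real^'n^'n"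
  by (metis invertible_right_inverse matrix_inv_left matrix_mul_assoc matrix_mul_lid matrix_mul_rid)

section \<open>Differential inequalities\<close>

text \<open>
  Only some arbitrarily small steps \<open>h\<close> are required; this is what admits tangent vectors that are
  limits along a mere sequence.
\<close>

lemma lower_Dini_Gronwall:
  fixes f :: "real \<Rightarrow> real"
  assumes cont: "continuous_on {0..T} f" and "0 \<le> T" "f 0 \<le> 0" "0 \<le> K"
    and step: "\<And>t e d. 0 \<le> t \<Longrightarrow> t < T \<Longrightarrow> 0 < e \<Longrightarrow> 0 < d \<Longrightarrow>
      \<exists>h. 0 < h \<and> h < d \<and> f (t + h) \<le> f t + h * (K * f t + e)"
  shows "f T \<le> 0"
proof -
  have le: "f T \<le> e * exp ((K + 1) * T)" if e: "e > 0" for e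
  proof (rule ccontr)
    \<comment> \<open>The rate \<open>K + 1\<close> exceeds \<open>K\<close> by one because
      \<open>e \<le> u t\<close> for t \<ge> 0 lets the error \<open>e\<close> be absorbed as one
      more multiple of \<open>u t\<close>.\<close>
    define u where "u t = e * exp ((K + 1) * t)" for t
    define S where "S = {t \<in> {0..T}. f t \<le> u t}"
    assume "\<not> f T \<le> e * exp ((K + 1) * T)"
    then have T: "\<not> f T \<le> u T" by (simp add: u_def)
    have "closed S" unfolding S_def u_def
      by (intro continuous_on_closed_Collect_le cont continuous_intros closed_atLeastAtMost)
    moreover have "0 \<in> S" using assms(2,3) e by (simp add: S_def u_def)
    moreover have bdd: "bdd_above S" by (auto simp: S_def)
    ultimately have c: "Sup S \<in> S" using closed_contains_Sup by blast
    \<comment> \<open>From the last time at which the barrier holds, one admissible step leads to a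
      later such time.\<close>
    define c where "c = Sup S"
    have c: "0 \<le> c" "c \<le> T" "f c \<le> u c" using c by (auto simp: S_def c_def)
    with T have "c < T" by (cases "c = T") auto
    then obtain h where h: "0 < h" "h < T - c" "f (c + h) \<le> f c + h * (K * f c + e)"
      using step[of c e "T - c"] c e by auto
    have "0 \<le> (K + 1) * c" using c assms by simp
    then have "e \<le> u c" using e by (simp add: u_def)
    have "f (c + h) \<le> f c + h * (K * f c + e)" by fact
    also have "\<dots> \<le> u c + h * (K * u c + u c)"
      using c h \<open>e \<le> u c\<close> assms(4) by (intro add_mono mult_left_mono) auto
    also have "\<dots> = u c * (1 + (K + 1) * h)" by (simp add: algebra_simps)
    also have "\<dots> \<le> u c * exp ((K + 1) * h)"
      using e by (intro mult_left_mono exp_ge_add_one_self) (simp add: u_def)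
    also have "\<dots> = u (c + h)" by (simp add: u_def exp_add[symmetric] algebra_simps)
    finally have "c + h \<in> S" using h c by (simp add: S_def)
    then have "c + h \<le> c" unfolding c_def using bdd by (rule cSup_upper)
    with h show False by simp
  qed
  have "f T \<le> 0 + e" if "e > 0" for e
    using le[of "e / exp ((K + 1) * T)"] that by simp
  then show ?thesis by (rule field_le_epsilon)
qed

lemma has_vector_derivative_within_estimate:
  assumes "(f has_vector_derivative f') (at t within S)" "0 < e"
  shows "\<exists>d>0. \<forall>h. t + h \<in> S \<and> \<bar>h\<bar> < d \<longrightarrow> norm (f (t + h) - f t - h *\<^sub>R f') \<le> e * \<bar>h\<bar>"
proof -
  obtain d where d: "d > 0" "\<And>y. y \<in> S \<Longrightarrow> norm (y - t) < d \<Longrightarrow> norm (f y - f t - (y - t) *\<^sub>R f') \<le> e * norm (y - t)"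
    using assms unfolding has_vector_derivative_def has_derivative_within_alt by blast
  show ?thesis
  proof (intro exI[of _ d] conjI allI impI d(1))
    fix h assume "t + h \<in> S \<and> \<bar>h\<bar> < d"
    with d(2)[of "t + h"] show "norm (f (t + h) - f t - h *\<^sub>R f') \<le> e * \<bar>h\<bar>" by simp
  qed
qed

text \<open>Gronwall for the norm of \<open>f\<close>. The norm may fail to be differentiable where
  \<open>f\<close> vanishes, so the step estimate replaces a derivative.\<close>

lemma ODE_zero_unique:
  fixes f :: "real \<Rightarrow> 'a::real_normed_vector"
  assumes f: "\<And>t. t \<in> {0..T} \<Longrightarrow> (f has_vector_derivative f' t) (at t within {0..T})"
    and f': "\<And>t. t \<in> {0..T} \<Longrightarrow> norm (f' t) \<le> K * norm (f t)"
    and "f 0 = 0" "0 \<le> T" "0 \<le> K"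
  shows "f T = 0"
proof -
  have "norm (f T) \<le> 0"
  proof (rule lower_Dini_Gronwall[where f = "\<lambda>t. norm (f t)"])
    show "continuous_on {0..T} (\<lambda>t. norm (f t))"
      using f by (intro continuous_on_norm continuous_on_vector_derivative)
    fix t e d :: real assume t: "0 \<le> t" "t < T" and "0 < e" "0 < d"
    obtain r where r: "r > 0" "\<And>h. t + h \<in> {0..T} \<Longrightarrow> \<bar>h\<bar> < r \<Longrightarrow> norm (f (t + h) - f t - h *\<^sub>R f' t) \<le> e * \<bar>h\<bar>"
      using has_vector_derivative_within_estimate[OF f \<open>0 < e\<close>] t by (metis atLeastAtMost_iff less_imp_le)
    obtain h where h: "0 < h" "h < d" "h < r" "h < T - t"
      using \<open>0 < d\<close> r(1) t dense[of 0 "min d (min r (T - t))"] by auto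
    have "norm (f (t + h)) \<le> norm (f t + h *\<^sub>R f' t) + norm (f (t + h) - f t - h *\<^sub>R f' t)"
      using norm_triangle_ineq[of "f t + h *\<^sub>R f' t" "f (t + h) - f t - h *\<^sub>R f' t"] by simp
    also have "\<dots> \<le> (norm (f t) + h * norm (f' t)) + e * h"
      using r(2)[of h] h t norm_triangle_ineq[of "f t" "h *\<^sub>R f' t"] by (intro add_mono) auto
    also have "\<dots> \<le> norm (f t) + h * (K * norm (f t) + e)"
      using f'[of t] t h mult_left_mono[of "norm (f' t)" "K * norm (f t)" h] by (simp add: algebra_simps)
    finally show "\<exists>h. 0 < h \<and> h < d \<and> norm (f (t + h)) \<le> norm (f t) + h * (K * norm (f t) + e)"
      using h by blast
  qed (use assms in auto)
  then show ?thesis by simp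
qed

section \<open>The tangent cone at the identity\<close>

text \<open>One \<open>e\<close> bounds both the step and the relative error, so shrinking it
  produces h_n -> 0 and A_n in \<open>G\<close> with (A_n - 1) / h_n -> X.\<close>

definition tangent_cone :: "(real^'p^'p) set \<Rightarrow> (real^'p^'p) set" where
  "tangent_cone G = {X. \<forall>e>0. \<exists>h A. 0 < h \<and> h < e \<and> A \<in> G \<and> norm (A - mat 1 - h *\<^sub>R X) \<le> e * h}"

lemma tangent_coneI:
  assumes "(\<gamma> has_vector_derivative X) (at 0)" "\<gamma> 0 = mat 1" "\<forall>\<^sub>F t in at_right 0. \<gamma> t \<in> G"
  shows "X \<in> tangent_cone G"
  unfolding tangent_cone_def mem_Collect_eq
proof (intro allI impI)
  fix e :: real assume e: "e > 0"
  obtain d where d: "d > 0" "\<And>h. \<bar>h\<bar> < d \<Longrightarrow> norm (\<gamma> h - mat 1 - h *\<^sub>R X) \<le> e * \<bar>h\<bar>"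
    using has_vector_derivative_within_estimate[OF assms(1) e] assms(2) by auto
  obtain b where b: "b > 0" "\<And>t. 0 < t \<Longrightarrow> t < b \<Longrightarrow> \<gamma> t \<in> G"
    using assms(3) unfolding eventually_at_right_field by auto
  obtain h where "0 < h" "h < e" "h < d" "h < b"
    using e d(1) b(1) dense[of 0 "min e (min d b)"] by auto
  then show "\<exists>h A. 0 < h \<and> h < e \<and> A \<in> G \<and> norm (A - mat 1 - h *\<^sub>R X) \<le> e * h"
    using d(2)[of h] b(2)[of h] by (intro exI[of _ h] exI[of _ "\<gamma> h"]) auto
qed

lemma tangent_cone_scaleR:
  assumes X: "X \<in> tangent_cone G" and r: "r > 0"
  shows "r *\<^sub>R X \<in> tangent_cone G"
  unfolding tangent_cone_def mem_Collect_eq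
proof (intro allI impI)
  fix e :: real assume e: "e > 0"
  \<comment> \<open>The new step is \<open>h / r\<close>: the bound \<open>e * r\<close> keeps it
    below \<open>e\<close>, and the bound \<open>e / r\<close> expresses the error in terms of
    it.\<close>
  define e' where "e' = min (e * r) (e / r)"
  have "e' > 0" using e r by (simp add: e'_def)
  then obtain h A where h: "0 < h" "h < e'" "A \<in> G" "norm (A - mat 1 - h *\<^sub>R X) \<le> e' * h"
    using X unfolding tangent_cone_def by blast
  have "e' * h \<le> e * (h / r)"
    using mult_right_mono[of e' "e / r" h] h(1) by (simp add: e'_def)
  moreover have "h / r < e" using h(2) r by (simp add: e'_def divide_less_eq)
  ultimately show "\<exists>h A. 0 < h \<and> h < e \<and> A \<in> G \<and> norm (A - mat 1 - h *\<^sub>R r *\<^sub>R X) \<le> e * h"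
    using h r by (intro exI[of _ "h / r"] exI[of _ A]) auto
qed

text \<open>Left multiplication by an element \<open>A\<close> near 1 + h X(t) preserves
  \<open>G\<close> and carries M(t) nearly to M(t + h). If \<open>B\<close> in \<open>G\<close> is
  close to M(t), then \<open>A ** B\<close> is an element of \<open>G\<close> close to M(t + h), so
  the distance to \<open>G\<close> grows by at most a factor 1 + h K and an error e h. M(t) itself
  may lie outside \<open>G\<close>.\<close>

lemma tangent_field_solution_in_closure:
  fixes G :: "(real^'p^'p) set"
  assumes mult: "\<And>A B. A \<in> G \<Longrightarrow> B \<in> G \<Longrightarrow> A ** B \<in> G"
    and M: "\<And>t. t \<in> {0..T} \<Longrightarrow> (M has_vector_derivative X t ** M t) (at t within {0..T})"
    and X: "\<And>t. t \<in> {0..T} \<Longrightarrow> X t \<in> tangent_cone G" "\<And>t. t \<in> {0..T} \<Longrightarrow> norm (X t) \<le> L"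
    and "M 0 \<in> G" "0 \<le> T"
  shows "M T \<in> closure G"
proof -
  interpret mm: bounded_bilinear "(**) :: real^'p^'p \<Rightarrow> real^'p^'p \<Rightarrow> real^'p^'p"
    by (rule bounded_bilinear_matrix_mult)
  obtain c where c: "0 < c" "\<And>(A::real^'p^'p) (B::real^'p^'p). norm (A ** B) \<le> norm A * norm B * c"
    using mm.pos_bounded by blast
  have G: "G \<noteq> {}" using assms by auto
  have L: "0 \<le> L" using order_trans[OF norm_ge_zero X(2)[of 0]] \<open>0 \<le> T\<close> by simp
  define K where "K = (L + 1) * c"
  have K: "0 \<le> K" using L c by (simp add: K_def)
  have "infdist (M T) G \<le> 0"
  proof (rule lower_Dini_Gronwall[where f = "\<lambda>t. infdist (M t) G" and K = K])
    show "continuous_on {0..T} (\<lambda>t. infdist (M t) G)"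
      using M by (intro continuous_on_infdist continuous_on_vector_derivative)
    fix t e d :: real assume t: "0 \<le> t" "t < T" and e: "0 < e" and d: "0 < d"
    obtain r where r: "r > 0"
      "\<And>h. t + h \<in> {0..T} \<Longrightarrow> \<bar>h\<bar> < r \<Longrightarrow> norm (M (t + h) - M t - h *\<^sub>R (X t ** M t)) \<le> e / 2 * \<bar>h\<bar>"
      using has_vector_derivative_within_estimate[OF M, of t "e / 2"] t e
      by (metis atLeastAtMost_iff half_gt_zero less_imp_le)
    \<comment> \<open>With this \<open>q\<close> the error of replacing 1 + h X(t) by
      \<open>A\<close>, after multiplication by M(t), is at most half of e h.\<close>
    define q where "q = e / (2 * c * (norm (M t) + 1))"
    have n: "norm (M t) + 1 > 0" by (simp add: add_nonneg_pos)
    have q: "q > 0" using e c n by (simp add: q_def)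
    have "q * norm (M t) * c \<le> q * (norm (M t) + 1) * c"
      using q c by (intro mult_right_mono mult_left_mono) auto
    also have "\<dots> = e / 2" using c n by (simp add: q_def)
    finally have q': "q * norm (M t) * c \<le> e / 2" .
    define \<epsilon> where "\<epsilon> = min (min 1 q) (min (min r d) (T - t))"
    have "\<epsilon> > 0" using q r d t by (simp add: \<epsilon>_def)
    then obtain h A where h: "0 < h" "h < \<epsilon>" "A \<in> G" and "norm (A - mat 1 - h *\<^sub>R X t) \<le> \<epsilon> * h"
      using X(1)[of t] t unfolding tangent_cone_def by force
    moreover have "\<epsilon> * h \<le> q * h" "\<epsilon> * h \<le> 1 * h"
      using h(1) by (auto simp: \<epsilon>_def intro!: mult_right_mono)
    ultimately have A: "norm (A - mat 1 - h *\<^sub>R X t) \<le> q * h" "norm (A - mat 1 - h *\<^sub>R X t) \<le> h"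
      by linarith+
    have A1: "norm (A - mat 1) \<le> h * (L + 1)"
    proof -
      have "norm (A - mat 1) \<le> norm (A - mat 1 - h *\<^sub>R X t) + norm (h *\<^sub>R X t)"
        using norm_triangle_ineq[of "A - mat 1 - h *\<^sub>R X t" "h *\<^sub>R X t"] by simp
      also have "\<dots> \<le> h + h * L"
        using A h X(2)[of t] t by (intro add_mono) (auto intro: mult_left_mono)
      finally show ?thesis by (simp add: algebra_simps)
    qed
    have "norm (M (t + h) - A ** M t)
        = norm ((M (t + h) - M t - h *\<^sub>R (X t ** M t)) - (A - mat 1 - h *\<^sub>R X t) ** M t)"
      by (simp add: mm.diff_left mm.scaleR_left)
    also have "\<dots> \<le> e / 2 * h + q * h * norm (M t) * c"
    proof (rule order_trans[OF norm_triangle_ineq4 add_mono])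
      show "norm (M (t + h) - M t - h *\<^sub>R (X t ** M t)) \<le> e / 2 * h"
        using r(2)[of h] h t by (simp add: \<epsilon>_def)
      have "norm ((A - mat 1 - h *\<^sub>R X t) ** M t) \<le> norm (A - mat 1 - h *\<^sub>R X t) * norm (M t) * c"
        by (rule c(2))
      also have "\<dots> \<le> q * h * norm (M t) * c"
        using A c by (intro mult_right_mono) auto
      finally show "norm ((A - mat 1 - h *\<^sub>R X t) ** M t) \<le> q * h * norm (M t) * c" .
    qed
    also have "\<dots> = e / 2 * h + q * norm (M t) * c * h" by (simp only: mult_ac)
    also have "\<dots> \<le> e / 2 * h + e / 2 * h"
      using h(1) by (intro add_left_mono mult_right_mono q') simp
    finally have err: "norm (M (t + h) - A ** M t) \<le> e * h" by simp
    have "infdist (M (t + h)) G \<le> e * h + (1 + h * K) * dist (M t) B" if "B \<in> G" for B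
    proof -
      have "norm (A ** M t - A ** B) = norm ((M t - B) + (A - mat 1) ** (M t - B))"
        by (simp add: mm.diff_left mm.diff_right)
      also have "\<dots> \<le> norm (M t - B) + norm (A - mat 1) * norm (M t - B) * c"
        by (rule order_trans[OF norm_triangle_ineq add_left_mono[OF c(2)]])
      also have "\<dots> \<le> norm (M t - B) + h * (L + 1) * norm (M t - B) * c"
        using A1 c by (intro add_left_mono mult_right_mono) auto
      also have "\<dots> = (1 + h * K) * norm (M t - B)" by (simp add: K_def algebra_simps)
      finally have *: "norm (A ** M t - A ** B) \<le> (1 + h * K) * norm (M t - B)" .
      have "infdist (M (t + h)) G \<le> dist (M (t + h)) (A ** B)"
        using mult[OF h(3) that] by (rule infdist_le)
      also have "\<dots> \<le> norm (M (t + h) - A ** M t) + norm (A ** M t - A ** B)"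
        using norm_triangle_ineq[of "M (t + h) - A ** M t" "A ** M t - A ** B"] by (simp add: dist_norm)
      finally show ?thesis using err * by (simp add: dist_norm)
    qed
    then have "(infdist (M (t + h)) G - e * h) / (1 + h * K) \<le> dist (M t) B" if "B \<in> G" for B
      using that K h(1) by (simp add: divide_le_eq add_pos_nonneg algebra_simps)
    then have "(infdist (M (t + h)) G - e * h) / (1 + h * K) \<le> infdist (M t) G"
      unfolding infdist_notempty[OF G] using G by (intro cINF_greatest) auto
    then have "infdist (M (t + h)) G \<le> infdist (M t) G + h * (K * infdist (M t) G + e)"
      using K h(1) by (simp add: divide_le_eq add_pos_nonneg algebra_simps)
    then show "\<exists>h. 0 < h \<and> h < d \<and> infdist (M (t + h)) G \<le> infdist (M t) G + h * (K * infdist (M t) G + e)"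
      using h by (auto simp: \<epsilon>_def)
  qed (use assms K in auto)
  then show ?thesis
    using in_closure_iff_infdist_zero[OF G] infdist_nonneg[of "M T" G] by simp
qed

section \<open>The Lie algebra of a closed linear group\<close>

lemma lie_algebra_scaleR:
  assumes "X \<in> lie_algebra G"
  shows "c *\<^sub>R X \<in> lie_algebra G"
proof -
  obtain \<gamma> e where e: "e > 0" "smooth_on {-e<..<e} \<gamma>" "\<gamma> ` {-e<..<e} \<subseteq> G" "\<gamma> 0 = mat 1"
    "(\<gamma> has_vector_derivative X) (at (0::real))"
    using assms unfolding lie_algebra_def by blast
  \<comment> \<open>Dividing by |c| + 1 rather than by |c| covers \<open>c = 0\<close>.\<close>
  define e' where "e' = e / (\<bar>c\<bar> + 1)"
  have e': "e' > 0" using e by (simp add: e'_def add_nonneg_pos)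
  have dom: "0 + c * t \<in> {-e<..<e}" if "t \<in> {-e'<..<e'}" for t
  proof -
    have "\<bar>c * t\<bar> \<le> (\<bar>c\<bar> + 1) * \<bar>t\<bar>" by (simp add: abs_mult mult_right_mono)
    also have "\<dots> < (\<bar>c\<bar> + 1) * e'" using that by (intro mult_strict_left_mono) auto
    also have "\<dots> = e" using e by (simp add: e'_def)
    finally show ?thesis by (auto simp: abs_less_iff)
  qed
  have "smooth_on {-e'<..<e'} (\<lambda>t. \<gamma> (0 + c * t))"
    using e dom by (intro smooth_on_compose_affine[of "{-e<..<e}"]) (auto intro: bounded_linear_mult_right)
  moreover have "((\<lambda>t. \<gamma> (0 + c * t)) has_vector_derivative c *\<^sub>R X) (at 0)"
  proof -
    have "((\<lambda>t. 0 + c * t) has_vector_derivative c) (at 0)"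
      by (auto intro!: derivative_eq_intros)
    from vector_diff_chain_at[OF this] e(5) show ?thesis by (simp add: o_def)
  qed
  moreover have "(\<lambda>t. \<gamma> (0 + c * t)) ` {-e'<..<e'} \<subseteq> G" using dom e(3) by blast
  ultimately show ?thesis unfolding lie_algebra_def using e' e(4) by (auto intro!: exI[of _ "\<lambda>t. \<gamma> (0 + c * t)"])
qed

lemma lie_algebra_subset_tangent_cone: "lie_algebra G \<subseteq> tangent_cone G"
proof
  fix X assume "X \<in> lie_algebra G"
  then obtain \<gamma> e where e: "e > 0" "\<gamma> ` {-e<..<e} \<subseteq> G" "\<gamma> 0 = mat 1"
    "(\<gamma> has_vector_derivative X) (at (0::real))"
    unfolding lie_algebra_def by blast
  have "\<forall>\<^sub>F t in at_right 0. \<gamma> t \<in> G"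
    unfolding eventually_at_right_field using e by (intro exI[of _ e]) auto
  then show "X \<in> tangent_cone G" using tangent_coneI e by blast
qed

lemma lie_algebra_add_in_tangent_cone:
  assumes mult: "\<And>A B. A \<in> G \<Longrightarrow> B \<in> G \<Longrightarrow> A ** B \<in> G"
    and "X \<in> lie_algebra G" "Y \<in> lie_algebra G"
  shows "X + Y \<in> tangent_cone G"
proof -
  obtain \<gamma> e where e: "e > 0" "\<gamma> ` {-e<..<e} \<subseteq> G" "\<gamma> 0 = mat 1"
    "(\<gamma> has_vector_derivative X) (at (0::real))"
    using assms unfolding lie_algebra_def by blast
  obtain \<delta> d where d: "d > 0" "\<delta> ` {-d<..<d} \<subseteq> G" "\<delta> 0 = mat 1"
    "(\<delta> has_vector_derivative Y) (at (0::real))"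
    using assms unfolding lie_algebra_def by blast
  have "((\<lambda>t. \<gamma> t ** \<delta> t) has_vector_derivative X + Y) (at 0)"
    using bounded_bilinear.has_vector_derivative[OF bounded_bilinear_matrix_mult e(4) d(4)] e(3) d(3)
    by (simp add: add.commute)
  moreover have "\<forall>\<^sub>F t in at_right 0. \<gamma> t ** \<delta> t \<in> G"
    unfolding eventually_at_right_field using e d by (intro exI[of _ "min e d"]) (auto intro!: mult)
  ultimately show ?thesis using e d by (intro tangent_coneI[of "\<lambda>t. \<gamma> t ** \<delta> t"]) auto
qed

lemma quadratic_field_scaled:
  fixes Q :: "'a::euclidean_space \<Rightarrow> 'a \<Rightarrow> 'a"
  assumes "bounded_bilinear Q"
  obtains s where "s > 0" "quadratic_field (\<lambda>x y. s *\<^sub>R Q x y) (1 / 8)"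
proof -
  interpret bounded_bilinear Q by fact
  obtain K where K: "K > 0" "\<And>x y. norm (Q x y) \<le> norm x * norm y * K" using pos_bounded by blast
  \<comment> \<open>The target constant 1/8 lies safely below the bound 1/4 for convergence up to
    radius 2.\<close>
  define s where "s = 1 / (8 * K)"
  have s: "s > 0" using K by (simp add: s_def)
  have b: "norm (s *\<^sub>R Q x y) \<le> 1 / 8 * norm x * norm y" for x y
    using mult_left_mono[OF K(2), of s x y] s K(1) by (simp add: s_def field_simps)
  have "quadratic_field (\<lambda>x y. s *\<^sub>R Q x y) (1 / 8)"
    by unfold_locales
      (use b in \<open>auto simp: add_left add_right scaleR_left scaleR_right algebra_simps intro!: exI[of _ "1/8"]\<close>)
  with s show thesis by (rule that)
qed

text \<open>The linear equation \<open>M' = Y M\<close> is turned into a homogeneous quadratic one for the pair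
  \<open>(M, N)\<close> by adding \<open>N' = 0\<close>.\<close>

lemma linear_ODE_solution:
  fixes Y :: "real^'p^'p"
  obtains r e M where "r > 0" "e > 0" "smooth_on {-e<..<e} M" "M 0 = mat 1"
    "\<And>t. t \<in> {-e<..<e} \<Longrightarrow> (M has_vector_derivative (r *\<^sub>R Y) ** M t) (at t)"
proof -
  interpret mm: bounded_bilinear "(**) :: real^'p^'p \<Rightarrow> real^'p^'p \<Rightarrow> real^'p^'p"
    by (rule bounded_bilinear_matrix_mult)
  \<comment> \<open>On the diagonal the value at (M, N) is (N M, 0): N stays constant and M solves a
    linear equation.\<close>
  let ?Q = "\<lambda>(x :: (real^'p^'p) \<times> (real^'p^'p)) (y :: (real^'p^'p) \<times> (real^'p^'p)). (snd x ** fst y, 0 :: real^'p^'p)"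
  have "bilinear ?Q" unfolding bilinear_def
    by (auto intro!: linearI simp: mm.add_left mm.add_right mm.scaleR_left mm.scaleR_right)
  then obtain s where s: "s > 0" "quadratic_field (\<lambda>x y. s *\<^sub>R ?Q x y) (1 / 8)"
    using quadratic_field_scaled[of ?Q] by (auto simp: bilinear_conv_bounded_bilinear)
  define q where "q = (\<lambda>x y. s *\<^sub>R ?Q x y)"
  interpret quadratic_field q "1 / 8" using s unfolding q_def by simp
  define n where "n = norm (mat 1 :: real^'p^'p, Y)"
  have n: "n \<ge> 0" by (simp add: n_def)
  \<comment> \<open>The initial value (1, Y) is shrunk to norm below 1 so that the series converges
    for |t| < 1. Dividing by \<open>c\<close> afterwards restores M(0) = 1, but N remains
    \<open>c *\<^sub>R Y\<close>; with \<open>s\<close> this makes the factor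
    \<open>r = s * c\<close>.\<close>
  define c where "c = 1 / (n + 1)"
  have c: "c > 0" using n by (simp add: c_def)
  define z where "z = c *\<^sub>R (mat 1 :: real^'p^'p, Y)"
  have "norm z = \<bar>c\<bar> * n" unfolding z_def n_def by (rule norm_scaleR)
  then have "norm z < 1" using n by (simp add: c_def)
  have dom: "(z, t) \<in> ball 0 2" if "t \<in> {-1<..<1}" for t :: real
    using norm_Pair_le[of z t] \<open>norm z < 1\<close> that by (auto simp: abs_less_iff)
  define w where "w t = flow q (z, t)" for t
  have w0: "w 0 = z" by (simp add: w_def)
  have w: "(w has_vector_derivative q (w t) (w t)) (at t)" if "t \<in> {-1<..<1}" for t
    using flow_has_vector_derivative[OF dom[OF that]] by (simp add: w_def[abs_def])
  have fw: "((\<lambda>t. fst (w t)) has_vector_derivative s *\<^sub>R (snd (w t) ** fst (w t))) (at t)"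
    and sw: "((\<lambda>t. snd (w t)) has_vector_derivative 0) (at t)" if "t \<in> {-1<..<1}" for t
    using bounded_linear.has_vector_derivative[OF bounded_linear_fst w[OF that]]
      bounded_linear.has_vector_derivative[OF bounded_linear_snd w[OF that]] by (auto simp: q_def)
  obtain d where d: "\<And>t. t \<in> {-1<..<1} \<Longrightarrow> snd (w t) = d"
    using has_vector_derivative_zero_constant[of "{-1<..<1}" "\<lambda>t. snd (w t)"] sw
    by (metis convex_real_interval(8) has_vector_derivative_at_within)
  from d[of 0] have "d = c *\<^sub>R Y" by (simp add: w0 z_def)
  with d have d: "\<And>t. t \<in> {-1<..<1} \<Longrightarrow> snd (w t) = c *\<^sub>R Y" by simp
  define M where "M t = (1 / c) *\<^sub>R fst (w t)" for t
  show thesis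
  proof (rule that[of "s * c" 1 M])
    show "M 0 = mat 1" using c by (simp add: M_def w0 z_def)
    show "(M has_vector_derivative ((s * c) *\<^sub>R Y) ** M t) (at t)" if "t \<in> {-1<..<1}" for t
      using bounded_linear.has_vector_derivative[OF bounded_linear_scaleR_right fw[OF that], of "1 / c"] c d[OF that]
      by (simp add: M_def[abs_def] mm.scaleR_left mm.scaleR_right mult.commute)
    have "smooth_on {-1<..<1} (\<lambda>t. flow q ((z, 0) + (0, t)))"
      by (rule smooth_on_compose_affine[OF smooth_on_flow])
        (use dom in \<open>auto intro!: bounded_linear_Pair bounded_linear_zero bounded_linear_ident simp del: mem_ball\<close>)
    then have "smooth_on {-1<..<1} w" by (simp add: w_def[abs_def])
    then have "smooth_on {-1<..<1} (\<lambda>t. fst (w t))"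
      by (intro smooth_on_compose_bounded_linear[OF bounded_linear_fst]) auto
    then show "smooth_on {-1<..<1} M"
      unfolding M_def by (intro smooth_on_compose_bounded_linear[OF bounded_linear_scaleR_right]) auto
  qed (use s c in auto)
qed

text \<open>M(u - t) and M(u) M(-t) solve the same linear equation in u and agree at u = 0; u = t
  gives the group law for opposite times.\<close>

lemma linear_ODE_solution_minus:
  fixes X :: "real^'p^'p"
  assumes M: "\<And>t. t \<in> {-e<..<e} \<Longrightarrow> (M has_vector_derivative X ** M t) (at t)"
    and M0: "M 0 = mat 1" and t: "0 \<le> t" "t < e"
  shows "M t ** M (- t) = mat 1"
proof -
  interpret mm: bounded_bilinear "(**) :: real^'p^'p \<Rightarrow> real^'p^'p \<Rightarrow> real^'p^'p"
    by (rule bounded_bilinear_matrix_mult)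
  obtain c where c: "0 < c" "\<And>(A::real^'p^'p) (B::real^'p^'p). norm (A ** B) \<le> norm A * norm B * c"
    using mm.pos_bounded by blast
  define f where "f u = M (u - t) - M u ** M (- t)" for u
  have "f t = 0"
  proof (rule ODE_zero_unique[where f' = "\<lambda>u. X ** f u" and K = "norm X * c"])
    fix u assume u: "u \<in> {0..t}"
    then have "((\<lambda>u. M (u - t)) has_vector_derivative 1 *\<^sub>R (X ** M (u - t))) (at u)"
      using t vector_diff_chain_at[of "\<lambda>u. u - t" 1 u M "X ** M (u - t)"] M[of "u - t"]
      by (simp add: o_def has_vector_derivative_diff_const)
    moreover have "((\<lambda>u. M u ** M (- t)) has_vector_derivative (X ** M u) ** M (- t)) (at u)"
      using bounded_linear.has_vector_derivative[OF mm.bounded_linear_left M[of u], of "M (- t)"] u t by simp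
    ultimately have "(f has_vector_derivative 1 *\<^sub>R (X ** M (u - t)) - (X ** M u) ** M (- t)) (at u)"
      unfolding f_def by (rule has_vector_derivative_diff)
    then show "(f has_vector_derivative X ** f u) (at u within {0..t})"
      by (simp add: f_def mm.diff_right matrix_mul_assoc has_vector_derivative_at_within)
    show "norm (X ** f u) \<le> norm X * c * norm (f u)" using c(2)[of X "f u"] by (simp add: mult_ac)
  qed (use t c M0 in \<open>auto simp: f_def\<close>)
  then show ?thesis by (simp add: f_def M0)
qed

text \<open>\<open>G\<close> is closed relative to \<open>GL\<close>, so a limit of its elements can
  be kept in \<open>G\<close> once it is known to be invertible.\<close>

lemma closure_in_linear_Lie_group:
  assumes "linear_Lie_group G" "A \<in> closure G" "invertible A"
  shows "A \<in> G"
proof -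
  have "closedin (top_of_set GL) G" using assms(1) by (simp add: linear_Lie_group_def)
  then obtain S where "closed S" "G = GL \<inter> S" by (auto simp: closedin_closed)
  then show ?thesis using assms(2,3) closure_minimal[of G S] by (auto simp: GL_def)
qed

text \<open>Cartan's closed subgroup theorem at the level of tangent spaces.\<close>

lemma tangent_cone_subset_lie_algebra:
  assumes G: "linear_Lie_group G"
  shows "tangent_cone G \<subseteq> lie_algebra G"
proof
  fix Y assume Y: "Y \<in> tangent_cone G"
  obtain r e M where r: "r > 0" and e: "e > 0" and M: "smooth_on {-e<..<e} M" "M 0 = mat 1"
    "\<And>t. t \<in> {-e<..<e} \<Longrightarrow> (M has_vector_derivative (r *\<^sub>R Y) ** M t) (at t)"
    by (rule linear_ODE_solution[of Y]) (rule that; assumption)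
  \<comment> \<open>Invariance of \<open>G\<close> is a forward statement; negative times follow
    because M(-t) is the inverse of M(t).\<close>
  have pos: "M t \<in> G" "M (- t) \<in> G" if t: "0 \<le> t" "t < e" for t
  proof -
    have inv: "M t ** M (- t) = mat 1"
      using linear_ODE_solution_minus[OF M(3,2) t] .
    have "invertible (M t)" unfolding invertible_right_inverse using inv by blast
    have "M t \<in> closure G"
    proof (rule tangent_field_solution_in_closure[where X = "\<lambda>t. r *\<^sub>R Y" and L = "norm (r *\<^sub>R Y)"])
      show "(M has_vector_derivative (r *\<^sub>R Y) ** M u) (at u within {0..t})" if "u \<in> {0..t}" for u
        by (rule has_vector_derivative_at_within[OF M(3)]) (use that t in auto)
      show "A ** B \<in> G" if "A \<in> G" "B \<in> G" for A B
        using G that by (simp add: linear_Lie_group_def)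
      show "M 0 \<in> G" using G M(2) by (simp add: linear_Lie_group_def)
    qed (use t tangent_cone_scaleR[OF Y r] in auto)
    then show "M t \<in> G"
      using \<open>invertible (M t)\<close> by (rule closure_in_linear_Lie_group[OF G])
    then show "M (- t) \<in> G"
      using G matrix_inv_unique[OF inv] by (auto simp: linear_Lie_group_def)
  qed
  have "M t \<in> G" if "t \<in> {-e<..<e}" for t
    using pos[of t] pos(2)[of "- t"] that by (cases "0 \<le> t") auto
  then have "M ` {-e<..<e} \<subseteq> G" by blast
  moreover have "(M has_vector_derivative r *\<^sub>R Y) (at 0)"
    using M(3)[of 0] M(2) e by simp
  ultimately have "r *\<^sub>R Y \<in> lie_algebra G"
    unfolding lie_algebra_def using e M by blast
  from lie_algebra_scaleR[OF this, of "1 / r"] show "Y \<in> lie_algebra G" using r by simp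
qed

lemma tangent_cone_eq_lie_algebra:
  "linear_Lie_group G \<Longrightarrow> tangent_cone G = lie_algebra G"
  using tangent_cone_subset_lie_algebra lie_algebra_subset_tangent_cone by blast

lemma subspace_lie_algebra:
  assumes G: "linear_Lie_group G"
  shows "subspace (lie_algebra G)"
  unfolding subspace_def
proof (intro conjI ballI allI)
  have "0 \<in> tangent_cone G"
    using G by (intro tangent_coneI[of "\<lambda>t. mat 1"]) (auto simp: linear_Lie_group_def)
  then show "0 \<in> lie_algebra G" using tangent_cone_eq_lie_algebra[OF G] by simp
  fix X Y assume "X \<in> lie_algebra G" "Y \<in> lie_algebra G"
  then show "X + Y \<in> lie_algebra G"
    using lie_algebra_add_in_tangent_cone[of G] tangent_cone_eq_lie_algebra[OF G] G
    by (auto simp: linear_Lie_group_def)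
qed (rule lie_algebra_scaleR)

section \<open>Smooth paths in a connected closed linear group\<close>

text \<open>Smoothness is demanded on an open neighbourhood, membership in \<open>G\<close> only on
  [0, 1]; an isotopy is required in the same shape.\<close>

definition joinable :: "(real^'p^'p) set \<Rightarrow> real^'p^'p \<Rightarrow> bool" where
  "joinable G A \<longleftrightarrow> (\<exists>c U. open U \<and> {0..1} \<subseteq> U \<and> smooth_on U c \<and> c ` {0..1} \<subseteq> G \<and>
     c (0::real) = mat 1 \<and> c 1 = A)"

lemma joinable_mat_1: "mat 1 \<in> G \<Longrightarrow> joinable G (mat 1)"
  unfolding joinable_def by (intro exI[of _ "\<lambda>t. mat 1"] exI[of _ UNIV]) (auto intro: smooth_on_const)

text \<open>Pointwise multiplication keeps the path smooth, whereas concatenation could produce a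
  corner.\<close>

lemma joinable_mult:
  assumes mult: "\<And>A B. A \<in> G \<Longrightarrow> B \<in> G \<Longrightarrow> A ** B \<in> G"
    and "joinable G A" "joinable G B"
  shows "joinable G (A ** B)"
proof -
  obtain c U where c: "open U" "{0..1} \<subseteq> U" "smooth_on U c" "c ` {0..1} \<subseteq> G" "c (0::real) = mat 1" "c 1 = A"
    using assms unfolding joinable_def by blast
  obtain d V where d: "open V" "{0..1} \<subseteq> V" "smooth_on V d" "d ` {0..1} \<subseteq> G" "d (0::real) = mat 1" "d 1 = B"
    using assms unfolding joinable_def by blast
  have "smooth_on (U \<inter> V) (\<lambda>t. c t ** d t)"
    using c d smooth_on_subset[of U c "U \<inter> V"] smooth_on_subset[of V d "U \<inter> V"]
    by (intro smooth_on_bilinear[OF bounded_bilinear_matrix_mult]) auto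
  then show ?thesis unfolding joinable_def using c d
    by (intro exI[of _ "\<lambda>t. c t ** d t"] exI[of _ "U \<inter> V"]) (auto intro!: mult)
qed

text \<open>Reversing the path and translating it by the fixed \<open>matrix_inv A\<close> avoids
  differentiating matrix inversion along the path.\<close>

lemma joinable_inv:
  assumes mult: "\<And>A B. A \<in> G \<Longrightarrow> B \<in> G \<Longrightarrow> A ** B \<in> G"
    and "joinable G A" "invertible A" "matrix_inv A \<in> G"
  shows "joinable G (matrix_inv A)"
proof -
  obtain c U where c: "open U" "{0..1} \<subseteq> U" "smooth_on U c" "c ` {0..1} \<subseteq> G" "c (0::real) = mat 1" "c 1 = A"
    using assms unfolding joinable_def by blast
  define V where "V = (\<lambda>t. 1 - t) -` U"
  have V: "open V" unfolding V_def using c by (intro open_vimage continuous_intros)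
  have sub: "1 - t \<in> U" if "0 \<le> t" "t \<le> 1" for t using that by (intro subsetD[OF c(2)]) simp
  have "smooth_on V (\<lambda>t. c (1 + - t))"
    using c V by (intro smooth_on_compose_affine[of U]) (auto simp: V_def intro: bounded_linear_minus bounded_linear_ident)
  then have "smooth_on V (\<lambda>t. matrix_inv A ** c (1 - t))"
    using smooth_on_compose_bounded_linear[OF bounded_bilinear.bounded_linear_right[OF bounded_bilinear_matrix_mult] V]
    by simp
  then show ?thesis unfolding joinable_def using c V assms(3,4)
    by (intro exI[of _ "\<lambda>t. matrix_inv A ** c (1 - t)"] exI[of _ V])
      (auto intro!: mult simp: V_def matrix_inv_left sub)
qed

lemma joinable_curve:
  assumes "smooth_on {-e<..<e} \<gamma>" "\<gamma> ` {-e<..<e} \<subseteq> G" "\<gamma> (0::real) = mat 1" "\<bar>s\<bar> < e"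
  shows "joinable G (\<gamma> s)"
proof -
  define V where "V = (\<lambda>t. t * s) -` {-e<..<e}"
  have V: "open V" unfolding V_def by (intro open_vimage continuous_intros open_greaterThanLessThan)
  have "smooth_on V (\<lambda>t. \<gamma> (0 + t * s))"
    using assms V by (intro smooth_on_compose_affine[of "{-e<..<e}"])
      (auto simp: V_def intro: bounded_linear_mult_left)
  moreover have sub: "{0..1} \<subseteq> V"
  proof
    fix t :: real assume "t \<in> {0..1}"
    then have "\<bar>t * s\<bar> \<le> 1 * \<bar>s\<bar>" unfolding abs_mult by (intro mult_right_mono) auto
    then show "t \<in> V" using assms(4) by (auto simp: V_def abs_less_iff)
  qed
  ultimately show ?thesis unfolding joinable_def using V assms(2,3)
    by (intro exI[of _ "\<lambda>t. \<gamma> (t * s)"] exI[of _ V]) (auto simp: V_def)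
qed

text \<open>Otherwise there are arbitrarily small nonzero displacements Y orthogonal to the cone,
  and their normalizations accumulate at a unit vector. It is a sequential tangent vector, yet as a
  limit of vectors orthogonal to the cone it is orthogonal to itself.\<close>

lemma orthogonal_complement_separated:
  fixes G :: "(real^'p^'p) set"
  shows "\<exists>d>0. \<forall>Y. (\<forall>X\<in>tangent_cone G. X \<bullet> Y = 0) \<and> norm Y < d \<and> mat 1 + Y \<in> G \<longrightarrow> Y = 0"
proof (rule ccontr)
  assume "\<not> ?thesis"
  then have neg: "\<exists>Y. (\<forall>X\<in>tangent_cone G. X \<bullet> Y = 0) \<and> norm Y < d \<and> mat 1 + Y \<in> G \<and> Y \<noteq> 0"
    if "d > 0" for d using that by blast
  have "\<forall>n. \<exists>Y. (\<forall>X\<in>tangent_cone G. X \<bullet> Y = 0) \<and> norm Y < inverse (real (Suc n)) \<and> mat 1 + Y \<in> G \<and> Y \<noteq> 0"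
    by (intro allI neg) simp
  then obtain Y where "\<forall>n. (\<forall>X\<in>tangent_cone G. X \<bullet> Y n = 0) \<and> norm (Y n) < inverse (real (Suc n)) \<and>
      mat 1 + Y n \<in> G \<and> Y n \<noteq> 0"
    by (rule choice[THEN exE])
  then have Y: "\<And>n X. X \<in> tangent_cone G \<Longrightarrow> X \<bullet> Y n = 0"
    "\<And>n. norm (Y n) < inverse (real (Suc n))" "\<And>n. mat 1 + Y n \<in> G" "\<And>n. Y n \<noteq> 0"
    by blast+
  define u where "u n = Y n /\<^sub>R norm (Y n)" for n
  have "\<forall>n. u n \<in> sphere 0 1" using Y(4) by (simp add: u_def)
  then obtain l \<phi> where l: "l \<in> sphere 0 1" "strict_mono \<phi>" "(u \<circ> \<phi>) \<longlonglongrightarrow> l"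
    by (rule seq_compactE[OF compact_imp_seq_compact[OF compact_sphere]])
  have "l \<in> tangent_cone G" unfolding tangent_cone_def mem_Collect_eq
  proof (intro allI impI)
    fix e :: real assume e: "e > 0"
    have "\<forall>\<^sub>F n in sequentially. dist ((u \<circ> \<phi>) n) l < e" using l(3) e by (rule tendstoD)
    moreover from order_tendstoD(2)[OF LIMSEQ_subseq_LIMSEQ[OF LIMSEQ_inverse_real_of_nat l(2)] e]
    have "\<forall>\<^sub>F n in sequentially. inverse (real (Suc (\<phi> n))) < e"
      by (simp only: comp_def)
    ultimately have "\<forall>\<^sub>F n in sequentially. dist ((u \<circ> \<phi>) n) l < e \<and> inverse (real (Suc (\<phi> n))) < e"
      by (rule eventually_conj)
    from eventually_happens'[OF sequentially_bot this]
    obtain n where n: "norm (u (\<phi> n) - l) < e" "inverse (real (Suc (\<phi> n))) < e"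
      by (auto simp: dist_norm)
    let ?h = "norm (Y (\<phi> n))"
    have "(mat 1 + Y (\<phi> n)) - mat 1 - ?h *\<^sub>R l = ?h *\<^sub>R (u (\<phi> n) - l)"
      using Y(4)[of "\<phi> n"] by (simp add: u_def scaleR_diff_right)
    then have "norm ((mat 1 + Y (\<phi> n)) - mat 1 - ?h *\<^sub>R l) \<le> e * ?h"
      using mult_left_mono[of "norm (u (\<phi> n) - l)" e ?h] n(1) by (simp add: mult.commute)
    then show "\<exists>h A. 0 < h \<and> h < e \<and> A \<in> G \<and> norm (A - mat 1 - h *\<^sub>R l) \<le> e * h"
      using Y(2)[of "\<phi> n"] Y(3)[of "\<phi> n"] Y(4)[of "\<phi> n"] n(2)
      by (intro exI[of _ ?h] exI[of _ "mat 1 + Y (\<phi> n)"]) auto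
  qed
  then have "l \<bullet> (u \<circ> \<phi>) n = 0" for n using Y(1) by (simp add: u_def)
  with tendsto_inner[OF tendsto_const[of l] l(3)] have "(\<lambda>n. 0) \<longlonglongrightarrow> l \<bullet> l" by simp
  then have "l \<bullet> l = 0" using LIMSEQ_unique tendsto_const by blast
  with l(1) show False by simp
qed

section \<open>Local coordinates from products of curves\<close>

primrec curve_product :: "('i \<Rightarrow> real \<Rightarrow> real^'p^'p) \<Rightarrow> ('i \<Rightarrow> 'a \<Rightarrow> real) \<Rightarrow> 'i list \<Rightarrow> 'a \<Rightarrow> real^'p^'p" where
  "curve_product \<gamma> x [] Z = mat 1"
| "curve_product \<gamma> x (b # bs) Z = \<gamma> b (x b Z) ** curve_product \<gamma> x bs Z"

lemma curve_product_at_0: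
  "(\<And>b. b \<in> set bs \<Longrightarrow> x b 0 = 0 \<and> \<gamma> b 0 = mat 1) \<Longrightarrow> curve_product \<gamma> x bs 0 = mat 1"
  by (induction bs) auto

lemma curve_product_has_derivative:
  fixes x :: "'i \<Rightarrow> 'a::real_normed_vector \<Rightarrow> real"
  assumes "\<And>b. b \<in> set bs \<Longrightarrow> bounded_linear (x b)" "\<And>b. b \<in> set bs \<Longrightarrow> \<gamma> b 0 = mat 1"
    "\<And>b. b \<in> set bs \<Longrightarrow> (\<gamma> b has_vector_derivative v b) (at 0)"
  shows "(curve_product \<gamma> x bs has_derivative (\<lambda>H. \<Sum>b\<leftarrow>bs. x b H *\<^sub>R v b)) (at 0)"
  using assms
proof (induction bs)
  case Nil
  have "curve_product \<gamma> x [] = (\<lambda>Z. mat 1)" by (simp add: fun_eq_iff)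
  then show ?case by simp
next
  case (Cons b bs)
  have x0: "x c 0 = 0" if "c \<in> set (b # bs)" for c
    using Cons.prems(1)[OF that] by (simp add: linear_simps(3))
  have "(\<gamma> b has_derivative (\<lambda>h. h *\<^sub>R v b)) (at (x b 0))"
    using Cons.prems(3)[of b] x0[of b] by (simp add: has_vector_derivative_def)
  moreover have "(x b has_derivative x b) (at 0)"
    using Cons.prems(1)[of b] by (simp add: bounded_linear_imp_has_derivative)
  ultimately have "((\<lambda>Z. \<gamma> b (x b Z)) has_derivative (\<lambda>H. x b H *\<^sub>R v b)) (at 0)"
    using has_derivative_compose by blast
  from bounded_bilinear.FDERIV[OF bounded_bilinear_matrix_mult this Cons.IH]
  have "((\<lambda>Z. \<gamma> b (x b Z) ** curve_product \<gamma> x bs Z) has_derivative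
      (\<lambda>H. \<Sum>b\<leftarrow>b # bs. x b H *\<^sub>R v b)) (at 0)"
    using Cons.prems curve_product_at_0[of bs x \<gamma>] x0 by (simp add: add.commute)
  moreover have "curve_product \<gamma> x (b # bs) = (\<lambda>Z. \<gamma> b (x b Z) ** curve_product \<gamma> x bs Z)"
    by (simp add: fun_eq_iff)
  ultimately show ?case by (simp only:)
qed

lemma curve_product_continuous_on:
  assumes "\<And>b. b \<in> set bs \<Longrightarrow> continuous_on S (\<lambda>Z. \<gamma> b (x b Z))"
  shows "continuous_on S (curve_product \<gamma> x bs)"
  using assms
  by (induction bs) (auto intro!: bounded_bilinear.continuous_on[OF bounded_bilinear_matrix_mult])

text \<open>Let \<open>P\<close> be the orthogonal projection onto the Lie algebra and F(Z) a
  product of curves in \<open>G\<close>, one for each basis vector, with the coordinates of Z as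
  parameters. Then F(Z) (1 + Z - P Z) has derivative P + (1 - P) at 0, the identity, so its values
  fill a neighbourhood of 1. If such a value lies in \<open>G\<close>, so does 1 + Z - P Z;
  separation forces Z = P Z, and the value is a product of curves.\<close>

lemma joinable_near_identity:
  fixes G :: "(real^'p^'p) set"
  assumes G: "linear_Lie_group G"
  shows "\<exists>r>0. \<forall>A\<in>G. dist A (mat 1) < r \<longrightarrow> joinable G A"
proof -
  have mult: "\<And>A B. A \<in> G \<Longrightarrow> B \<in> G \<Longrightarrow> A ** B \<in> G" and "mat 1 \<in> G"
    using G by (auto simp: linear_Lie_group_def)
  obtain B where B: "B \<subseteq> lie_algebra G" "pairwise orthogonal B" "\<And>b. b \<in> B \<Longrightarrow> norm b = 1"
    "independent B" "span B = lie_algebra G"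
    using orthonormal_basis_subspace[OF subspace_lie_algebra[OF G]] by metis
  have "finite B" using B(4) by (rule independent_imp_finite)
  then obtain bs where bs: "set bs = B" "distinct bs" using finite_distinct_list by blast
  have "\<forall>b\<in>B. \<exists>\<gamma> e. e > 0 \<and> smooth_on {-e<..<e} \<gamma> \<and> \<gamma> ` {-e<..<e} \<subseteq> G \<and> \<gamma> 0 = mat 1 \<and>
      (\<gamma> has_vector_derivative b) (at (0::real))"
    using B(1) unfolding lie_algebra_def by auto
  then obtain \<gamma> e where \<gamma>: "\<And>b. b \<in> B \<Longrightarrow> e b > 0" "\<And>b. b \<in> B \<Longrightarrow> smooth_on {- e b<..<e b} (\<gamma> b)"
    "\<And>b. b \<in> B \<Longrightarrow> \<gamma> b ` {- e b<..<e b} \<subseteq> G" "\<And>b. b \<in> B \<Longrightarrow> \<gamma> b 0 = mat 1"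
    "\<And>b. b \<in> B \<Longrightarrow> (\<gamma> b has_vector_derivative b) (at (0::real))"
    by metis
  define x where "x = (\<lambda>(b :: real^'p^'p) (Z :: real^'p^'p). Z \<bullet> b)"
  \<comment> \<open>As basis vectors have norm 1, this radius keeps every curve parameter inside its
    interval. The inserted 1 covers an empty basis.\<close>
  define \<epsilon> where "\<epsilon> = Min (insert 1 (e ` B))"
  have \<epsilon>: "\<epsilon> > 0" "\<And>b. b \<in> B \<Longrightarrow> \<epsilon> \<le> e b"
    using \<open>finite B\<close> \<gamma>(1) by (auto simp: \<epsilon>_def)
  have small: "\<bar>x b Z\<bar> < e b" if "b \<in> B" "Z \<in> ball 0 \<epsilon>" for b Z
    using Cauchy_Schwarz_ineq2[of Z b] B(3)[OF that(1)] \<epsilon>(2)[OF that(1)] that(2) by (simp add: x_def)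
  define P where "P Z = (\<Sum>b\<in>B. x b Z *\<^sub>R b)" for Z
  define F where "F = curve_product \<gamma> x bs"
  define \<Phi> where "\<Phi> Z = F Z ** (mat 1 + (Z - P Z))" for Z
  have blx: "bounded_linear (x b)" for b unfolding x_def by (rule bounded_linear_inner_left)
  have blP: "bounded_linear P" unfolding P_def
    by (intro bounded_linear_sum bounded_linear_compose[OF bounded_linear_scaleR_left blx])
  have F0: "F 0 = mat 1" unfolding F_def using \<gamma>(4) bs by (intro curve_product_at_0) (auto simp: x_def)
  have contF: "continuous_on (ball 0 \<epsilon>) F" unfolding F_def
  proof (rule curve_product_continuous_on)
    fix b assume "b \<in> set bs"
    then have b: "b \<in> B" using bs by simp
    show "continuous_on (ball 0 \<epsilon>) (\<lambda>Z. \<gamma> b (x b Z))"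
    proof (rule continuous_on_compose2[OF smooth_on_imp_continuous_on[OF \<gamma>(2)[OF b]]])
      show "continuous_on (ball 0 \<epsilon>) (x b)" by (rule linear_continuous_on[OF blx])
      show "x b ` ball 0 \<epsilon> \<subseteq> {- e b<..<e b}"
        by (rule image_subsetI) (drule small[OF b], simp add: abs_less_iff minus_less_iff)
    qed
  qed
  have derF: "(F has_derivative P) (at 0)"
  proof -
    have "(F has_derivative (\<lambda>H. \<Sum>b\<leftarrow>bs. x b H *\<^sub>R b)) (at 0)"
      unfolding F_def using \<gamma> bs blx by (intro curve_product_has_derivative) auto
    moreover have "(\<lambda>H. \<Sum>b\<leftarrow>bs. x b H *\<^sub>R b) = P"
      unfolding P_def using bs by (simp add: sum_list_distinct_conv_sum_set fun_eq_iff)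
    ultimately show ?thesis by simp
  qed
  have joinF: "joinable G (F Z) \<and> F Z \<in> G" if Z: "Z \<in> ball 0 \<epsilon>" for Z
  proof -
    have "set cs \<subseteq> B \<Longrightarrow> joinable G (curve_product \<gamma> x cs Z) \<and> curve_product \<gamma> x cs Z \<in> G" for cs
    proof (induction cs)
      case Nil
      then show ?case using \<open>mat 1 \<in> G\<close> by (simp add: joinable_mat_1)
    next
      case (Cons b cs)
      then have b: "b \<in> B" by simp
      have "\<gamma> b (x b Z) \<in> G" using \<gamma>(3)[OF b] small[OF b Z] by (auto simp: abs_less_iff)
      moreover have "joinable G (\<gamma> b (x b Z))"
        using joinable_curve[OF \<gamma>(2,3,4)[OF b] small[OF b Z]] .
      ultimately show ?case using Cons joinable_mult[OF mult] mult by simp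
    qed
    then show ?thesis using bs by (simp add: F_def)
  qed
  obtain d where d: "d > 0"
    "\<And>Y. (\<And>X. X \<in> lie_algebra G \<Longrightarrow> X \<bullet> Y = 0) \<Longrightarrow> norm Y < d \<Longrightarrow> mat 1 + Y \<in> G \<Longrightarrow> Y = 0"
    using orthogonal_complement_separated[of G] unfolding tangent_cone_eq_lie_algebra[OF G] by metis
  have bl: "bounded_linear (\<lambda>Z. Z - P Z)" by (intro bounded_linear_sub bounded_linear_ident blP)
  obtain K where K: "K > 0" "\<And>Z. norm (Z - P Z) \<le> norm Z * K"
    using bounded_linear.pos_bounded[OF bl] by blast
  \<comment> \<open>On this smaller ball Z - P Z also has norm below \<open>d\<close>, as separation
    demands.\<close>
  define \<eta> where "\<eta> = min \<epsilon> (d / K)"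
  have \<eta>: "\<eta> > 0" "\<eta> \<le> \<epsilon>" "\<eta> \<le> d / K" using \<epsilon> d(1) K(1) by (auto simp: \<eta>_def)
  have orth: "X \<bullet> (Z - P Z) = 0" if "X \<in> lie_algebra G" for X Z
  proof -
    have "b \<bullet> (Z - P Z) = 0" if b: "b \<in> B" for b
    proof -
      have "b \<bullet> P Z = (\<Sum>c\<in>B. x c Z * (b \<bullet> c))" by (simp add: P_def inner_sum_right)
      also have "\<dots> = (\<Sum>c\<in>B. if c = b then x c Z else 0)"
        using B(2,3) b by (intro sum.cong refl) (auto simp: pairwise_def orthogonal_def norm_eq_1)
      finally show ?thesis using \<open>finite B\<close> b by (simp add: x_def inner_diff_right inner_commute)
    qed
    moreover have "X \<in> span B" using B(5) that by simp
    ultimately have "orthogonal (Z - P Z) X"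
      by (intro orthogonal_to_span[of X B]) (auto simp: orthogonal_def inner_commute)
    then show ?thesis by (simp add: orthogonal_def inner_commute)
  qed
  \<comment> \<open>Continuity near 0 and an invertible derivative at the single point 0 are
    available, which is what this open mapping theorem takes.\<close>
  have "\<Phi> 0 \<in> interior (\<Phi> ` ball 0 \<eta>)"
  proof (rule sussmann_open_mapping[OF open_ball])
    show "continuous_on (ball 0 \<epsilon>) \<Phi>" unfolding \<Phi>_def
      by (intro bounded_bilinear.continuous_on[OF bounded_bilinear_matrix_mult] contF continuous_intros
          linear_continuous_on[OF blP])
    have "((\<lambda>Z. mat 1 + (Z - P Z)) has_derivative (\<lambda>H. H - P H)) (at 0)"
      by (auto intro!: derivative_eq_intros bounded_linear_imp_has_derivative blP)
    from bounded_bilinear.FDERIV[OF bounded_bilinear_matrix_mult derF this]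
    show "(\<Phi> has_derivative (\<lambda>H. H)) (at 0)"
      using F0 linear_0[OF bounded_linear.linear[OF blP]] unfolding \<Phi>_def by simp
    show "(\<lambda>H. H) \<circ> (\<lambda>H. H) = id" by (simp add: fun_eq_iff)
  qed (use \<eta> \<epsilon> in \<open>auto simp: interior_open bounded_linear_ident\<close>)
  moreover have "\<Phi> 0 = mat 1" using F0 linear_0[OF bounded_linear.linear[OF blP]] by (simp add: \<Phi>_def)
  ultimately obtain r where r: "r > 0" "ball (mat 1) r \<subseteq> \<Phi> ` ball 0 \<eta>"
    using mem_interior by metis
  show ?thesis
  proof (intro exI[of _ r] conjI ballI impI r(1))
    fix A assume A: "A \<in> G" "dist A (mat 1) < r"
    then obtain Z where Z: "Z \<in> ball 0 \<eta>" "A = \<Phi> Z" using r(2) by (auto simp: dist_commute)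
    then have "Z \<in> ball 0 \<epsilon>" using \<eta> by auto
    note FZ = joinF[OF this]
    then have inv: "invertible (F Z)" "matrix_inv (F Z) \<in> G"
      using G by (auto simp: linear_Lie_group_def GL_def)
    have "mat 1 + (Z - P Z) = matrix_inv (F Z) ** A"
      using matrix_inv_left[OF inv(1)] by (simp add: Z(2) \<Phi>_def matrix_mul_assoc)
    also have "\<dots> \<in> G" using inv(2) A(1) by (rule mult)
    finally have *: "mat 1 + (Z - P Z) \<in> G" .
    have "norm (Z - P Z) \<le> norm Z * K" by (rule K)
    also have "\<dots> < d / K * K" using Z(1) \<eta>(3) K(1) by (intro mult_strict_right_mono) auto
    finally have "norm (Z - P Z) < d" using K(1) by simp
    with d(2)[OF orth _ *] have "Z - P Z = 0" by blast
    then have "A = F Z" by (simp add: Z(2) \<Phi>_def)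
    with FZ show "joinable G A" by simp
  qed
qed

text \<open>Relating x to y when x^(-1) y is joinable gives an equivalence relation on
  \<open>G\<close>. The local result makes its classes open, so connectedness leaves a single
  class.\<close>

lemma connected_linear_Lie_group_joinable:
  fixes G :: "(real^'p^'p) set"
  assumes G: "linear_Lie_group G" and "connected G" "A \<in> G"
  shows "joinable G A"
proof -
  have mult: "\<And>A B. A \<in> G \<Longrightarrow> B \<in> G \<Longrightarrow> A ** B \<in> G" and one: "mat 1 \<in> G"
    and inv: "\<And>A. A \<in> G \<Longrightarrow> matrix_inv A \<in> G" and inve: "\<And>A. A \<in> G \<Longrightarrow> invertible A"
    using G by (auto simp: linear_Lie_group_def GL_def)
  obtain r where r: "r > 0" "\<And>A. A \<in> G \<Longrightarrow> dist A (mat 1) < r \<Longrightarrow> joinable G A"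
    using joinable_near_identity[OF G] by blast
  have "joinable G (matrix_inv (mat 1) ** A)"
  proof (rule connected_equivalence_relation[OF \<open>connected G\<close> one \<open>A \<in> G\<close>,
        where R = "\<lambda>A B. joinable G (matrix_inv A ** B)"])
    fix x y assume xy: "joinable G (matrix_inv x ** y)" "x \<in> G" "y \<in> G"
    have "(matrix_inv x ** y) ** (matrix_inv y ** x) = mat 1"
      by (metis xy(2,3) inve matrix_inv_left matrix_inv_right matrix_mul_assoc matrix_mul_lid)
    then have "matrix_inv (matrix_inv x ** y) = matrix_inv y ** x" by (rule matrix_inv_unique)
    then show "joinable G (matrix_inv y ** x)"
      using joinable_inv[OF mult xy(1)] xy by (metis inv inve mult)
  next
    fix x y z assume xyz: "joinable G (matrix_inv x ** y)" "joinable G (matrix_inv y ** z)"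
      "x \<in> G" "y \<in> G" "z \<in> G"
    have "(matrix_inv x ** y) ** (matrix_inv y ** z) = matrix_inv x ** z"
      by (metis xyz(4) inve matrix_inv_right matrix_mul_assoc matrix_mul_lid)
    with joinable_mult[OF mult xyz(1,2)] show "joinable G (matrix_inv x ** z)" by simp
  next
    fix a assume a: "a \<in> G"
    define T where "T = G \<inter> (\<lambda>x. matrix_inv a ** x) -` ball (mat 1) r"
    have "continuous_on G (\<lambda>x. matrix_inv a ** x)"
      by (intro linear_continuous_on bounded_bilinear.bounded_linear_right[OF bounded_bilinear_matrix_mult])
    then have "openin (top_of_set G) T" unfolding T_def
      by (intro continuous_openin_preimage_gen) auto
    moreover have "a \<in> T" using a r(1) by (simp add: T_def matrix_inv_left inve)
    moreover have "joinable G (matrix_inv a ** x)" if "x \<in> T" for x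
      using that r(2) a mult inv by (auto simp: T_def dist_commute)
    ultimately show "\<exists>T. openin (top_of_set G) T \<and> a \<in> T \<and> (\<forall>x\<in>T. joinable G (matrix_inv a ** x))" by blast
  qed
  then show ?thesis using matrix_inv_unique[of "mat 1 :: real^'p^'p" "mat 1"] by (simp add: matrix_mul_lid)
qed

section \<open>Jacobi matrices and germs\<close>

text \<open>Placing a vector in column \<open>j\<close> is linear, so \<open>matrix F\<close>
  becomes a finite sum of linear images of the vectors F(e_j), and calculus for matrices reduces to
  calculus for vectors.\<close>

definition column_matrix :: "'n \<Rightarrow> real^'m \<Rightarrow> real^'n^'m" where
  "column_matrix j w = (\<chi> i k. if k = j then w $ i else 0)"

lemma bounded_linear_column_matrix: "bounded_linear (column_matrix j :: real^'m \<Rightarrow> real^'n^'m)"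
proof -
  have "linear (column_matrix j :: real^'m \<Rightarrow> real^'n^'m)"
    by (intro linearI) (auto simp: column_matrix_def vec_eq_iff)
  then show ?thesis by (simp add: linear_conv_bounded_linear)
qed

lemma matrix_eq_sum_columns: "matrix F = (\<Sum>j\<in>UNIV. column_matrix j (F (axis j 1)))"
  for F :: "real^'n \<Rightarrow> real^'m"
  by (simp add: vec_eq_iff matrix_def column_matrix_def)

lemma matrix_has_derivative:
  fixes F :: "'a::real_normed_vector \<Rightarrow> real^'n \<Rightarrow> real^'m"
  assumes "\<And>w. ((\<lambda>y. F y w) has_derivative F' w) (at y)"
  shows "((\<lambda>y. matrix (F y)) has_derivative (\<lambda>v. matrix (\<lambda>w. F' w v))) (at y)"
  unfolding matrix_eq_sum_columns
  by (intro has_derivative_sum bounded_linear.has_derivative[OF bounded_linear_column_matrix] assms)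

lemma matrix_has_vector_derivative:
  fixes F :: "real \<Rightarrow> real^'n \<Rightarrow> real^'m"
  assumes "\<And>w. ((\<lambda>t. F t w) has_vector_derivative F' w) (at t)"
  shows "((\<lambda>t. matrix (F t)) has_vector_derivative matrix F') (at t)"
  unfolding matrix_eq_sum_columns
  by (intro has_vector_derivative_sum bounded_linear.has_vector_derivative[OF bounded_linear_column_matrix] assms)

lemma jacobian_eq: "(f has_derivative f') (at x) \<Longrightarrow> jacobian f (at x) = matrix f'"
  unfolding jacobian_def by (simp only: frechet_derivative_at[symmetric])

lemma jacobian_matrix_vector_mult: "jacobian ((*v) A) (at x) = A" for A :: "real^'n^'n"
  by (subst jacobian_eq[OF bounded_linear_imp_has_derivative[OF matrix_vector_mul_bounded_linear]])
    (simp add: matrix_of_matrix_vector_mul)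

lemma germ_of_eq_iff: "germ_of f = germ_of g \<longleftrightarrow> (\<exists>S. open S \<and> 0 \<in> S \<and> (\<forall>x\<in>S. f x = g x))"
  by (simp add: germ.abs_eq_iff eventually_nhds)

lemma germ_of_eqI: "open S \<Longrightarrow> 0 \<in> S \<Longrightarrow> (\<And>x. x \<in> S \<Longrightarrow> f x = g x) \<Longrightarrow> germ_of f = germ_of g"
  by (auto simp: germ_of_eq_iff)

text \<open>Equality of germs is equality on a whole neighbourhood of 0, so the derivatives agree
  there as well.\<close>

lemma germ_of_eq_matrix_germD:
  assumes "germ_of f = matrix_germ A" "open U" "0 \<in> U" "smooth_on U f"
  obtains S where "open S" "0 \<in> S" "S \<subseteq> U" "\<And>y. y \<in> S \<Longrightarrow> f y = A *v y"
    "\<And>y. y \<in> S \<Longrightarrow> frechet_derivative f (at y) = (*v) A" "\<And>y. y \<in> S \<Longrightarrow> jacobian f (at y) = A"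
proof -
  obtain S where S: "open S" "0 \<in> S" "\<And>y. y \<in> S \<Longrightarrow> f y = A *v y"
    using assms(1) by (auto simp: matrix_germ_def germ_of_eq_iff)
  have D: "(f has_derivative (*v) A) (at y)" if "y \<in> S" for y
    by (rule has_derivative_transform_within_open[OF
          bounded_linear_imp_has_derivative[OF matrix_vector_mul_bounded_linear] S(1) that])
      (simp add: S(3))
  show thesis
  proof (rule that[of "S \<inter> U"])
    show "frechet_derivative f (at y) = (*v) A" if "y \<in> S \<inter> U" for y
      using frechet_derivative_at[OF D[of y]] that by simp
    show "jacobian f (at y) = A" if "y \<in> S \<inter> U" for y
      using jacobian_eq[OF D[of y]] that by (simp add: matrix_of_matrix_vector_mul)
  qed (use S assms in auto)
qed

lemma smooth_on_matrix_vector_mult: "smooth_on S ((*v) A)" for A :: "real^'n^'n"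
  by (intro smooth_on_bounded_linear matrix_vector_mul_bounded_linear)

lemma matrix_germ_inject: "matrix_germ A = matrix_germ B \<Longrightarrow> A = B" for A :: "real^'n^'n"
proof -
  assume eq: "matrix_germ A = matrix_germ B"
  have g: "germ_of ((*v) A) = matrix_germ B" using eq by (simp add: matrix_germ_def)
  show "A = B"
    by (rule germ_of_eq_matrix_germD[OF g open_UNIV UNIV_I smooth_on_matrix_vector_mult])
      (metis jacobian_matrix_vector_mult)
qed

lemma matrix_germ_add: "matrix_germ (A + B) = matrix_germ A + matrix_germ B"
  by (simp add: matrix_germ_def plus_germ.abs_eq matrix_vector_mult_add_rdistrib)

lemma matrix_germ_scaleR: "matrix_germ (c *\<^sub>R A) = c *\<^sub>R matrix_germ A"
  by (simp add: matrix_germ_def scaleR_germ.abs_eq scaleR_matrix_vector_assoc)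

text \<open>There are finitely many components, so the neighbourhoods on which they are linear
  contain a common one, and the component maps assemble to a matrix.\<close>

lemma linear_components_iff:
  fixes \<eta> :: "(real^'n, real^'n) germ"
  shows "(\<forall>i. linear_germ (component_germ \<eta> i)) \<longleftrightarrow> (\<exists>A. \<eta> = matrix_germ A)"
proof
  assume l: "\<forall>i. linear_germ (component_germ \<eta> i)"
  obtain f where f: "\<eta> = germ_of f" using Quotient3_abs_rep[OF Quotient3_germ, of \<eta>] by metis
  have "\<forall>i. \<exists>L. linear L \<and> (\<forall>\<^sub>F x in nhds 0. f x $ i = L x)"
    using l by (simp add: f component_germ.abs_eq linear_germ_def germ.abs_eq_iff)
  then obtain L where "\<forall>i. linear (L i) \<and> (\<forall>\<^sub>F x in nhds 0. f x $ i = L i x)"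
    by (rule choice[THEN exE])
  then have L: "\<And>i. linear (L i)" "\<And>i. \<forall>\<^sub>F x in nhds 0. f x $ i = L i x" by auto
  define T where "T x = (\<chi> i. L i x)" for x
  have "linear T"
    using L(1) by (intro linearI) (auto simp: T_def vec_eq_iff linear_add linear_cmul)
  have "\<forall>\<^sub>F x in nhds 0. \<forall>i. f x $ i = L i x" using L(2) by (rule eventually_all_finite)
  then have "\<forall>\<^sub>F x in nhds 0. f x = matrix T *v x"
    by eventually_elim (simp add: fun_cong[OF matrix_vector_mul(2)[OF \<open>linear T\<close>]] T_def vec_eq_iff)
  then show "\<exists>A. \<eta> = matrix_germ A" by (auto simp: f matrix_germ_def germ.abs_eq_iff)
next
  assume "\<exists>A. \<eta> = matrix_germ A"
  then obtain A where A: "\<eta> = matrix_germ A" ..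
  show "\<forall>i. linear_germ (component_germ \<eta> i)"
  proof
    fix i
    have "linear (\<lambda>x. (A *v x) $ i)"
      by (intro linearI) (simp_all add: matrix_vector_right_distrib matrix_vector_mult_scaleR)
    then show "linear_germ (component_germ \<eta> i)"
      unfolding A matrix_germ_def component_germ.abs_eq linear_germ_def by blast
  qed
qed

section \<open>The first prolongation\<close>

definition prolongation_trivial :: "(real^'p^'p) set \<Rightarrow> bool" where
  "prolongation_trivial G \<longleftrightarrow>
     (\<forall>B. bilinear B \<and> (\<forall>v w. B v w = B w v) \<and> (\<forall>v. matrix (B v) \<in> lie_algebra G) \<longrightarrow> B = (\<lambda>v w. 0))"

text \<open>Linearity in the second argument is that of a derivative; the first argument inherits it
  through symmetry.\<close>

lemma second_derivative:
  fixes f :: "'a::euclidean_space \<Rightarrow> 'b::euclidean_space"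
  assumes f: "smooth_on U f" "open U" "y \<in> U"
  defines "D2 \<equiv> \<lambda>v. frechet_derivative (\<lambda>y. frechet_derivative f (at y) v) (at y)"
  shows "((\<lambda>y. frechet_derivative f (at y) v) has_derivative D2 v) (at y)"
    "D2 v w = D2 w v" "bilinear D2"
proof -
  have D: "((\<lambda>y. frechet_derivative f (at y) v) has_derivative D2 v) (at y)" for v
    unfolding D2_def by (rule smooth_on_has_derivative[OF smooth_on_frechet_derivative[OF f(1)] f(3)])
  then show "((\<lambda>y. frechet_derivative f (at y) v) has_derivative D2 v) (at y)" .
  have sym: "D2 v w = D2 w v" for v w
    by (rule symmetric_second_derivative[OF f(2,3) smooth_on_has_derivative[OF f(1)] D D])
  then show "D2 v w = D2 w v" .
  have "linear (D2 v)" for v using D by (rule has_derivative_linear)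
  moreover from this have "linear (\<lambda>v. D2 v w)" for w by (simp only: sym[of _ w])
  ultimately show "bilinear D2" by (simp add: bilinear_def)
qed

text \<open>Differentiating in direction v puts v into the second argument; symmetry moves it to the
  first, the form in which the prolongation condition is stated.\<close>

lemma jacobian_has_derivative:
  fixes f :: "real^'n \<Rightarrow> real^'n"
  assumes f: "smooth_on U f" "open U" "y \<in> U"
  shows "((\<lambda>y. jacobian f (at y)) has_derivative
    (\<lambda>v. matrix (frechet_derivative (\<lambda>y. frechet_derivative f (at y) v) (at y)))) (at y)"
proof -
  have "((\<lambda>y. jacobian f (at y)) has_derivative
    (\<lambda>v. matrix (\<lambda>w. frechet_derivative (\<lambda>y. frechet_derivative f (at y) w) (at y) v))) (at y)"
    unfolding jacobian_def by (rule matrix_has_derivative[OF second_derivative(1)[OF f]])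
  then show ?thesis by (simp only: second_derivative(2)[OF f])
qed

lemma zero_second_derivative_imp_matrix_germ:
  fixes f :: "real^'n \<Rightarrow> real^'n"
  assumes f: "smooth_on U f" "open U" "0 \<in> U" "f 0 = 0"
    and D2: "\<And>y. y \<in> U \<Longrightarrow> (\<lambda>v. frechet_derivative (\<lambda>y. frechet_derivative f (at y) v) (at y)) = (\<lambda>v w. 0)"
  shows "germ_of f = matrix_germ (jacobian f (at 0))"
proof -
  let ?A = "jacobian f (at 0)"
  obtain r where r: "r > 0" "ball 0 r \<subseteq> U" using f openE by blast
  have "((\<lambda>y. jacobian f (at y)) has_derivative (\<lambda>v. 0)) (at y)" if "y \<in> U" for y
  proof -
    have "matrix (\<lambda>w :: real^'n. 0 :: real^'n) = 0" by (simp add: matrix_def vec_eq_iff)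
    then show ?thesis using jacobian_has_derivative[OF f(1,2) that] fun_cong[OF D2[OF that]] by simp
  qed
  then have "\<And>y. y \<in> ball 0 r \<Longrightarrow> ((\<lambda>y. jacobian f (at y)) has_derivative (\<lambda>v. 0)) (at y within ball 0 r)"
    using r(2) by (blast intro: has_derivative_at_withinI)
  from has_derivative_zero_constant[OF convex_ball this]
  obtain A where "\<And>y. y \<in> ball 0 r \<Longrightarrow> jacobian f (at y) = A" by blast
  with r(1) have A: "jacobian f (at y) = ?A" if "y \<in> ball 0 r" for y using that by (metis centre_in_ball)
  have "((\<lambda>y. f y - ?A *v y) has_derivative (\<lambda>v. 0)) (at y within ball 0 r)" if y: "y \<in> ball 0 r" for y
  proof -
    have "f differentiable (at y)"
      using y r(2) by (intro differentiableI[OF smooth_on_has_derivative[OF f(1)]]) auto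
    then have "(f has_derivative (*v) ?A) (at y)" using A[OF y] by (simp add: jacobian_works)
    moreover have "((*v) ?A has_derivative (*v) ?A) (at y)"
      by (intro bounded_linear_imp_has_derivative matrix_vector_mul_bounded_linear)
    ultimately have "((\<lambda>y. f y - ?A *v y) has_derivative (\<lambda>v. ?A *v v - ?A *v v)) (at y)"
      by (rule has_derivative_diff)
    then show ?thesis by (simp add: has_derivative_at_withinI)
  qed
  from has_derivative_zero_constant[OF convex_ball this]
  obtain c where c: "\<And>y. y \<in> ball 0 r \<Longrightarrow> f y - ?A *v y = c" by blast
  with c[of 0] f(4) r(1) have "c = 0" by simp
  with c show ?thesis unfolding matrix_germ_def using r(1) by (intro germ_of_eqI[of "ball 0 r"]) auto
qed

lemma has_derivative_imp_directional:
  assumes J: "(J has_derivative J') (at y)"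
  shows "((\<lambda>s. J (y + s *\<^sub>R v)) has_vector_derivative J' v) (at 0)"
proof -
  have "((\<lambda>s. y + s *\<^sub>R v) has_derivative (\<lambda>s. s *\<^sub>R v)) (at 0)"
    by (auto intro!: derivative_eq_intros)
  from has_derivative_compose[OF this, of J J'] J show ?thesis
    using linear_cmul[OF has_derivative_linear[OF J]] by (simp add: has_vector_derivative_def)
qed

text \<open>Difference quotients along \<open>v\<close> lie in \<open>V\<close>, and subspaces of a
  Euclidean space are closed.\<close>

lemma derivative_in_closed_subspace:
  fixes J :: "'a::real_normed_vector \<Rightarrow> 'b::euclidean_space"
  assumes J: "(J has_derivative J') (at y)" and U: "open U" "y \<in> U" "\<And>z. z \<in> U \<Longrightarrow> J z \<in> V"
    and V: "subspace V"
  shows "J' v \<in> V"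
proof -
  note D = has_derivative_imp_directional[OF J, of v]
  have "J' v \<in> closure V"
    unfolding closure_approachable
  proof (intro allI impI)
    fix e :: real assume e: "e > 0"
    obtain d where d: "d > 0" "\<And>h. \<bar>h\<bar> < d \<Longrightarrow> norm (J (y + h *\<^sub>R v) - J y - h *\<^sub>R J' v) \<le> e / 2 * \<bar>h\<bar>"
      using has_vector_derivative_within_estimate[OF D half_gt_zero[OF e]] by auto
    obtain r where r: "r > 0" "ball y r \<subseteq> U" using U openE by blast
    define N where "N = norm v + 1"
    have N: "N > 0" "norm v \<le> N" by (simp_all add: N_def add_nonneg_pos)
    define h where "h = min (d / 2) (r / (2 * N))"
    have h: "h > 0" "h < d" using d(1) r(1) N by (auto simp: h_def)
    have "h * norm v < r"
    proof -
      have "h * norm v \<le> r / (2 * N) * N"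
        using h N by (intro mult_mono) (auto simp: h_def)
      also have "\<dots> < r" using r(1) N by simp
      finally show ?thesis .
    qed
    then have "y + h *\<^sub>R v \<in> U" using r h by (auto simp: dist_norm)
    then have "(1 / h) *\<^sub>R (J (y + h *\<^sub>R v) - J y) \<in> V"
      using U V by (intro subspace_scale subspace_diff) auto
    moreover have "dist ((1 / h) *\<^sub>R (J (y + h *\<^sub>R v) - J y)) (J' v) < e"
    proof -
      have "(1 / h) *\<^sub>R (J (y + h *\<^sub>R v) - J y) - J' v = (1 / h) *\<^sub>R (J (y + h *\<^sub>R v) - J y - h *\<^sub>R J' v)"
        using h by (simp add: scaleR_diff_right)
      then have "dist ((1 / h) *\<^sub>R (J (y + h *\<^sub>R v) - J y)) (J' v)
          = (1 / h) * norm (J (y + h *\<^sub>R v) - J y - h *\<^sub>R J' v)"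
        using h by (simp add: dist_norm)
      also have "\<dots> \<le> (1 / h) * (e / 2 * h)"
        using d(2)[of h] h by (intro mult_left_mono) auto
      also have "\<dots> < e" using h e by simp
      finally show ?thesis .
    qed
    ultimately show "\<exists>z\<in>V. dist z (J' v) < e" by blast
  qed
  then show ?thesis using closed_subspace[OF V] by (simp add: closure_closed)
qed

section \<open>Vector fields\<close>

lemma matrix_germ_in_theta0_iff:
  fixes G :: "(real^'p^'p) set"
  shows "matrix_germ A \<in> theta0 G \<longleftrightarrow> A \<in> lie_algebra G"
proof
  assume "matrix_germ A \<in> theta0 G"
  then obtain f U where f: "matrix_germ A = germ_of f" "open U" "0 \<in> U" "smooth_on U f"
    "\<And>y. y \<in> U \<Longrightarrow> jacobian f (at y) \<in> lie_algebra G"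
    unfolding theta0_def by blast
  show "A \<in> lie_algebra G"
    by (rule germ_of_eq_matrix_germD[OF f(1)[symmetric] f(2-4)]) (metis f(5) subsetD)
next
  assume "A \<in> lie_algebra G"
  then show "matrix_germ A \<in> theta0 G" unfolding theta0_def mem_Collect_eq matrix_germ_def
    by (intro exI[of _ "(*v) A"] conjI exI[of _ UNIV] refl)
      (auto simp: jacobian_matrix_vector_mult smooth_on_matrix_vector_mult)
qed

lemma prolongation_trivial_imp_linear:
  assumes G: "linear_Lie_group G" and triv: "prolongation_trivial G" and "\<eta> \<in> theta0 G"
  shows "\<exists>A. \<eta> = matrix_germ A"
proof -
  obtain f U where f: "\<eta> = germ_of f" "open U" "0 \<in> U" "smooth_on U f" "f 0 = 0"
    "\<And>y. y \<in> U \<Longrightarrow> jacobian f (at y) \<in> lie_algebra G"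
    using assms(3) unfolding theta0_def by blast
  have "(\<lambda>v. frechet_derivative (\<lambda>y. frechet_derivative f (at y) v) (at y)) = (\<lambda>v w. 0)" if y: "y \<in> U" for y
  proof (rule triv[unfolded prolongation_trivial_def, rule_format], intro conjI allI)
    show "matrix (frechet_derivative (\<lambda>y. frechet_derivative f (at y) v) (at y)) \<in> lie_algebra G" for v
      using derivative_in_closed_subspace[OF jacobian_has_derivative[OF f(4,2) y] f(2) y f(6) subspace_lie_algebra[OF G]] .
  qed (use second_derivative[OF f(4,2) y] in auto)
  from zero_second_derivative_imp_matrix_germ[OF f(4,2,3,5) this] show ?thesis using f(1) by blast
qed

lemma linear_vanishing_near_0:
  fixes g :: "'a::real_normed_vector \<Rightarrow> 'b::real_vector"
  assumes g: "linear g" and S: "open S" "0 \<in> S" "\<And>y. y \<in> S \<Longrightarrow> g y = 0"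
  shows "g v = 0"
proof -
  obtain r where r: "r > 0" "ball 0 r \<subseteq> S" using S openE by blast
  define c where "c = r / (norm v + 1)"
  have "norm v + 1 > 0" by (simp add: add_nonneg_pos)
  with r(1) have "c > 0" "c * norm v < r" by (auto simp: c_def field_simps)
  then have "g (c *\<^sub>R v) = 0" using r by (intro S(3)) auto
  with \<open>c > 0\<close> show ?thesis by (simp add: linear_cmul[OF g])
qed

lemma linear_imp_prolongation_trivial:
  fixes G :: "(real^'p^'p) set"
  assumes lin: "\<And>\<eta>. \<eta> \<in> theta0 G \<Longrightarrow> \<exists>A. \<eta> = matrix_germ A"
  shows "prolongation_trivial G"
  unfolding prolongation_trivial_def
proof (intro allI impI, elim conjE)
  fix B :: "real^'p \<Rightarrow> real^'p \<Rightarrow> real^'p"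
  assume B: "bilinear B" "\<forall>v w. B v w = B w v" "\<forall>v. matrix (B v) \<in> lie_algebra G"
  then have bb: "bounded_bilinear B" by (simp add: bilinear_conv_bounded_bilinear)
  interpret bounded_bilinear B by fact
  \<comment> \<open>By symmetry of \<open>B\<close> the factor 1/2 makes the derivative at
    \<open>y\<close> exactly \<open>B y\<close>.\<close>
  define f where "f y = (1 / 2) *\<^sub>R B y y" for y
  have D: "(f has_derivative B y) (at y)" for y
  proof -
    have "(f has_derivative (\<lambda>v. (1 / 2) *\<^sub>R (B y v + B v y))) (at y)"
      unfolding f_def by (intro has_derivative_scaleR_right FDERIV has_derivative_ident)
    moreover have "(\<lambda>v. (1 / 2) *\<^sub>R (B y v + B v y)) = B y"
      using B(2) by (auto simp: fun_eq_iff simp flip: scaleR_2)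
    ultimately show ?thesis by simp
  qed
  have sm: "smooth_on UNIV f" unfolding f_def
    by (intro smooth_on_compose_bounded_linear[OF bounded_linear_scaleR_right] smooth_on_bilinear[OF bb]
        smooth_on_bounded_linear bounded_linear_ident open_UNIV)
  have "germ_of f \<in> theta0 G" unfolding theta0_def mem_Collect_eq
    using sm B(3) by (intro exI[of _ f] conjI exI[of _ UNIV] refl) (auto simp: jacobian_eq[OF D] f_def zero_left)
  then obtain A where A: "germ_of f = matrix_germ A" using lin by blast
  obtain S where S: "open S" "0 \<in> S" "\<And>y. y \<in> S \<Longrightarrow> frechet_derivative f (at y) = (*v) A"
    using germ_of_eq_matrix_germD[OF A open_UNIV UNIV_I sm] by metis
  \<comment> \<open>All \<open>B y\<close> near the origin have the same matrix \<open>A\<close>,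
    and \<open>B 0 = 0\<close> makes it zero.\<close>
  have BA: "B y = (*v) A" if "y \<in> S" for y using S(3)[OF that] frechet_derivative_at[OF D[of y]] by simp
  have "(*v) A = (\<lambda>v. 0)" using BA[OF S(2)] by (simp add: fun_eq_iff zero_left)
  then have "B y w = 0" if "y \<in> S" for y w using BA[OF that] by simp
  then have "B v w = 0" for v w
    using linear_vanishing_near_0[OF _ S(1,2), of "\<lambda>v. B v w"] B(1) by (simp add: bilinear_def)
  then show "B = (\<lambda>v w. 0)" by (simp add: fun_eq_iff)
qed

text \<open>\<open>h\<close> is linear on \<open>V\<close> alone. Extension from a basis gives an
  ambient linear map that agrees with \<open>h\<close> on \<open>V\<close>, after which dimensions
  can be compared.\<close>

lemma injective_endomorphism_surj:
  fixes V :: "'a::euclidean_space set"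
  assumes V: "subspace V" "h ` V \<subseteq> V" "inj_on h V"
    and add: "\<And>x y. x \<in> V \<Longrightarrow> y \<in> V \<Longrightarrow> h (x + y) = h x + h y"
    and scale: "\<And>c x. x \<in> V \<Longrightarrow> h (c *\<^sub>R x) = c *\<^sub>R h x"
  shows "h ` V = V"
proof -
  obtain B where B: "B \<subseteq> V" "independent B" "span B = V"
    using orthogonal_basis_subspace[OF V(1)] by metis
  obtain L where L: "linear L" "\<And>x. x \<in> B \<Longrightarrow> L x = h x"
    using linear_independent_extend[OF B(2), of h] by blast
  have "h 0 = 0" using scale[of 0 0] subspace_0[OF V(1)] by simp
  then have "subspace {x \<in> V. L x = h x}"
    using V(1) add scale unfolding subspace_def
    by (auto simp: linear_0[OF L(1)] linear_add[OF L(1)] linear_cmul[OF L(1)])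
  then have "span B \<subseteq> {x \<in> V. L x = h x}"
    using B(1) L(2) by (intro span_minimal) auto
  then have eq: "L x = h x" if "x \<in> V" for x using that B(3) by auto
  then have im: "L ` V = h ` V" by auto
  have "inj_on L (span V)" using V(3) eq by (simp add: inj_on_def span_eq_iff[THEN iffD2, OF V(1)])
  then have "dim (L ` V) = dim V" using L(1) by (rule dim_image_eq[rotated])
  moreover have "subspace (L ` V)" using L(1) V(1) by (rule linear_subspace_image)
  ultimately show ?thesis using subspace_dim_equal[of "L ` V" V] V im by simp
qed

lemma lin_isomorphic_iff_linear:
  fixes G :: "(real^'p^'p) set"
  assumes G: "linear_Lie_group G"
  shows "lin_isomorphic (lie_algebra G) (theta0 G) \<longleftrightarrow> (\<forall>\<eta>\<in>theta0 G. \<exists>A. \<eta> = matrix_germ A)"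
proof
  let ?V = "lie_algebra G"
  note V = subspace_lie_algebra[OF G]
  assume "lin_isomorphic ?V (theta0 G)"
  then obtain f where f: "bij_betw f ?V (theta0 G)"
    "\<And>x y. x \<in> ?V \<Longrightarrow> y \<in> ?V \<Longrightarrow> f (x + y) = f x + f y"
    "\<And>c x. x \<in> ?V \<Longrightarrow> f (c *\<^sub>R x) = c *\<^sub>R f x"
    unfolding lin_isomorphic_def by blast
  \<comment> \<open>The given isomorphism need not send X to the field X y. Once \<open>h\<close> is
    onto, every f(Y) is f(h X) = \<open>matrix_germ X\<close> for some X.\<close>
  define h where "h X = inv_into ?V f (matrix_germ X)" for X
  have h: "h X \<in> ?V" "f (h X) = matrix_germ X" if "X \<in> ?V" for X
  proof -
    have "matrix_germ X \<in> f ` ?V"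
      using that matrix_germ_in_theta0_iff[of X G] f(1) by (simp add: bij_betw_def)
    then show "h X \<in> ?V" "f (h X) = matrix_germ X"
      unfolding h_def by (rule inv_into_into, rule f_inv_into_f)
  qed
  have inj: "x = y" if "f x = f y" "x \<in> ?V" "y \<in> ?V" for x y
    using f(1) that by (auto simp: bij_betw_def inj_on_def)
  have "h ` ?V = ?V"
  proof (rule injective_endomorphism_surj[OF V])
    show "h ` ?V \<subseteq> ?V" using h by blast
    show "inj_on h ?V" using h(2) matrix_germ_inject by (metis inj_onI)
    show "h (x + y) = h x + h y" if "x \<in> ?V" "y \<in> ?V" for x y
      using that h f(2) V by (intro inj) (auto simp: matrix_germ_add subspace_add)
    show "h (c *\<^sub>R x) = c *\<^sub>R h x" if "x \<in> ?V" for c x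
      using that h f(3) V by (intro inj) (auto simp: matrix_germ_scaleR subspace_scale)
  qed
  show "\<forall>\<eta>\<in>theta0 G. \<exists>A. \<eta> = matrix_germ A"
  proof
    fix \<eta> assume "\<eta> \<in> theta0 G"
    then obtain Y where "Y \<in> ?V" "\<eta> = f Y" using f(1) by (auto simp: bij_betw_def)
    then obtain X where "X \<in> ?V" "Y = h X" using \<open>h ` ?V = ?V\<close> by blast
    then show "\<exists>A. \<eta> = matrix_germ A" using h(2) \<open>\<eta> = f Y\<close> by auto
  qed
next
  assume lin: "\<forall>\<eta>\<in>theta0 G. \<exists>A. \<eta> = matrix_germ A"
  have "bij_betw matrix_germ (lie_algebra G) (theta0 G)"
  proof (rule bij_betwI')
    show "(matrix_germ X = matrix_germ Y) = (X = Y)" for X Y :: "real^'p^'p"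
      using matrix_germ_inject by blast
    show "matrix_germ X \<in> theta0 G" if "X \<in> lie_algebra G" for X
      using that by (simp add: matrix_germ_in_theta0_iff)
    show "\<exists>X\<in>lie_algebra G. \<eta> = matrix_germ X" if "\<eta> \<in> theta0 G" for \<eta>
      using lin that by (metis matrix_germ_in_theta0_iff)
  qed
  then show "lin_isomorphic (lie_algebra G) (theta0 G)"
    unfolding lin_isomorphic_def by (intro exI[of _ matrix_germ]) (simp add: matrix_germ_add matrix_germ_scaleR)
qed

section \<open>Diffeomorphisms\<close>

lemma invertible_linear_Lie_group: "linear_Lie_group G \<Longrightarrow> A \<in> G \<Longrightarrow> invertible A"
  by (auto simp: linear_Lie_group_def GL_def)

text \<open>Translation by the inverse of the Jacobi matrix at \<open>y\<close> makes the curve of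
  Jacobi matrices along \<open>v\<close> start at 1, so its velocity is tangent to \<open>G\<close>
  there. Invertibility transfers the vanishing back to the second derivative.\<close>

lemma prolongation_trivial_imp_Diff_linear:
  fixes G :: "(real^'p^'p) set"
  assumes G: "linear_Lie_group G" and triv: "prolongation_trivial G" and "\<psi> \<in> Diff G"
  shows "\<psi> \<in> matrix_germ ` G"
proof -
  obtain f U where f: "\<psi> = germ_of f" "open U" "0 \<in> U" "smooth_on U f" "f 0 = 0"
    "\<And>y. y \<in> U \<Longrightarrow> jacobian f (at y) \<in> G"
    using assms(3) unfolding Diff_def by blast
  let ?D2 = "\<lambda>y v. frechet_derivative (\<lambda>y. frechet_derivative f (at y) v) (at y)"
  have "?D2 y = (\<lambda>v w. 0)" if y: "y \<in> U" for y
  proof -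
    let ?N = "jacobian f (at y)"
    note inv = invertible_linear_Lie_group[OF G f(6)[OF y]]
    have lin: "linear (?D2 y v)" "linear (\<lambda>v. ?D2 y v w)" for v w
      using second_derivative(3)[OF f(4,2) y] by (auto simp: bilinear_def)
    let ?B = "\<lambda>v w. matrix_inv ?N *v ?D2 y v w"
    have "?B = (\<lambda>v w. 0)"
    proof (rule triv[unfolded prolongation_trivial_def, rule_format], intro conjI allI)
      show "bilinear ?B" unfolding bilinear_def
        by (intro conjI allI linear_compose[OF lin(1) matrix_vector_mul_linear, unfolded o_def]
            linear_compose[OF lin(2) matrix_vector_mul_linear, unfolded o_def])
      show "?B v w = ?B w v" for v w using second_derivative(2)[OF f(4,2) y] by simp
      show "matrix (?B v) \<in> lie_algebra G" for v
      proof -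
        have eq: "matrix (?B v) = matrix_inv ?N ** matrix (?D2 y v)"
          using matrix_compose[OF lin(1)[of v] matrix_vector_mul_linear[of "matrix_inv ?N"]]
          by (simp add: o_def matrix_of_matrix_vector_mul)
        from bounded_linear.has_vector_derivative[OF
            bounded_bilinear.bounded_linear_right[OF bounded_bilinear_matrix_mult]
            has_derivative_imp_directional[OF jacobian_has_derivative[OF f(4,2) y], of v], of "matrix_inv ?N"]
        have D: "((\<lambda>s. matrix_inv ?N ** jacobian f (at (y + s *\<^sub>R v))) has_vector_derivative
            matrix_inv ?N ** matrix (?D2 y v)) (at 0)" .
        have "\<forall>\<^sub>F s in at_right 0. y + s *\<^sub>R v \<in> U"
        proof (rule topological_tendstoD[OF _ f(2) y])
          show "((\<lambda>s. y + s *\<^sub>R v) \<longlongrightarrow> y) (at_right 0)" by (auto intro!: tendsto_eq_intros)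
        qed
        then have "\<forall>\<^sub>F s in at_right 0. matrix_inv ?N ** jacobian f (at (y + s *\<^sub>R v)) \<in> G"
          by eventually_elim (use G f(6) y in \<open>auto simp: linear_Lie_group_def\<close>)
        then have "matrix_inv ?N ** matrix (?D2 y v) \<in> tangent_cone G"
          by (intro tangent_coneI[OF D]) (simp_all add: matrix_inv_left[OF inv])
        then show ?thesis unfolding eq tangent_cone_eq_lie_algebra[OF G] .
      qed
    qed
    then have "matrix_inv ?N *v ?D2 y v w = 0" for v w by (metis (mono_tags))
    then have "?N *v (matrix_inv ?N *v ?D2 y v w) = 0" for v w by simp
    then show ?thesis by (simp add: matrix_vector_mul_assoc matrix_inv_right[OF inv] fun_eq_iff)
  qed
  from zero_second_derivative_imp_matrix_germ[OF f(4,2,3,5) this] show ?thesis using f(1,3,6) by blast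
qed

lemma matrix_germ_in_Diff:
  fixes G :: "(real^'p^'p) set"
  assumes G: "linear_Lie_group G" "A \<in> G"
  shows "matrix_germ A \<in> Diff G"
proof -
  note inv = invertible_linear_Lie_group[OF G]
  have "homeomorphism UNIV UNIV ((*v) A) ((*v) (matrix_inv A))"
    by (intro homeomorphismI linear_continuous_on matrix_vector_mul_bounded_linear)
      (auto simp: matrix_vector_mul_assoc matrix_inv_left[OF inv] matrix_inv_right[OF inv])
  then show ?thesis unfolding Diff_def mem_Collect_eq matrix_germ_def using G(2)
    by (intro exI[of _ "(*v) A"] conjI exI[of _ UNIV] exI[of _ "(*v) (matrix_inv A)"] refl)
      (auto simp: jacobian_matrix_vector_mult smooth_on_matrix_vector_mult)
qed

lemma matrix_germ_in_Diff0:
  fixes G :: "(real^'p^'p) set"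
  assumes G: "linear_Lie_group G" "connected G" "A \<in> G"
  shows "matrix_germ A \<in> Diff0 G"
proof -
  obtain c W where c: "open W" "{0..1} \<subseteq> W" "smooth_on W c" "c ` {0..1} \<subseteq> G" "c (0::real) = mat 1" "c 1 = A"
    using connected_linear_Lie_group_joinable[OF G] unfolding joinable_def by blast
  define \<Psi> where "\<Psi> z = c (snd z) *v fst z" for z
  have "smooth_on (UNIV \<times> W) (\<lambda>z :: (real^'p) \<times> real. c (0 + snd z))"
    using c by (intro smooth_on_compose_affine[of W] open_Times) (auto intro: bounded_linear_snd)
  then have "smooth_on (UNIV \<times> W) (\<lambda>z :: (real^'p) \<times> real. c (snd z))" by simp
  from smooth_on_bilinear[OF bounded_bilinear_matrix_vector_mult _ this smooth_on_bounded_linear[OF bounded_linear_fst]]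
  have "smooth_on (UNIV \<times> W) \<Psi>" unfolding \<Psi>_def using c(1) by (simp add: open_Times)
  moreover have "germ_of (\<lambda>y. \<Psi> (y, t)) = matrix_germ (c t)" for t
    by (simp add: \<Psi>_def matrix_germ_def)
  moreover have "matrix_germ (mat 1 :: real^'p^'p) = germ_of (\<lambda>y. y)" by (simp add: matrix_germ_def)
  ultimately have "isotopic_to_id G (matrix_germ A)"
    unfolding isotopic_to_id_def using c matrix_germ_in_Diff[OF G(1)]
    by (intro exI[of _ \<Psi>] exI[of _ "UNIV \<times> W"]) (auto simp: \<Psi>_def open_Times)
  then show ?thesis using matrix_germ_in_Diff[OF G(1,3)] by (simp add: Diff0_def)
qed

section \<open>Isotopies from the first prolongation\<close>

context quadratic_field
begin

text \<open>The flow run backwards from the end point and the original trajectory traversed in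
  reverse solve the same equation from the same start. They agree at
  \<open>u = \<bar>t\<bar>\<close>, where the latter is back at \<open>y\<close>.\<close>

lemma flow_backwards:
  assumes y: "y \<in> ball 0 1" "flow Q (y, t) \<in> ball 0 1" and t: "\<bar>t\<bar> \<le> 1"
  shows "flow Q (flow Q (y, t), - t) = y"
proof -
  define x where "x = flow Q (y, t)"
  \<comment> \<open>The sign lets both directions of time be treated with u running over
    [0, |t|].\<close>
  define \<sigma> where "\<sigma> = sgn t"
  have \<sigma>: "\<bar>\<sigma>\<bar> \<le> 1" "\<sigma> * \<bar>t\<bar> = t" by (simp_all add: \<sigma>_def abs_sgn_eq sgn_mult_abs)
  define a where "a u = flow Q (x, - \<sigma> * u)" for u
  define b where "b u = flow Q (y, t - \<sigma> * u)" for u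
  have dom: "(z, s) \<in> ball 0 2" if "z \<in> ball 0 1" "\<bar>s\<bar> \<le> 1" for z :: 'a and s :: real
    using norm_Pair_le[of z s] that by simp
  have s1: "\<bar>- \<sigma> * u\<bar> \<le> 1" if "u \<in> {0..\<bar>t\<bar>}" for u
    using mult_mono[of "\<bar>\<sigma>\<bar>" 1 u 1] \<sigma>(1) t that by (simp add: abs_mult)
  have s2: "\<bar>t - \<sigma> * u\<bar> \<le> 1" if "u \<in> {0..\<bar>t\<bar>}" for u
  proof -
    have "t - \<sigma> * u = \<sigma> * (\<bar>t\<bar> - u)" using \<sigma>(2) by (simp add: right_diff_distrib)
    then show ?thesis
      using mult_mono[of "\<bar>\<sigma>\<bar>" 1 "\<bar>t\<bar> - u" 1] \<sigma>(1) t that by (simp add: abs_mult)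
  qed
  have a: "(a has_vector_derivative - \<sigma> *\<^sub>R Q (a u) (a u)) (at u within {0..\<bar>t\<bar>})" if "u \<in> {0..\<bar>t\<bar>}" for u
  proof -
    have "((\<lambda>u. - \<sigma> * u) has_vector_derivative - \<sigma>) (at u)" by (auto intro!: derivative_eq_intros)
    from vector_diff_chain_at[OF this flow_has_vector_derivative[OF dom[OF _ s1[OF that]], of x]] y(2)
    show ?thesis unfolding a_def by (auto simp: o_def x_def intro: has_vector_derivative_at_within)
  qed
  have b: "(b has_vector_derivative - \<sigma> *\<^sub>R Q (b u) (b u)) (at u within {0..\<bar>t\<bar>})" if "u \<in> {0..\<bar>t\<bar>}" for u
  proof -
    have "((\<lambda>u. t - \<sigma> * u) has_vector_derivative - \<sigma>) (at u)" by (auto intro!: derivative_eq_intros)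
    from vector_diff_chain_at[OF this flow_has_vector_derivative[OF dom[OF y(1) s2[OF that]]]]
    show ?thesis unfolding b_def by (auto simp: o_def intro: has_vector_derivative_at_within)
  qed
  have "continuous_on {0..\<bar>t\<bar>} a" by (rule continuous_on_vector_derivative) (rule a)
  moreover have "continuous_on {0..\<bar>t\<bar>} b" by (rule continuous_on_vector_derivative) (rule b)
  ultimately have "bounded (a ` {0..\<bar>t\<bar>})" "bounded (b ` {0..\<bar>t\<bar>})"
    by (simp_all add: compact_imp_bounded compact_continuous_image)
  then obtain K1 K2 where K: "\<And>u. u \<in> {0..\<bar>t\<bar>} \<Longrightarrow> norm (a u) \<le> K1" "\<And>u. u \<in> {0..\<bar>t\<bar>} \<Longrightarrow> norm (b u) \<le> K2"
    unfolding bounded_iff by (metis imageI)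
  have K0: "0 \<le> K1" "0 \<le> K2" 
    using order_trans[OF norm_ge_zero K(1)[of 0]] order_trans[OF norm_ge_zero K(2)[of 0]] by simp_all
  have "a \<bar>t\<bar> - b \<bar>t\<bar> = 0"
  proof (rule ODE_zero_unique[where f = "\<lambda>u. a u - b u" and T = "\<bar>t\<bar>" and K = "C * (K1 + K2)"
        and f' = "\<lambda>u. - \<sigma> *\<^sub>R Q (a u) (a u) - - \<sigma> *\<^sub>R Q (b u) (b u)"])
    fix u assume u: "u \<in> {0..\<bar>t\<bar>}"
    show "((\<lambda>u. a u - b u) has_vector_derivative - \<sigma> *\<^sub>R Q (a u) (a u) - - \<sigma> *\<^sub>R Q (b u) (b u))
        (at u within {0..\<bar>t\<bar>})"
      using a[OF u] b[OF u] by (rule has_vector_derivative_diff)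
    \<comment> \<open>Splitting the quadratic difference as Q(d, a) + Q(b, d) gives a bound linear
      in d, as both curves are bounded.\<close>
    let ?d = "a u - b u"
    have "- \<sigma> *\<^sub>R Q (a u) (a u) - - \<sigma> *\<^sub>R Q (b u) (b u) = - \<sigma> *\<^sub>R (Q ?d (a u) + Q (b u) ?d)"
      by (simp add: diff_left diff_right scaleR_diff_right)
    then have "norm (- \<sigma> *\<^sub>R Q (a u) (a u) - - \<sigma> *\<^sub>R Q (b u) (b u)) = \<bar>\<sigma>\<bar> * norm (Q ?d (a u) + Q (b u) ?d)"
      by (simp only: norm_scaleR abs_minus_cancel)
    also have "\<dots> \<le> 1 * (C * norm ?d * norm (a u) + C * norm (b u) * norm ?d)"
      using \<sigma>(1) by (intro mult_mono norm_triangle_le add_mono bound) auto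
    also have "\<dots> \<le> C * norm ?d * K1 + C * K2 * norm ?d"
      using K u C by (simp add: add_mono mult_left_mono mult_right_mono)
    also have "\<dots> = C * (K1 + K2) * norm ?d" by (simp add: algebra_simps)
    finally show "norm (- \<sigma> *\<^sub>R Q (a u) (a u) - - \<sigma> *\<^sub>R Q (b u) (b u)) \<le> C * (K1 + K2) * norm ?d" .
  qed (use K0 C in \<open>auto simp: a_def b_def x_def\<close>)
  then show ?thesis using \<sigma>(2) by (simp add: a_def b_def x_def)
qed

end

text \<open>The field is Q(y, y) without the factor 1/2, so its derivative at \<open>y\<close> is 2
  Q(y, .), still with matrix in the Lie algebra.\<close>

locale prolongation_field = quadratic_field Q C
  for Q :: "real^'p \<Rightarrow> real^'p \<Rightarrow> real^'p" and C :: real +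
  fixes G :: "(real^'p^'p) set"
  assumes G: "linear_Lie_group G" and sym: "Q x y = Q y x" and lie: "matrix (Q x) \<in> lie_algebra G"
begin

lemma flow_domain: "y \<in> ball 0 1 \<Longrightarrow> \<bar>t\<bar> \<le> 1 \<Longrightarrow> (y, t) \<in> ball (0 :: (real^'p) \<times> real) 2"
  using norm_Pair_le[of y t] by simp

lemma time_map_has_derivative:
  assumes "y \<in> ball 0 1" "\<bar>t\<bar> \<le> 1"
  shows "((\<lambda>y. flow Q (y, t)) has_derivative (\<lambda>w. frechet_derivative (flow Q) (at (y, t)) (w, 0))) (at y)"
proof -
  have "((\<lambda>y. (y, t)) has_derivative (\<lambda>w. (w, 0))) (at y)"
    by (auto intro!: derivative_eq_intros)
  from has_derivative_compose[OF this smooth_on_has_derivative[OF smooth_on_flow flow_domain[OF assms]]]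
  show ?thesis .
qed

lemma smooth_on_time_map:
  assumes "\<bar>t\<bar> \<le> 1"
  shows "smooth_on (ball 0 1) (\<lambda>y. flow Q (y, t))"
proof -
  have "smooth_on (ball 0 1) (\<lambda>y. flow Q ((0, t) + (y, 0)))"
    by (rule smooth_on_compose_affine[OF smooth_on_flow])
      (use flow_domain assms in \<open>auto intro: bounded_linear_Pair bounded_linear_zero bounded_linear_ident simp del: mem_ball\<close>)
  then show ?thesis by simp
qed

text \<open>The variational equation: the flow equation is differentiated in space, and symmetry of
  the second derivative interchanges space and time.\<close>

lemma spatial_derivative_ODE:
  assumes "y \<in> ball 0 1" "\<bar>t\<bar> \<le> 1"
  shows "((\<lambda>t. frechet_derivative (flow Q) (at (y, t)) (w, 0)) has_vector_derivative
     2 *\<^sub>R Q (flow Q (y, t)) (frechet_derivative (flow Q) (at (y, t)) (w, 0))) (at t)"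
proof -
  note yt = flow_domain[OF assms]
  let ?D = "\<lambda>v z. frechet_derivative (flow Q) (at z) v"
  let ?D2 = "\<lambda>v. frechet_derivative (?D v) (at (y, t))"
  note D2 = second_derivative[OF smooth_on_flow open_ball yt]
  have F: "(flow Q has_derivative frechet_derivative (flow Q) (at (y, t))) (at (y, t))"
    by (rule smooth_on_has_derivative[OF smooth_on_flow yt])
  have "((\<lambda>z. Q (flow Q z) (flow Q z)) has_derivative
      (\<lambda>v. Q (flow Q (y, t)) (?D v (y, t)) + Q (?D v (y, t)) (flow Q (y, t)))) (at (y, t))"
    by (rule FDERIV[OF F F])
  then have "(?D (0, 1) has_derivative
      (\<lambda>v. Q (flow Q (y, t)) (?D v (y, t)) + Q (?D v (y, t)) (flow Q (y, t)))) (at (y, t))"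
    by (rule has_derivative_transform_within_open[OF _ open_ball yt])
      (use flow_time_derivative in \<open>auto simp del: mem_ball\<close>)
  from has_derivative_unique[OF this D2(1)]
  have "?D2 (0, 1) (w, 0) = 2 *\<^sub>R Q (flow Q (y, t)) (?D (w, 0) (y, t))"
    by (simp add: fun_eq_iff scaleR_2 sym)
  then have eq: "?D2 (w, 0) (0, 1) = 2 *\<^sub>R Q (flow Q (y, t)) (?D (w, 0) (y, t))"
    using D2(2) by simp
  have "((\<lambda>s. (y, s)) has_derivative (\<lambda>s. (0, s))) (at t)"
    by (auto intro!: derivative_eq_intros)
  from has_derivative_compose[OF this D2(1)[of "(w, 0)"]]
  have "((\<lambda>s. ?D (w, 0) (y, s)) has_derivative (\<lambda>s. ?D2 (w, 0) (0, s))) (at t)" .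
  moreover have "?D2 (w, 0) (0, s) = s *\<^sub>R 2 *\<^sub>R Q (flow Q (y, t)) (?D (w, 0) (y, t))" for s
    using linear_cmul[OF has_derivative_linear[OF D2(1)[of "(w, 0)"]], of s "(0, 1)"] by (simp add: eq)
  ultimately show ?thesis by (simp add: has_vector_derivative_def)
qed

text \<open>Along a trajectory the Jacobi matrices start at 1 and solve M' = X(s) M, where X(s) is
  the Jacobi matrix of the field at the point reached. Only the inverse flow will add the
  invertibility that puts them in \<open>G\<close>.\<close>

lemma jacobian_in_closure:
  assumes y: "y \<in> ball 0 1" and t: "t \<in> {0..1}"
  shows "jacobian (\<lambda>y. flow Q (y, t)) (at y) \<in> closure G"
proof -
  define X where "X s = 2 *\<^sub>R matrix (Q (flow Q (y, s)))" for s
  define F where "F s w = frechet_derivative (flow Q) (at (y, s)) (w, 0)" for s w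
  have "matrix (F t) \<in> closure G"
  proof -
    have cont: "continuous_on {0..t} X"
    proof -
      have "continuous_on {0..t} (\<lambda>s. flow Q (y, s))"
        by (rule continuous_on_vector_derivative, rule has_vector_derivative_at_within,
            rule flow_has_vector_derivative[OF flow_domain[OF y]]) (use t in auto)
      then show ?thesis unfolding X_def matrix_eq_sum_columns
        by (intro continuous_intros bounded_linear.continuous_on[OF bounded_linear_column_matrix]
            bounded_linear.continuous_on[OF bounded_linear_left])
    qed
    then have "bounded (X ` {0..t})"
      by (intro compact_imp_bounded compact_continuous_image compact_Icc)
    then obtain L where L: "\<And>s. s \<in> {0..t} \<Longrightarrow> norm (X s) \<le> L" unfolding bounded_iff by (metis imageI)
    show ?thesis
    proof (rule tangent_field_solution_in_closure[where M = "\<lambda>s. matrix (F s)" and X = X and T = t])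
      show "A ** B \<in> G" if "A \<in> G" "B \<in> G" for A B using G that by (simp add: linear_Lie_group_def)
      fix s assume s: "s \<in> {0..t}"
      then have s1: "\<bar>s\<bar> \<le> 1" using t by auto
      show "X s \<in> tangent_cone G"
        unfolding X_def tangent_cone_eq_lie_algebra[OF G] by (rule lie_algebra_scaleR[OF lie])
      show "norm (X s) \<le> L" using L s .
      have "((\<lambda>s. matrix (F s)) has_vector_derivative matrix (\<lambda>w. 2 *\<^sub>R Q (flow Q (y, s)) (F s w))) (at s)"
        unfolding F_def by (intro matrix_has_vector_derivative spatial_derivative_ODE y s1)
      moreover have "matrix (\<lambda>w. 2 *\<^sub>R Q (flow Q (y, s)) (F s w)) = X s ** matrix (F s)"
      proof -
        have lin: "linear (F s)" unfolding F_def
          by (rule has_derivative_linear[OF time_map_has_derivative[OF y s1]])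
        have lin2: "linear (\<lambda>w. 2 *\<^sub>R Q (flow Q (y, s)) w)"
          by (intro linear_compose_scale_right bounded_linear.linear bounded_linear_right)
        have "matrix (\<lambda>w. 2 *\<^sub>R Q (flow Q (y, s)) (F s w)) = matrix (\<lambda>w. 2 *\<^sub>R Q (flow Q (y, s)) w) ** matrix (F s)"
          using matrix_compose[OF lin lin2] by (simp add: o_def)
        moreover have "matrix (\<lambda>w. 2 *\<^sub>R Q (flow Q (y, s)) w) = X s"
          by (simp add: X_def matrix_def vec_eq_iff)
        ultimately show ?thesis by simp
      qed
      ultimately show "((\<lambda>s. matrix (F s)) has_vector_derivative X s ** matrix (F s)) (at s within {0..t})"
        by (simp add: has_vector_derivative_at_within)
    next
      have "((\<lambda>y. flow Q (y, 0)) has_derivative F 0) (at y)"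
        unfolding F_def by (rule time_map_has_derivative[OF y]) simp
      then have "((\<lambda>y. y) has_derivative F 0) (at y)" by simp
      then have "F 0 = (\<lambda>w. w)" using has_derivative_unique has_derivative_ident by blast
      then have "matrix (F 0) = mat 1" by (simp add: matrix_id_mat_1[unfolded id_def])
      then show "matrix (F 0) \<in> G" using G by (simp add: linear_Lie_group_def)
    qed (use t in auto)
  qed
  moreover have "\<bar>t\<bar> \<le> 1" using t by auto
  ultimately show ?thesis using jacobian_eq[OF time_map_has_derivative[OF y]] by (simp add: F_def[abs_def])
qed

lemma time_map_in_Diff:
  assumes t: "t \<in> {0..1}"
  shows "germ_of (\<lambda>y. flow Q (y, t)) \<in> Diff G"
proof -
  define f where "f s y = flow Q (y, s)" for s y
  \<comment> \<open>Requiring both the point and its image to lie in the unit ball is a symmetric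
    condition: for |s| \<le> 1 the time maps of \<open>s\<close> and \<open>- s\<close> exchange
    \<open>W s\<close> and \<open>W (- s)\<close>.\<close>
  define W where "W s = ball 0 1 \<inter> f s -` ball 0 1" for s
  have t1: "\<bar>t\<bar> \<le> 1" "\<bar>- t\<bar> \<le> 1" using t by auto
  have sm: "smooth_on (ball 0 1) (f s)" if "\<bar>s\<bar> \<le> 1" for s
    unfolding f_def using that by (rule smooth_on_time_map)
  have opn: "open (W s)" if "\<bar>s\<bar> \<le> 1" for s
    unfolding W_def by (intro continuous_open_preimage smooth_on_imp_continuous_on[OF sm[OF that]] open_ball)
  have inv: "f (- s) (f s y) = y" if "y \<in> W s" "\<bar>s\<bar> \<le> 1" for s y
    using that flow_backwards[of y s] by (auto simp: W_def f_def)
  have im: "f s y \<in> W (- s)" if "y \<in> W s" "\<bar>s\<bar> \<le> 1" for s y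
    using that inv[OF that] by (auto simp: W_def)
  have hom: "homeomorphism (W t) (W (- t)) (f t) (f (- t))"
  proof (rule homeomorphismI)
    have "continuous_on (W s) (f s)" if "\<bar>s\<bar> \<le> 1" for s
      using smooth_on_imp_continuous_on[OF sm[OF that]] by (rule continuous_on_subset) (auto simp: W_def)
    from this[OF t1(1)] this[OF t1(2)]
    show "continuous_on (W t) (f t)" "continuous_on (W (- t)) (f (- t))" .
    show "f t ` W t \<subseteq> W (- t)" "f (- t) ` W (- t) \<subseteq> W t"
      using im[OF _ t1(1)] im[OF _ t1(2)] by auto
    show "f (- t) (f t y) = y" if "y \<in> W t" for y using inv[OF that t1(1)] .
    show "f t (f (- t) y) = y" if "y \<in> W (- t)" for y using inv[OF that t1(2)] by simp
  qed
  have jac: "jacobian (f t) (at y) \<in> G" if y: "y \<in> W t" for y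
  proof (rule closure_in_linear_Lie_group[OF G])
    have yb: "y \<in> ball 0 1" "f t y \<in> ball 0 1" using y by (auto simp: W_def)
    show "jacobian (f t) (at y) \<in> closure G"
      using jacobian_in_closure[OF yb(1) t] by (simp add: f_def[abs_def])
    have 1: "(f t has_derivative (*v) (jacobian (f t) (at y))) (at y)"
      using differentiableI[OF smooth_on_has_derivative[OF sm[OF t1(1)] yb(1)]] by (simp add: jacobian_works)
    have 2: "(f (- t) has_derivative (*v) (jacobian (f (- t)) (at (f t y)))) (at (f t y))"
      using differentiableI[OF smooth_on_has_derivative[OF sm[OF t1(2)] yb(2)]] by (simp add: jacobian_works)
    \<comment> \<open>The chain rule for the inverse time map produces a left inverse of the Jacobi
      matrix.\<close>
    have "((\<lambda>y. f (- t) (f t y)) has_derivative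
        (\<lambda>w. jacobian (f (- t)) (at (f t y)) *v (jacobian (f t) (at y) *v w))) (at y)"
      by (rule has_derivative_compose[OF 1 2])
    moreover have "((\<lambda>y. f (- t) (f t y)) has_derivative (\<lambda>w. w)) (at y)"
      by (rule has_derivative_transform_within_open[OF has_derivative_ident opn[OF t1(1)] y])
        (simp add: inv[OF _ t1(1)])
    ultimately have "(\<lambda>w. jacobian (f (- t)) (at (f t y)) *v (jacobian (f t) (at y) *v w)) = (\<lambda>w. w)"
      by (rule has_derivative_unique)
    then have "jacobian (f (- t)) (at (f t y)) ** jacobian (f t) (at y) = mat 1"
      by (simp add: matrix_eq matrix_vector_mul_assoc fun_eq_iff)
    then show "invertible (jacobian (f t) (at y))" unfolding invertible_left_inverse by blast
  qed
  have sub: "W s \<subseteq> ball 0 1" for s by (auto simp: W_def)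
  have 0: "0 \<in> W t" by (simp add: W_def f_def)
  have "germ_of (f t) \<in> Diff G" unfolding Diff_def mem_Collect_eq
    using hom opn[OF t1(1)] opn[OF t1(2)] 0 jac smooth_on_subset[OF sm[OF t1(1)] sub]
      smooth_on_subset[OF sm[OF t1(2)] sub]
    by (intro exI[of _ "f t"] conjI refl exI[of _ "W t"] exI[of _ "W (- t)"] exI[of _ "f (- t)"])
      (auto simp: f_def)
  then show ?thesis by (simp add: f_def[abs_def])
qed

lemma time_map_in_Diff0: "germ_of (\<lambda>y. flow Q (y, 1)) \<in> Diff0 G"
proof -
  have "{0} \<times> {0..1} \<subseteq> ball (0 :: (real^'p) \<times> real) 2"
    using flow_domain[of 0] by (auto simp del: mem_ball)
  then have "isotopic_to_id G (germ_of (\<lambda>y. flow Q (y, 1)))"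
    unfolding isotopic_to_id_def using smooth_on_flow time_map_in_Diff
    by (intro exI[of _ "flow Q"] exI[of _ "ball 0 2"]) auto
  then show ?thesis using time_map_in_Diff[of 1] by (simp add: Diff0_def)
qed

text \<open>By homogeneity, a time-one map that is linear near 0 makes the trajectory of a small y
  constant, equal to A y on (0, 1]. Its velocity Q(A y, A y) vanishes, and continuity at time 0
  gives A y = y; scaling and polarization extend Q(y, y) = 0 to all pairs.\<close>

lemma linear_time_map_imp_zero:
  assumes "germ_of (\<lambda>y. flow Q (y, 1)) = matrix_germ A"
  shows "Q x y = 0"
proof -
  obtain S where S: "open S" "0 \<in> S" "\<And>y. y \<in> S \<Longrightarrow> flow Q (y, 1) = A *v y"
    using assms by (auto simp: matrix_germ_def germ_of_eq_iff)
  obtain r where r: "r > 0" "ball 0 r \<subseteq> S" using S openE by blast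
  have diag: "Q y y = 0" if y: "y \<in> ball 0 (min r 1)" for y
  proof -
    have const: "flow Q (y, s) = A *v y" if s: "s \<in> {0<..1}" for s
    proof -
      have "norm (s *\<^sub>R y) \<le> 1 * norm y" unfolding norm_scaleR using s by (intro mult_right_mono) auto
      then have "s *\<^sub>R y \<in> S" using y r(2) by auto
      from S(3)[OF this] have "s *\<^sub>R flow Q (y, s * 1) = s *\<^sub>R (A *v y)"
        using flow_scaleR[of y s 1] flow_domain[of y s] y s by (simp add: matrix_vector_mult_scaleR)
      then show ?thesis using s by simp
    qed
    have vd: "((\<lambda>s. flow Q (y, s)) has_vector_derivative Q (flow Q (y, s)) (flow Q (y, s))) (at s)"
      if "\<bar>s\<bar> \<le> 1" for s
      using y that by (intro flow_has_vector_derivative flow_domain) auto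
    \<comment> \<open>Time 1/2 is an interior point of the interval on which the trajectory is
      constant.\<close>
    have "((\<lambda>s. A *v y) has_vector_derivative Q (flow Q (y, 1 / 2)) (flow Q (y, 1 / 2))) (at (1 / 2))"
      by (rule has_vector_derivative_transform_within_open[OF vd open_greaterThanLessThan[of 0 1]])
        (use const in auto)
    from vector_derivative_unique_at[OF this has_vector_derivative_const]
    have "Q (A *v y) (A *v y) = 0" using const[of "1 / 2"] by simp
    moreover have "A *v y = y"
    proof -
      have "((\<lambda>s. flow Q (y, s)) \<longlongrightarrow> flow Q (y, 0)) (at_right 0)"
        using has_vector_derivative_continuous[OF vd[of 0]]
        by (auto simp: continuous_at intro: filterlim_mono[OF _ order_refl at_le])
      moreover have "\<forall>\<^sub>F s in at_right 0. flow Q (y, s) = A *v y"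
        unfolding eventually_at_right_field by (intro exI[of _ 1]) (auto intro: const)
      ultimately have "((\<lambda>s. A *v y) \<longlongrightarrow> flow Q (y, 0)) (at_right (0::real))"
        by (simp add: tendsto_cong)
      then show ?thesis using tendsto_unique[OF trivial_limit_at_right_real _ tendsto_const] by fastforce
    qed
    ultimately show ?thesis by simp
  qed
  have all: "Q y y = 0" for y
  proof -
    define N where "N = norm y + 1"
    have N: "N > 0" "norm y < N" by (simp_all add: N_def add_nonneg_pos)
    define c where "c = min r 1 / N"
    have c: "c > 0" using N r by (simp add: c_def)
    have "norm (c *\<^sub>R y) = c * norm y" using c by simp
    also have "\<dots> < c * N" using N c by (intro mult_strict_left_mono) auto
    also have "\<dots> = min r 1" using N by (simp add: c_def)
    finally have "c *\<^sub>R y \<in> ball 0 (min r 1)" by (simp only: mem_ball_0)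
    from diag[OF this] show ?thesis using c by (simp add: scaleR_left scaleR_right)
  qed
  have "Q (x + y) (x + y) = 2 *\<^sub>R Q x y"
    unfolding add_left add_right using all sym[of y x] by (simp add: scaleR_2)
  then show ?thesis using all[of "x + y"] by simp
qed

end

lemma Diff0_linear_imp_prolongation_trivial:
  fixes G :: "(real^'p^'p) set"
  assumes G: "linear_Lie_group G" and lin: "Diff0 G \<subseteq> range matrix_germ"
  shows "prolongation_trivial G"
  unfolding prolongation_trivial_def
proof (intro allI impI, elim conjE)
  fix B :: "real^'p \<Rightarrow> real^'p \<Rightarrow> real^'p"
  assume B: "bilinear B" "\<forall>v w. B v w = B w v" "\<forall>v. matrix (B v) \<in> lie_algebra G"
  obtain s where s: "s > 0" "quadratic_field (\<lambda>x y. s *\<^sub>R B x y) (1 / 8)"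
    using quadratic_field_scaled[of B] B(1) bilinear_conv_bounded_bilinear by blast
  interpret quadratic_field "\<lambda>x y. s *\<^sub>R B x y" "1 / 8" by fact
  interpret prolongation_field "\<lambda>x y. s *\<^sub>R B x y" "1 / 8" G
  proof
    show "s *\<^sub>R B x y = s *\<^sub>R B y x" for x y using B(2) by simp
    have "matrix (\<lambda>y. s *\<^sub>R B x y) = s *\<^sub>R matrix (B x)" for x by (simp add: matrix_def vec_eq_iff)
    then show "matrix (\<lambda>y. s *\<^sub>R B x y) \<in> lie_algebra G" for x
      using lie_algebra_scaleR[of "matrix (B x)" G s] B(3) by simp
  qed (rule G)
  obtain A where "germ_of (\<lambda>y. flow (\<lambda>x y. s *\<^sub>R B x y) (y, 1)) = matrix_germ A"
    using time_map_in_Diff0 lin by blast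
  from linear_time_map_imp_zero[OF this] s(1) show "B = (\<lambda>v w. 0)" by (simp add: fun_eq_iff)
qed

theorem theorem7p1:
  fixes G :: "(real ^ 'p ^ 'p) set"
  assumes "linear_Lie_group G" and "connected G"
  shows "(lin_isomorphic (lie_algebra G) (theta0 G)
            \<longleftrightarrow> (\<forall>\<eta>\<in>theta0 G. \<forall>i. linear_germ (component_germ \<eta> i)))
       \<and> ((\<forall>\<eta>\<in>theta0 G. \<forall>i. linear_germ (component_germ \<eta> i))
            \<longleftrightarrow> Diff0 G = matrix_germ ` G)"
proof -
  note G = assms
  have triv: "(\<forall>\<eta>\<in>theta0 G. \<exists>A. \<eta> = matrix_germ A) \<longleftrightarrow> prolongation_trivial G"
    using linear_imp_prolongation_trivial[of G] prolongation_trivial_imp_linear[OF G(1)] by blast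
  have "prolongation_trivial G \<longleftrightarrow> Diff0 G = matrix_germ ` G"
  proof
    assume "prolongation_trivial G"
    then have "Diff0 G \<subseteq> matrix_germ ` G"
      using prolongation_trivial_imp_Diff_linear[OF G(1)] by (auto simp: Diff0_def)
    moreover have "matrix_germ ` G \<subseteq> Diff0 G" using matrix_germ_in_Diff0[OF G] by blast
    ultimately show "Diff0 G = matrix_germ ` G" by (rule equalityI)
  next
    assume "Diff0 G = matrix_germ ` G"
    then show "prolongation_trivial G" using Diff0_linear_imp_prolongation_trivial[OF G(1)] by blast
  qed
  with triv lin_isomorphic_iff_linear[OF G(1)] show ?thesis by (simp add: linear_components_iff)
qed

end
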